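(* Let $\mathcal C$ be a small $\mathbb C$-linear category, let $p\in[1,\infty)$, and let $(\mathscr{H},\mathcal F)$ be a $p$-summable even Fredholm module over $\mathcal C$. Let $m\ge 0$ be an integer with $2m \geq p-1$. Then the tuple $(\Omega'\mathcal C,\partial',\hat{Tr}_s,\rho')$ defines a $2m$-dimensional cycle over $\mathcal C$. Moreover $\phi^{2m} \in CN^{2m}(\mathcal{C})$ defined by $$\phi^{2m}(f^0 \otimes f^1 \otimes \ldots \otimes f^{2m}):= Tr_s\left(\mathscr H({f}^0)[\mathcal F,f^1][\mathcal F,f^2] \cdots [\mathcal F,f^{2m}]\right)$$ for any $f^0 \otimes f^1 \otimes \ldots \otimes f^{2m} \in Hom_{\mathcal{C}}(X_1,X) \otimes Hom_{\mathcal{C}}(X_2,X_1) \otimes \ldots \otimes Hom_{\mathcal{C}}(X,X_{2m})$ is a cyclic cocycle over $\mathcal C$.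
   Context: **Fredholm modules.** $SHilb_{\mathbb Z_2}$ is the category of $\mathbb Z_2$-graded separable complex Hilbert spaces with bounded linear maps. $\mathcal B(\mathcal H_1,\mathcal H_2)$ denotes bounded operators and $\mathcal B^p(\mathcal H_1,\mathcal H_2)$ the $p$-th Schatten class (compact $T$ with $\sum\mu_n(T)^p<\infty$, $\mu_n$ the singular values). A $p$-summable even Fredholm module over $\mathcal C$ is a pair $(\mathscr H,\mathcal F)$: a functor $\mathscr H:\mathcal C\to SHilb_{\mathbb Z_2}$ with each $\mathscr H(f)$ of degree $0$ (linear on Hom spaces), and a family $\mathcal F=\{\mathcal F_X:\mathscr H(X)\to\mathscr H(X)\}_{X\in Ob(\mathcal C)}$ of bounded operators of degree $1$ with $\mathcal F_X^2=\mathrm{id}$, such that for each $f\in Hom_{\mathcal C}(X,Y)$, $[\mathcal F,f]:=\mathcal F_Y\mathscr H(f)-\mathscr H(f)\mathcal F_X\in\mathcal B^p(\mathscr H(X),\mathscr H(Y))$. **The DG-semicategory $\Omega'\mathcal C$.** A semicategory is a category without the requirement of identities. $\Omega'\mathcal C$ has the objects of $\mathcal C$, and $Hom^j_{\Omega'\mathcal C}(X,Y)$ is the linear span in $\mathcal B(\mathscr H(X),\mathscr H(Y))$ of the operators $(\mathscr H(f^0)+\mu\cdot\mathrm{id})[\mathcal F,f^1]\cdots[\mathcal F,f^j]$, where $f^0\in Hom_{\mathcal C}(X_1,Y)$, $f^1\in Hom_{\mathcal C}(X_2,X_1),\dots,f^j\in Hom_{\mathcal C}(X,X_j)$ and $\mu\in\mathbb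 C$, with $\mu=0$ if $X_1\ne Y$ or $j=0$ (for $j=0$: operators $\mathscr H(f^0)$, $f^0\in Hom_{\mathcal C}(X,Y)$). Composition is composition of operators. The differential is $\partial'T=\mathcal F_Y T-(-1)^{|T|}T\mathcal F_X$. $\rho':\mathcal C\to\Omega'^0\mathcal C$ is the identity on objects and $f\mapsto\mathscr H(f)$. For $T\in Hom^{2m}_{\Omega'\mathcal C}(X,X)$, $Tr_s(T):=\tfrac12Tr(\epsilon\,\mathcal F_X\,\partial'(T))$, where $\epsilon$ is the grading operator and $Tr$ the operator trace; $\hat{Tr}_s=\{Tr_s:Hom^{2m}_{\Omega'\mathcal C}(X,X)\to\mathbb C\}_{X\in Ob(\mathcal C)}$. **Cycles.** A DG-semicategory $(\mathcal S,\hat\partial)$ is a $\mathbb C$-linear semicategory whose Hom spaces are cochain complexes in degrees $\ge 0$, with composition additive in degrees and $\hat\partial(gf)=\hat\partial(g)f+(-1)^{\deg g}g\hat\partial(f)$; $\mathcal S^0$ is its degree-$0$ part. A closed graded trace of dimension $n$ on it is a collection of linear maps $\hat T_X:Hom^n_{\mathcal S}(X,X)\to\mathbb C$ with $\hat T_X(\hat\partial^{n-1}(f))=0$ for $f\in Hom^{n-1}_{\mathcal S}(X,X)$ and $\hat T_X(gg')=(-1)^{ij}\hat T_Y(g'g)$ for $g\in Hom^i_{\mathcal S}(Y,X)$, $g'\in Hom^j_{\mathcal S}(X,Y)$, $i+j=n$. An $n$-dimensional cycle over $\mathcal C$ is a tuple $(\mathcal S,\hat\partial,\hat T,\rho)$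 where $\hat T$ is a closed graded trace of dimension $n$ on $(\mathcal S,\hat\partial)$ and $\rho:\mathcal C\to\mathcal S^0$ is a linear semifunctor (a composition-preserving assignment). **Cyclic cocycles.** $CN_n(\mathcal C)=\bigoplus_{(X_0,\dots,X_n)}Hom_{\mathcal C}(X_1,X_0)\otimes Hom_{\mathcal C}(X_2,X_1)\otimes\cdots\otimes Hom_{\mathcal C}(X_0,X_n)$ and $CN^n(\mathcal C)$ is its linear dual. A cyclic $n$-cocycle is $\phi\in CN^n(\mathcal C)$ with $b\phi=0$ and $\lambda\phi=\phi$, where $(b\phi)(f^0\otimes\cdots\otimes f^{n+1})=\sum_{i=0}^n(-1)^i\phi(f^0\otimes\cdots\otimes f^if^{i+1}\otimes\cdots\otimes f^{n+1})+(-1)^{n+1}\phi(f^{n+1}f^0\otimes f^1\otimes\cdots\otimes f^n)$ and $(\lambda\phi)(f^0\otimes\cdots\otimes f^n)=(-1)^n\phi(f^n\otimes f^0\otimes\cdots\otimes f^{n-1})$. *)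

theory Defs
  imports "HOL-Analysis.Analysis"
begin

section \<open>Complex vector spaces and complex Hilbert spaces\<close>

class complex_vector = real_vector +
  fixes scaleC :: "complex \<Rightarrow> 'a \<Rightarrow> 'a"  (infixr "*\<^sub>C" 75)
  assumes scaleC_add_right: "c *\<^sub>C (x + y) = c *\<^sub>C x + c *\<^sub>C y"
    and scaleC_add_left: "(c + d) *\<^sub>C x = c *\<^sub>C x + d *\<^sub>C x"
    and scaleC_scaleC: "c *\<^sub>C (d *\<^sub>C x) = (c * d) *\<^sub>C x"
    and scaleC_one: "1 *\<^sub>C x = x"
    and scaleR_scaleC: "r *\<^sub>R x = complex_of_real r *\<^sub>C x"

global_interpretation complex_vector: vector_space "scaleC :: complex \<Rightarrow> 'a \<Rightarrow> 'a::complex_vector"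
  by standard (simp_all add: scaleC_add_right scaleC_add_left scaleC_scaleC scaleC_one)

instantiation complex :: complex_vector
begin
definition scaleC_complex :: "complex \<Rightarrow> complex \<Rightarrow> complex" where "scaleC_complex c x = c * x"
instance
  by standard (simp_all add: scaleC_complex_def algebra_simps scaleR_conv_of_real)
end

definition clinear_on :: "'a::complex_vector set \<Rightarrow> ('a \<Rightarrow> 'b::complex_vector) \<Rightarrow> bool" where
  "clinear_on S f \<longleftrightarrow>
     (\<forall>x\<in>S. \<forall>y\<in>S. f (x + y) = f x + f y) \<and> (\<forall>c. \<forall>x\<in>S. f (c *\<^sub>C x) = c *\<^sub>C f x)"

text \<open>The inner product is conjugate-linear in the first argument; norm and topology are those of
  its real part.\<close>

class complex_hilbert_space = complex_vector + real_inner + complete_space +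
  fixes cinner :: "'a \<Rightarrow> 'a \<Rightarrow> complex"
  assumes cinner_commute: "cinner x y = cnj (cinner y x)"
    and cinner_add_right: "cinner x (y + z) = cinner x y + cinner x z"
    and cinner_scaleC_right: "cinner x (c *\<^sub>C y) = c * cinner x y"
    and inner_eq_Re_cinner: "inner x y = Re (cinner x y)"

lemma norm_scaleC: "norm (c *\<^sub>C x) = cmod c * norm (x :: 'a::complex_hilbert_space)"
proof -
  have "cinner (c *\<^sub>C x) (c *\<^sub>C x) = c * cnj c * cinner x x"
    by (metis cinner_commute cinner_scaleC_right complex_cnj_mult mult.assoc)
  also have "c * cnj c = complex_of_real ((cmod c)\<^sup>2)"
    using complex_norm_square[of c] by simp
  finally have "Re (cinner (c *\<^sub>C x) (c *\<^sub>C x)) = (cmod c)\<^sup>2 * Re (cinner x x)"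
    by simp
  then show ?thesis
    by (simp add: norm_eq_sqrt_inner inner_eq_Re_cinner real_sqrt_mult)
qed

lemma bounded_linear_scaleC: "bounded_linear (\<lambda>x :: 'a::complex_hilbert_space. c *\<^sub>C x)"
  by (rule bounded_linear_intro[where K = "cmod c"])
     (simp_all add: scaleC_add_right scaleR_scaleC scaleC_scaleC norm_scaleC mult.commute)

instantiation blinfun :: (real_normed_vector, complex_hilbert_space) complex_vector
begin
definition scaleC_blinfun :: "complex \<Rightarrow> ('a \<Rightarrow>\<^sub>L 'b) \<Rightarrow> ('a \<Rightarrow>\<^sub>L 'b)" where
  "scaleC_blinfun c T = Blinfun (\<lambda>x. c *\<^sub>C blinfun_apply T x)"

lemma blinfun_apply_scaleC: "blinfun_apply (c *\<^sub>C T) x = c *\<^sub>C blinfun_apply T x"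
  for T :: "'a \<Rightarrow>\<^sub>L 'b"
  unfolding scaleC_blinfun_def
  by (subst bounded_linear_Blinfun_apply)
     (auto intro: bounded_linear_compose[OF bounded_linear_scaleC] blinfun.bounded_linear_right)

instance
  by standard
     (auto intro!: blinfun_eqI simp: blinfun_apply_scaleC blinfun.add_left blinfun.scaleR_left
        scaleC_add_right scaleC_add_left scaleC_scaleC scaleC_one scaleR_scaleC)
end

section \<open>Graded separable Hilbert spaces and operators between them\<close>

text \<open>
  The members of a family of separable Hilbert spaces are represented as closed subspaces of one
  Hilbert space \<open>'h\<close> of arbitrary dimension.  This loses no generality, since any family of Hilbert
  spaces embeds isometrically into its Hilbert direct sum.  A graded space is given by its even and
  its odd part.
\<close>

record 'h graded_space =
  even_part :: "'h set"
  odd_part :: "'h set"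

definition separable_subspace :: "'h::complex_hilbert_space set \<Rightarrow> bool" where
  "separable_subspace S \<longleftrightarrow> complex_vector.subspace S \<and> closed S \<and>
     (\<exists>D. countable D \<and> D \<subseteq> S \<and> S \<subseteq> closure D)"

definition graded_hilbert :: "'h::complex_hilbert_space graded_space \<Rightarrow> bool" where
  "graded_hilbert V \<longleftrightarrow> separable_subspace (even_part V) \<and> separable_subspace (odd_part V) \<and>
     (\<forall>x\<in>even_part V. \<forall>y\<in>odd_part V. cinner x y = 0)"

definition space_of :: "'h::complex_hilbert_space graded_space \<Rightarrow> 'h set" where
  "space_of V = {x + y | x y. x \<in> even_part V \<and> y \<in> odd_part V}"

text \<open>
  A bounded operator \<open>V \<rightarrow> W\<close> is represented by its extension to \<open>'h\<close> by zero on the orthogonal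
  complement of \<open>V\<close>.  Under this representation, composition, linear combinations and adjoints of
  operators are those of operators on \<open>'h\<close>, and the identity of \<open>V\<close> is the orthogonal projection
  onto \<open>V\<close>.
\<close>

definition operators ::
  "'h::complex_hilbert_space graded_space \<Rightarrow> 'h graded_space \<Rightarrow> ('h \<Rightarrow>\<^sub>L 'h) set" where
  "operators V W = {T. (\<forall>c x. blinfun_apply T (c *\<^sub>C x) = c *\<^sub>C blinfun_apply T x) \<and>
     (\<forall>x\<in>space_of V. blinfun_apply T x \<in> space_of W) \<and>
     (\<forall>x. (\<forall>v\<in>space_of V. cinner v x = 0) \<longrightarrow> blinfun_apply T x = 0)}"

definition orth_proj :: "'h::complex_hilbert_space set \<Rightarrow> ('h \<Rightarrow>\<^sub>L 'h)" where
  "orth_proj S = (THE P. \<forall>x. blinfun_apply P x \<in> S \<and>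
     (\<forall>y\<in>S. cinner y (x - blinfun_apply P x) = 0))"

definition ident_op :: "'h::complex_hilbert_space graded_space \<Rightarrow> ('h \<Rightarrow>\<^sub>L 'h)" where
  "ident_op V = orth_proj (space_of V)"

definition grading_op :: "'h::complex_hilbert_space graded_space \<Rightarrow> ('h \<Rightarrow>\<^sub>L 'h)" where
  "grading_op V = orth_proj (even_part V) - orth_proj (odd_part V)"

definition degree0_op ::
  "'h::complex_hilbert_space graded_space \<Rightarrow> 'h graded_space \<Rightarrow> ('h \<Rightarrow>\<^sub>L 'h) \<Rightarrow> bool" where
  "degree0_op V W T \<longleftrightarrow> (\<forall>x\<in>even_part V. blinfun_apply T x \<in> even_part W) \<and>
     (\<forall>x\<in>odd_part V. blinfun_apply T x \<in> odd_part W)"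

definition degree1_op ::
  "'h::complex_hilbert_space graded_space \<Rightarrow> 'h graded_space \<Rightarrow> ('h \<Rightarrow>\<^sub>L 'h) \<Rightarrow> bool" where
  "degree1_op V W T \<longleftrightarrow> (\<forall>x\<in>even_part V. blinfun_apply T x \<in> odd_part W) \<and>
     (\<forall>x\<in>odd_part V. blinfun_apply T x \<in> even_part W)"

section \<open>Schatten classes and the trace\<close>

definition hadjoint :: "('h::complex_hilbert_space \<Rightarrow>\<^sub>L 'h) \<Rightarrow> ('h \<Rightarrow>\<^sub>L 'h)" where
  "hadjoint T = (THE S. \<forall>x y. cinner (blinfun_apply T x) y = cinner x (blinfun_apply S y))"

definition compact_operator :: "('h::complex_hilbert_space \<Rightarrow>\<^sub>L 'h) \<Rightarrow> bool" where
  "compact_operator T \<longleftrightarrow> compact (closure (blinfun_apply T ` cball 0 1))"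

text \<open>
  Multiplicity of \<open>s > 0\<close> as a singular value of \<open>T\<close>, i.e. of \<open>s\<^sup>2\<close> as an eigenvalue of \<open>T\<^sup>* T\<close>.
  For compact \<open>T\<close> the eigenspace is finite-dimensional, so that \<open>dim\<close> is its true dimension.  If
  \<open>T\<close> is the extension by zero of an operator on \<open>V\<close>, the eigenspace is contained in \<open>V\<close>.
\<close>

definition singular_multiplicity :: "('h::complex_hilbert_space \<Rightarrow>\<^sub>L 'h) \<Rightarrow> real \<Rightarrow> nat" where
  "singular_multiplicity T s =
     complex_vector.dim {x. blinfun_apply (hadjoint T o\<^sub>L T) x = (s\<^sup>2) *\<^sub>R x}"

text \<open>The sum over \<open>s\<close> below is the sum of the \<open>p\<close>-th powers of the singular values, each taken
  as often as its multiplicity.\<close>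

definition schatten ::
  "real \<Rightarrow> 'h::complex_hilbert_space graded_space \<Rightarrow> 'h graded_space \<Rightarrow> ('h \<Rightarrow>\<^sub>L 'h) set" where
  "schatten p V W = {T \<in> operators V W. compact_operator T \<and>
     (\<lambda>s. real (singular_multiplicity T s) * s powr p) summable_on {0<..}}"

definition orthonormal_basis_of :: "'h::complex_hilbert_space set \<Rightarrow> 'h set \<Rightarrow> bool" where
  "orthonormal_basis_of S B \<longleftrightarrow> B \<subseteq> S \<and>
     (\<forall>e\<in>B. \<forall>e'\<in>B. cinner e e' = (if e = e' then 1 else 0)) \<and>
     S \<subseteq> closure (complex_vector.span B)"

text \<open>For trace class \<open>T\<close> the sum converges absolutely for every orthonormal basis, to a value that
  does not depend on the basis; otherwise the value of \<open>op_trace\<close> is unspecified.\<close>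

definition op_trace :: "'h::complex_hilbert_space graded_space \<Rightarrow> ('h \<Rightarrow>\<^sub>L 'h) \<Rightarrow> complex" where
  "op_trace V T = (THE t. \<forall>B. orthonormal_basis_of (space_of V) B \<longrightarrow>
     ((\<lambda>e. cinner e (blinfun_apply T e)) has_sum t) B)"

section \<open>Linear categories and Fredholm modules\<close>

text \<open>
  The Hom spaces are subspaces of one complex vector space \<open>'a\<close> (in general the direct sum of all
  Hom spaces), and \<open>Hom C X Y\<close> consists of the morphisms from \<open>X\<close> to \<open>Y\<close>.  Since they are not
  disjoint, the morphism maps of functors take source and target as extra arguments.
\<close>

record ('o, 'a) category =
  Obj :: "'o set"
  Hom :: "'o \<Rightarrow> 'o \<Rightarrow> 'a set"
  Comp :: "'a \<Rightarrow> 'a \<Rightarrow> 'a"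
  Ident :: "'o \<Rightarrow> 'a"

definition linear_category :: "('o, 'a::complex_vector) category \<Rightarrow> bool" where
  "linear_category C \<longleftrightarrow>
     (\<forall>X\<in>Obj C. \<forall>Y\<in>Obj C. complex_vector.subspace (Hom C X Y)) \<and>
     (\<forall>X\<in>Obj C. \<forall>Y\<in>Obj C. \<forall>Z\<in>Obj C. \<forall>f\<in>Hom C X Y. \<forall>g\<in>Hom C Y Z. Comp C g f \<in> Hom C X Z) \<and>
     (\<forall>X\<in>Obj C. \<forall>Y\<in>Obj C. \<forall>Z\<in>Obj C.
        (\<forall>f\<in>Hom C X Y. clinear_on (Hom C Y Z) (\<lambda>g. Comp C g f)) \<and>
        (\<forall>g\<in>Hom C Y Z. clinear_on (Hom C X Y) (\<lambda>f. Comp C g f))) \<and>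
     (\<forall>W\<in>Obj C. \<forall>X\<in>Obj C. \<forall>Y\<in>Obj C. \<forall>Z\<in>Obj C.
        \<forall>f\<in>Hom C W X. \<forall>g\<in>Hom C X Y. \<forall>h\<in>Hom C Y Z.
          Comp C (Comp C h g) f = Comp C h (Comp C g f)) \<and>
     (\<forall>X\<in>Obj C. Ident C X \<in> Hom C X X) \<and>
     (\<forall>X\<in>Obj C. \<forall>Y\<in>Obj C. \<forall>f\<in>Hom C X Y. Comp C f (Ident C X) = f \<and> Comp C (Ident C Y) f = f)"

record (overloaded) ('o, 'a, 'h) fredholm_data =
  Hsp :: "'o \<Rightarrow> 'h graded_space"
  Hmap :: "'o \<Rightarrow> 'o \<Rightarrow> 'a \<Rightarrow> ('h \<Rightarrow>\<^sub>L 'h)"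
  Fop :: "'o \<Rightarrow> ('h \<Rightarrow>\<^sub>L 'h)"

definition commutator ::
  "('o, 'a, 'h::complex_hilbert_space) fredholm_data \<Rightarrow> 'o \<Rightarrow> 'o \<Rightarrow> 'a \<Rightarrow> ('h \<Rightarrow>\<^sub>L 'h)" where
  "commutator M X Y f = (Fop M Y o\<^sub>L Hmap M X Y f) - (Hmap M X Y f o\<^sub>L Fop M X)"

definition graded_hilbert_functor ::
  "('o, 'a::complex_vector) category \<Rightarrow> ('o, 'a, 'h::complex_hilbert_space) fredholm_data \<Rightarrow> bool" where
  "graded_hilbert_functor C M \<longleftrightarrow>
     (\<forall>X\<in>Obj C. graded_hilbert (Hsp M X)) \<and>
     (\<forall>X\<in>Obj C. \<forall>Y\<in>Obj C. clinear_on (Hom C X Y) (Hmap M X Y) \<and>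
        (\<forall>f\<in>Hom C X Y. Hmap M X Y f \<in> operators (Hsp M X) (Hsp M Y) \<and>
           degree0_op (Hsp M X) (Hsp M Y) (Hmap M X Y f))) \<and>
     (\<forall>X\<in>Obj C. Hmap M X X (Ident C X) = ident_op (Hsp M X)) \<and>
     (\<forall>X\<in>Obj C. \<forall>Y\<in>Obj C. \<forall>Z\<in>Obj C. \<forall>f\<in>Hom C X Y. \<forall>g\<in>Hom C Y Z.
        Hmap M X Z (Comp C g f) = Hmap M Y Z g o\<^sub>L Hmap M X Y f)"

definition even_fredholm_module ::
  "real \<Rightarrow> ('o, 'a::complex_vector) category \<Rightarrow> ('o, 'a, 'h::complex_hilbert_space) fredholm_data \<Rightarrow> bool" where
  "even_fredholm_module p C M \<longleftrightarrow>
     graded_hilbert_functor C M \<and>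
     (\<forall>X\<in>Obj C. Fop M X \<in> operators (Hsp M X) (Hsp M X) \<and>
        degree1_op (Hsp M X) (Hsp M X) (Fop M X) \<and>
        Fop M X o\<^sub>L Fop M X = ident_op (Hsp M X)) \<and>
     (\<forall>X\<in>Obj C. \<forall>Y\<in>Obj C. \<forall>f\<in>Hom C X Y. commutator M X Y f \<in> schatten p (Hsp M X) (Hsp M Y))"

section \<open>DG-semicategories, closed graded traces and cycles\<close>

text \<open>
  \<open>GHom S j X Y\<close> is the degree \<open>j\<close> part of the graded Hom space from \<open>X\<close> to \<open>Y\<close>.  The graded Hom
  space is the external direct sum of these; for different \<open>j\<close> they may overlap as sets, so
  the differential \<open>d j X Y\<close> carries the degree as an argument.
\<close>

record ('o, 'a) graded_semicategory =
  GObj :: "'o set"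
  GHom :: "nat \<Rightarrow> 'o \<Rightarrow> 'o \<Rightarrow> 'a set"
  GComp :: "'a \<Rightarrow> 'a \<Rightarrow> 'a"

definition dg_semicategory ::
  "('o, 'a::complex_vector) graded_semicategory \<Rightarrow> (nat \<Rightarrow> 'o \<Rightarrow> 'o \<Rightarrow> 'a \<Rightarrow> 'a) \<Rightarrow> bool" where
  "dg_semicategory S d \<longleftrightarrow>
     (\<forall>X\<in>GObj S. \<forall>Y\<in>GObj S. \<forall>j. complex_vector.subspace (GHom S j X Y)) \<and>
     (\<forall>X\<in>GObj S. \<forall>Y\<in>GObj S. \<forall>Z\<in>GObj S. \<forall>i j. \<forall>f\<in>GHom S j X Y. \<forall>g\<in>GHom S i Y Z.
        GComp S g f \<in> GHom S (i + j) X Z) \<and>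
     (\<forall>X\<in>GObj S. \<forall>Y\<in>GObj S. \<forall>Z\<in>GObj S. \<forall>i j.
        (\<forall>f\<in>GHom S j X Y. clinear_on (GHom S i Y Z) (\<lambda>g. GComp S g f)) \<and>
        (\<forall>g\<in>GHom S i Y Z. clinear_on (GHom S j X Y) (\<lambda>f. GComp S g f))) \<and>
     (\<forall>W\<in>GObj S. \<forall>X\<in>GObj S. \<forall>Y\<in>GObj S. \<forall>Z\<in>GObj S. \<forall>i j k.
        \<forall>f\<in>GHom S k W X. \<forall>g\<in>GHom S j X Y. \<forall>h\<in>GHom S i Y Z.
          GComp S (GComp S h g) f = GComp S h (GComp S g f)) \<and>
     (\<forall>X\<in>GObj S. \<forall>Y\<in>GObj S. \<forall>j. clinear_on (GHom S j X Y) (d j X Y) \<and>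
        (\<forall>f\<in>GHom S j X Y. d j X Y f \<in> GHom S (Suc j) X Y \<and> d (Suc j) X Y (d j X Y f) = 0)) \<and>
     (\<forall>X\<in>GObj S. \<forall>Y\<in>GObj S. \<forall>Z\<in>GObj S. \<forall>i j. \<forall>f\<in>GHom S j X Y. \<forall>g\<in>GHom S i Y Z.
        d (i + j) X Z (GComp S g f) =
          GComp S (d i Y Z g) f + (- 1) ^ i *\<^sub>R GComp S g (d j X Y f))"

definition closed_graded_trace ::
  "nat \<Rightarrow> ('o, 'a::complex_vector) graded_semicategory \<Rightarrow> (nat \<Rightarrow> 'o \<Rightarrow> 'o \<Rightarrow> 'a \<Rightarrow> 'a) \<Rightarrow>
     ('o \<Rightarrow> 'a \<Rightarrow> complex) \<Rightarrow> bool" where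
  "closed_graded_trace n S d t \<longleftrightarrow>
     (\<forall>X\<in>GObj S. clinear_on (GHom S n X X) (t X)) \<and>
     (\<forall>X\<in>GObj S. \<forall>k. Suc k = n \<longrightarrow> (\<forall>f\<in>GHom S k X X. t X (d k X X f) = 0)) \<and>
     (\<forall>X\<in>GObj S. \<forall>Y\<in>GObj S. \<forall>i j. i + j = n \<longrightarrow>
        (\<forall>g\<in>GHom S i Y X. \<forall>g'\<in>GHom S j X Y.
           t X (GComp S g g') = (- 1) ^ (i * j) * t Y (GComp S g' g)))"

definition linear_semifunctor ::
  "('o, 'a::complex_vector) category \<Rightarrow> ('p, 'b::complex_vector) graded_semicategory \<Rightarrow>
     ('o \<Rightarrow> 'p) \<Rightarrow> ('o \<Rightarrow> 'o \<Rightarrow> 'a \<Rightarrow> 'b) \<Rightarrow> bool" where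
  "linear_semifunctor C S r\<^sub>0 r \<longleftrightarrow>
     (\<forall>X\<in>Obj C. r\<^sub>0 X \<in> GObj S) \<and>
     (\<forall>X\<in>Obj C. \<forall>Y\<in>Obj C. clinear_on (Hom C X Y) (r X Y) \<and>
        (\<forall>f\<in>Hom C X Y. r X Y f \<in> GHom S 0 (r\<^sub>0 X) (r\<^sub>0 Y))) \<and>
     (\<forall>X\<in>Obj C. \<forall>Y\<in>Obj C. \<forall>Z\<in>Obj C. \<forall>f\<in>Hom C X Y. \<forall>g\<in>Hom C Y Z.
        r X Z (Comp C g f) = GComp S (r Y Z g) (r X Y f))"

definition cycle_over ::
  "('o, 'a::complex_vector) category \<Rightarrow> nat \<Rightarrow>
     ('p, 'b::complex_vector) graded_semicategory \<Rightarrow> (nat \<Rightarrow> 'p \<Rightarrow> 'p \<Rightarrow> 'b \<Rightarrow> 'b) \<Rightarrow>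
     ('p \<Rightarrow> 'b \<Rightarrow> complex) \<Rightarrow> ('o \<Rightarrow> 'p) \<Rightarrow> ('o \<Rightarrow> 'o \<Rightarrow> 'a \<Rightarrow> 'b) \<Rightarrow> bool" where
  "cycle_over C n S d t r\<^sub>0 r \<longleftrightarrow>
     dg_semicategory S d \<and> closed_graded_trace n S d t \<and> linear_semifunctor C S r\<^sub>0 r"

section \<open>The DG-semicategory of a Fredholm module\<close>

text \<open>\<open>comm_word M X f A j\<close> is \<open>A [F, f\<^sup>1] \<cdots> [F, f\<^sup>j]\<close> for \<open>f\<^sup>i : X\<^sub>i\<^sub>+\<^sub>1 \<rightarrow> X\<^sub>i\<close>.\<close>

primrec comm_word ::
  "('o, 'a, 'h::complex_hilbert_space) fredholm_data \<Rightarrow> (nat \<Rightarrow> 'o) \<Rightarrow> (nat \<Rightarrow> 'a) \<Rightarrow>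
     ('h \<Rightarrow>\<^sub>L 'h) \<Rightarrow> nat \<Rightarrow> ('h \<Rightarrow>\<^sub>L 'h)" where
  "comm_word M Xs fs A 0 = A"
| "comm_word M Xs fs A (Suc j) =
     comm_word M Xs fs A j o\<^sub>L commutator M (Xs (Suc (Suc j))) (Xs (Suc j)) (fs (Suc j))"

definition Omega_hom ::
  "('o, 'a::complex_vector) category \<Rightarrow> ('o, 'a, 'h::complex_hilbert_space) fredholm_data \<Rightarrow>
     nat \<Rightarrow> 'o \<Rightarrow> 'o \<Rightarrow> ('h \<Rightarrow>\<^sub>L 'h) set" where
  "Omega_hom C M j X Y = complex_vector.span
     {comm_word M Xs fs (Hmap M (Xs 1) (Xs 0) (fs 0) + \<mu> *\<^sub>C ident_op (Hsp M Y)) j | Xs fs \<mu>.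
        Xs 0 = Y \<and> Xs (Suc j) = X \<and>
        (\<forall>i\<le>Suc j. Xs i \<in> Obj C) \<and>
        (\<forall>i\<le>j. fs i \<in> Hom C (Xs (Suc i)) (Xs i)) \<and>
        (Xs 1 \<noteq> Y \<or> j = 0 \<longrightarrow> \<mu> = 0)}"

definition Omega ::
  "('o, 'a::complex_vector) category \<Rightarrow> ('o, 'a, 'h::complex_hilbert_space) fredholm_data \<Rightarrow>
     ('o, 'h \<Rightarrow>\<^sub>L 'h) graded_semicategory" where
  "Omega C M = \<lparr>GObj = Obj C, GHom = Omega_hom C M, GComp = (o\<^sub>L)\<rparr>"

definition Omega_diff ::
  "('o, 'a, 'h::complex_hilbert_space) fredholm_data \<Rightarrow>
     nat \<Rightarrow> 'o \<Rightarrow> 'o \<Rightarrow> ('h \<Rightarrow>\<^sub>L 'h) \<Rightarrow> ('h \<Rightarrow>\<^sub>L 'h)" where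
  "Omega_diff M j X Y T = (Fop M Y o\<^sub>L T) - (- 1) ^ j *\<^sub>R (T o\<^sub>L Fop M X)"

definition strace_arg ::
  "('o, 'a, 'h::complex_hilbert_space) fredholm_data \<Rightarrow> nat \<Rightarrow> 'o \<Rightarrow> ('h \<Rightarrow>\<^sub>L 'h) \<Rightarrow> ('h \<Rightarrow>\<^sub>L 'h)" where
  "strace_arg M m X T = grading_op (Hsp M X) o\<^sub>L Fop M X o\<^sub>L Omega_diff M (2 * m) X X T"

definition strace ::
  "('o, 'a, 'h::complex_hilbert_space) fredholm_data \<Rightarrow> nat \<Rightarrow> 'o \<Rightarrow> ('h \<Rightarrow>\<^sub>L 'h) \<Rightarrow> complex" where
  "strace M m X T = 1 / 2 * op_trace (Hsp M X) (strace_arg M m X T)"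

section \<open>Cyclic cocycles\<close>

text \<open>
  An element \<open>f\<^sup>0 \<otimes> \<cdots> \<otimes> f\<^sup>n\<close> of the summand of \<open>CN\<^sub>n\<close> at \<open>(X\<^sub>0, \<dots>, X\<^sub>n)\<close> is represented by the
  lists \<open>[X\<^sub>0, \<dots>, X\<^sub>n]\<close> and \<open>[f\<^sup>0, \<dots>, f\<^sup>n]\<close>, with \<open>f\<^sup>i : X\<^sub>i\<^sub>+\<^sub>1 \<rightarrow> X\<^sub>i\<close> and \<open>X\<^sub>n\<^sub>+\<^sub>1 = X\<^sub>0\<close>.
  By the universal property of direct sums and tensor products, the linear dual \<open>CN\<^sup>n\<close> consists
  of the families of multilinear forms indexed by \<open>(X\<^sub>0, \<dots>, X\<^sub>n)\<close>.
\<close>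

definition pure_tensor :: "('o, 'a) category \<Rightarrow> nat \<Rightarrow> 'o list \<Rightarrow> 'a list \<Rightarrow> bool" where
  "pure_tensor C n Xs fs \<longleftrightarrow> length Xs = Suc n \<and> length fs = Suc n \<and> set Xs \<subseteq> Obj C \<and>
     (\<forall>i\<le>n. fs ! i \<in> Hom C (Xs ! (Suc i mod Suc n)) (Xs ! i))"

definition cochain ::
  "('o, 'a::complex_vector) category \<Rightarrow> nat \<Rightarrow> ('o list \<Rightarrow> 'a list \<Rightarrow> complex) \<Rightarrow> bool" where
  "cochain C n \<phi> \<longleftrightarrow> (\<forall>Xs fs. pure_tensor C n Xs fs \<longrightarrow>
     (\<forall>i\<le>n. clinear_on (Hom C (Xs ! (Suc i mod Suc n)) (Xs ! i)) (\<lambda>g. \<phi> Xs (fs[i := g]))))"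

definition hochschild_b ::
  "('o, 'a) category \<Rightarrow> nat \<Rightarrow> ('o list \<Rightarrow> 'a list \<Rightarrow> complex) \<Rightarrow> 'o list \<Rightarrow> 'a list \<Rightarrow> complex" where
  "hochschild_b C n \<phi> Xs fs =
     (\<Sum>i\<le>n. (- 1) ^ i * \<phi> (take (Suc i) Xs @ drop (Suc (Suc i)) Xs)
                          (take i fs @ Comp C (fs ! i) (fs ! Suc i) # drop (Suc (Suc i)) fs)) +
     (- 1) ^ Suc n * \<phi> (last Xs # butlast (tl Xs)) (Comp C (last fs) (hd fs) # butlast (tl fs))"

definition cyclic_op ::
  "nat \<Rightarrow> ('o list \<Rightarrow> 'a list \<Rightarrow> complex) \<Rightarrow> 'o list \<Rightarrow> 'a list \<Rightarrow> complex" where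
  "cyclic_op n \<phi> Xs fs = (- 1) ^ n * \<phi> (last Xs # butlast Xs) (last fs # butlast fs)"

definition cyclic_cocycle ::
  "('o, 'a::complex_vector) category \<Rightarrow> nat \<Rightarrow> ('o list \<Rightarrow> 'a list \<Rightarrow> complex) \<Rightarrow> bool" where
  "cyclic_cocycle C n \<phi> \<longleftrightarrow> cochain C n \<phi> \<and>
     (\<forall>Xs fs. pure_tensor C (Suc n) Xs fs \<longrightarrow> hochschild_b C n \<phi> Xs fs = 0) \<and>
     (\<forall>Xs fs. pure_tensor C n Xs fs \<longrightarrow> cyclic_op n \<phi> Xs fs = \<phi> Xs fs)"

definition character ::
  "('o, 'a, 'h::complex_hilbert_space) fredholm_data \<Rightarrow> nat \<Rightarrow> 'o list \<Rightarrow> 'a list \<Rightarrow> complex" where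
  "character M m Xs fs =
     (let X = (\<lambda>i. Xs ! (i mod Suc (2 * m))) in
        strace M m (X 0) (comm_word M X ((!) fs) (Hmap M (X 1) (X 0) (fs ! 0)) (2 * m)))"

end

theory Submission
  imports Defs
begin

text \<open>
  Trace class membership is obtained from finite rank approximation instead of Hoelder's inequality
  for Schatten norms.  If the compact operator \<open>T\<close> has \<open>N(t)\<close> singular values above \<open>t\<close>, counted
  with multiplicity, then \<open>N(t)\<close> is the least rank of an operator within distance \<open>t\<close> of \<open>T\<close>, and
  \<open>T\<close> is of class \<open>p\<close> if and only if \<open>\<Sum>\<^sub>j N(2\<^sup>-\<^sup>j) 2\<^sup>-\<^sup>p\<^sup>j\<close> converges.  In products errors multiply while
  ranks add, so a product of \<open>k \<ge> p\<close> operators of class \<open>p\<close> satisfies the condition for trace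
  class with \<open>2\<^sup>-\<^sup>k\<close> in place of \<open>2\<^sup>-\<^sup>1\<close>.

  For the graded trace property, expand \<open>\<epsilon> F \<delta>(S T)\<close> by the Leibniz rule.  Since \<open>\<epsilon>\<close> and \<open>F\<close> both
  anticommute in the graded sense with the boundary \<open>\<delta> S\<close>, this becomes
  \<open>\<delta> S (\<epsilon> F T) \<plusminus> (\<epsilon> F S) \<delta> T\<close>, and \<open>Tr(A B) = Tr(B A)\<close> exchanges its two terms with those of
  \<open>\<epsilon> F \<delta>(T S)\<close>.  Only one factor need be compact for the trace identity, as soon as both products are
  of trace class.
\<close>

text \<open>An operator of degree \<open>2 * m\<close> carries only \<open>2 * m\<close> commutators
  and need not be of trace class; differentiating supplies one more, and
  \<open>2 * m + 1 \<ge> p\<close> is what the count of factors asks for. In \<open>op_trace\<close>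
  the value is a definite description ranging over all bases, so an identity between traces can be
  used only once every operator in it, sums included, is known to be of trace class. That membership
  is therefore proved for linear spaces of operators rather than for single ones, and
  \<open>schatten_power\<close> is built so that closure under sums and products is easy.

  A second obstacle is the unit. Generators of positive degree may begin with a multiple of the
  identity, those of degree 0 may not, so the Hom spaces have no uniform recursive description. The
  algebra is carried out in the spaces \<open>unital_hom\<close>, which allow the unit in degree 0
  as well and agree with \<open>Omega_hom\<close> in positive degrees; degree 0 is treated
  separately where the two differ.\<close>

section \<open>Inner product identities and the Cauchy-Schwarz inequality\<close>

lemma cinner_add_left: "cinner (x + y) z = cinner x z + cinner y z"
  for x y z :: "'h::complex_hilbert_space"
  by (metis cinner_add_right cinner_commute complex_cnj_add)

lemma cinner_scaleC_left: "cinner (c *\<^sub>C x) y = cnj c * cinner x y"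
  for x y :: "'h::complex_hilbert_space"
  by (metis cinner_commute cinner_scaleC_right complex_cnj_mult)

lemma cinner_scaleR_left: "cinner (r *\<^sub>R x) y = of_real r * cinner x y"
  for x y :: "'h::complex_hilbert_space"
  by (simp add: scaleR_scaleC cinner_scaleC_left)

lemma cinner_scaleR_right: "cinner x (r *\<^sub>R y) = of_real r * cinner x y"
  for x y :: "'h::complex_hilbert_space"
  by (simp add: scaleR_scaleC cinner_scaleC_right)

lemma cinner_self: "cinner x x = of_real ((norm x)\<^sup>2)"
  for x :: "'h::complex_hilbert_space"
proof (rule complex_eqI)
  show "Re (cinner x x) = Re (of_real ((norm x)\<^sup>2))"
    by (simp add: dot_square_norm flip: inner_eq_Re_cinner)
  show "Im (cinner x x) = Im (of_real ((norm x)\<^sup>2))"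
    using arg_cong[OF cinner_commute[of x x], of Im] by simp
qed

text \<open>Multiplying \<open>y\<close> by a unimodular constant makes the inner product real and
  nonnegative, so the real Cauchy-Schwarz inequality applies.\<close>

lemma norm_cinner_le: "norm (cinner x y) \<le> norm x * norm y"
  for x y :: "'h::complex_hilbert_space"
proof (cases "cinner x y = 0")
  case False
  define c where "c = cnj (sgn (cinner x y))"
  have c: "norm c = 1"
    using False by (simp add: c_def norm_sgn)
  have "c * cinner x y = of_real (norm (cinner x y))"
    using False by (simp add: c_def sgn_div_norm scaleR_conv_of_real field_simps
        complex_norm_square[symmetric] power2_eq_square del: of_real_power)
  then have "norm (cinner x y) = Re (cinner x (c *\<^sub>C y))"
    by (simp add: cinner_scaleC_right)
  also have "\<dots> \<le> norm x * norm (c *\<^sub>C y)"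
    by (metis inner_eq_Re_cinner norm_cauchy_schwarz)
  finally show ?thesis
    using c by (simp add: norm_scaleC)
qed simp

lemma bounded_linear_cinner_right: "bounded_linear (cinner x)"
  for x :: "'h::complex_hilbert_space"
  by (rule bounded_linear_intro[where K = "norm x"])
     (simp_all add: cinner_add_right cinner_scaleR_right scaleR_conv_of_real
       norm_cinner_le mult.commute[of _ "norm x"])

lemma bounded_linear_cinner_left: "bounded_linear (\<lambda>x. cinner x y)"
  for y :: "'h::complex_hilbert_space"
  by (rule bounded_linear_intro[where K = "norm y"])
     (simp_all add: cinner_add_left cinner_scaleR_left scaleR_conv_of_real norm_cinner_le)

lemmas cinner_diff_right = linear_diff[OF bounded_linear.linear, OF bounded_linear_cinner_right]
  and cinner_diff_left = linear_diff[OF bounded_linear.linear, OF bounded_linear_cinner_left]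
  and cinner_zero_right [simp] = linear_0[OF bounded_linear.linear, OF bounded_linear_cinner_right]
  and cinner_zero_left [simp] = linear_0[OF bounded_linear.linear, OF bounded_linear_cinner_left]
  and cinner_sum_right = linear_sum[OF bounded_linear.linear, OF bounded_linear_cinner_right]
  and cinner_sum_left = linear_sum[OF bounded_linear.linear, OF bounded_linear_cinner_left]

lemma cinner_eq_zero_commute: "cinner x y = 0 \<longleftrightarrow> cinner y x = 0"
  for x y :: "'h::complex_hilbert_space"
  by (metis cinner_commute complex_cnj_zero)

text \<open>Upgrades real orthogonality to a complex subspace to complex orthogonality, since such a
  subspace contains the rotated vector as well.\<close>

lemma Im_cinner: "Im (cinner x y) = inner (\<i> *\<^sub>C x) y"
  for x y :: "'h::complex_hilbert_space"
  by (simp add: inner_eq_Re_cinner cinner_scaleC_left)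

lemma cinner_extI:
  fixes y z :: "'h::complex_hilbert_space"
  assumes "\<And>x. cinner x y = cinner x z"
  shows "y = z"
proof -
  have "cinner (y - z) (y - z) = 0"
    using assms[of "y - z"] by (simp add: cinner_diff_right)
  then show ?thesis
    by (simp add: cinner_self)
qed

lemma norm_add_orthogonal:
  fixes x y :: "'h::complex_hilbert_space"
  assumes "cinner x y = 0"
  shows "(norm (x + y))\<^sup>2 = (norm x)\<^sup>2 + (norm y)\<^sup>2"
proof -
  have "inner x y = 0"
    using assms by (simp add: inner_eq_Re_cinner)
  then show ?thesis
    by (simp add: power2_norm_eq_inner inner_simps inner_commute)
qed

section \<open>Orthogonal projections and adjoints\<close>

lemma complex_subspace_scaleR:
  "complex_vector.subspace S \<Longrightarrow> x \<in> S \<Longrightarrow> r *\<^sub>R x \<in> S"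
  for S :: "'a::complex_vector set"
  by (simp add: scaleR_scaleC complex_vector.subspace_scale)

text \<open>A minimising sequence is Cauchy: midpoints stay in \<open>S\<close>, so the
  parallelogram law bounds the distance of two members by how far each is from attaining the
  infimum.\<close>

lemma nearest_point_exists:
  fixes S :: "'h::complex_hilbert_space set"
  assumes S: "complex_vector.subspace S" "closed S"
  shows "\<exists>p\<in>S. \<forall>y\<in>S. norm (x - p) \<le> norm (x - y)"
proof -
  define D where "D = (\<lambda>y. (norm (x - y))\<^sup>2) ` S"
  define d where "d = Inf D"
  have ne: "D \<noteq> {}"
    using complex_vector.subspace_0[OF S(1)] by (auto simp: D_def)
  have bdd: "bdd_below D"
    by (auto simp: D_def intro!: bdd_belowI[of _ 0])
  have dle: "d \<le> (norm (x - y))\<^sup>2" if "y \<in> S" for y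
    unfolding d_def by (rule cInf_lower[OF _ bdd]) (use that in \<open>auto simp: D_def\<close>)
  have "\<exists>y\<in>S. (norm (x - y))\<^sup>2 < d + 1 / real (Suc n)" for n
  proof -
    have "\<exists>z\<in>D. z < d + 1 / real (Suc n)"
      using cInf_lessD[OF ne, of "d + 1 / real (Suc n)"] by (simp add: d_def)
    then show ?thesis
      by (auto simp: D_def)
  qed
  then obtain y where y: "\<And>n. y n \<in> S" "\<And>n. (norm (x - y n))\<^sup>2 < d + 1 / real (Suc n)"
    by metis
  have par: "(norm (y m - y n))\<^sup>2 \<le> 2 / real (Suc m) + 2 / real (Suc n)" for m n
  proof -
    have "(1/2) *\<^sub>R (y m + y n) \<in> S"
      by (intro complex_subspace_scaleR complex_vector.subspace_add S y)
    then have "d \<le> (norm (x - (1/2) *\<^sub>R (y m + y n)))\<^sup>2"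
      by (rule dle)
    moreover have "(norm (y m - y n))\<^sup>2 = 2 * (norm (x - y m))\<^sup>2 + 2 * (norm (x - y n))\<^sup>2
        - 4 * (norm (x - (1/2) *\<^sub>R (y m + y n)))\<^sup>2"
      by (simp add: power2_norm_eq_inner inner_simps inner_commute algebra_simps)
    ultimately show ?thesis
      using y(2)[of m] y(2)[of n] by simp
  qed
  have "Cauchy y"
  proof (rule metric_CauchyI)
    fix e :: real assume e: "0 < e"
    obtain N where N: "inverse (real (Suc N)) < e\<^sup>2 / 4"
      using reals_Archimedean[of "e\<^sup>2 / 4"] e by auto
    show "\<exists>N. \<forall>m\<ge>N. \<forall>n\<ge>N. dist (y m) (y n) < e"
    proof (intro exI allI impI)
      fix m n assume mn: "m \<ge> N" "n \<ge> N"
      have "2 / real (Suc m) + 2 / real (Suc n) \<le> 2 / real (Suc N) + 2 / real (Suc N)"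
        using mn by (intro add_mono divide_left_mono) auto
      also have "\<dots> < e\<^sup>2"
        using N by (simp add: inverse_eq_divide)
      finally have "(norm (y m - y n))\<^sup>2 < e\<^sup>2"
        using par[of m n] by linarith
      then show "dist (y m) (y n) < e"
        unfolding dist_norm by (rule power2_less_imp_less) (use e in simp)
    qed
  qed
  then obtain p where p: "y \<longlonglongrightarrow> p"
    using Cauchy_convergent_iff convergent_def by blast
  have pS: "p \<in> S"
    using closed_sequentially[OF S(2) _ p] y(1) by blast
  have "(\<lambda>n. (norm (x - y n))\<^sup>2) \<longlonglongrightarrow> (norm (x - p))\<^sup>2"
    by (intro tendsto_intros p)
  moreover have "(\<lambda>n. d + 1 / real (Suc n)) \<longlonglongrightarrow> d + 0"
    by (intro tendsto_add tendsto_const LIMSEQ_Suc lim_1_over_n)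
  ultimately have "(norm (x - p))\<^sup>2 \<le> d + 0"
    by (rule LIMSEQ_le) (use y(2) less_imp_le in blast)
  then have "norm (x - p) \<le> norm (x - y)" if "y \<in> S" for y
    using power2_le_imp_le[OF order_trans[OF _ dle[OF that]] norm_ge_zero] by simp
  with pS show ?thesis by blast
qed

lemma projection_exists:
  fixes S :: "'h::complex_hilbert_space set"
  assumes S: "complex_vector.subspace S" "closed S"
  shows "\<exists>p\<in>S. \<forall>y\<in>S. cinner y (x - p) = 0"
proof -
  obtain p where p: "p \<in> S" "\<And>y. y \<in> S \<Longrightarrow> norm (x - p) \<le> norm (x - y)"
    using nearest_point_exists[OF S] by blast
  have orth: "inner y (x - p) = 0" if y: "y \<in> S" for y
  proof (cases "y = 0")
    case False
    \<comment> \<open>The step along \<open>y\<close> that minimises the real quadratic in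
      \<open>t\<close>; minimality of \<open>p\<close> then forces its linear coefficient to
      vanish.\<close>
    define t where "t = inner y (x - p) / inner y y"
    have "p + t *\<^sub>R y \<in> S"
      by (intro complex_vector.subspace_add complex_subspace_scaleR S p y)
    then have "(norm (x - p))\<^sup>2 \<le> (norm (x - (p + t *\<^sub>R y)))\<^sup>2"
      using p(2) by (intro power_mono) auto
    also have "x - (p + t *\<^sub>R y) = (x - p) - t *\<^sub>R y"
      by simp
    also have "(norm ((x - p) - t *\<^sub>R y))\<^sup>2
        = (norm (x - p))\<^sup>2 - 2 * t * inner y (x - p) + t * t * inner y y"
      by (simp only: power2_norm_eq_inner inner_diff_left inner_diff_right inner_scaleR_left
          inner_scaleR_right inner_commute[of "x - p" y]) (simp add: algebra_simps inner_commute)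
    also have "t * t * inner y y = t * inner y (x - p)"
      using False by (simp add: t_def)
    finally have "t * inner y (x - p) \<le> 0"
      by simp
    then have "(inner y (x - p))\<^sup>2 \<le> 0"
      using False inner_gt_zero_iff[of y]
      by (auto simp: t_def power2_eq_square divide_le_0_iff simp del: inner_gt_zero_iff)
    then show ?thesis
      by simp
  qed simp
  have "cinner y (x - p) = 0" if "y \<in> S" for y
    by (rule complex_eqI)
       (simp_all add: Im_cinner orth that complex_vector.subspace_scale[OF S(1)]
         flip: inner_eq_Re_cinner)
  with p show ?thesis by blast
qed

lemma projection_unique:
  fixes S :: "'h::complex_hilbert_space set"
  assumes S: "complex_vector.subspace S"
    and "p \<in> S" "\<And>y. y \<in> S \<Longrightarrow> cinner y (x - p) = 0"
    and "q \<in> S" "\<And>y. y \<in> S \<Longrightarrow> cinner y (x - q) = 0"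
  shows "p = q"
proof -
  have "cinner (p - q) (p - q) = cinner (p - q) (x - q) - cinner (p - q) (x - p)"
    by (simp flip: cinner_diff_right)
  also have "\<dots> = 0"
    using assms complex_vector.subspace_diff[OF S, of p q] by simp
  finally show ?thesis
    by (simp add: cinner_self)
qed

text \<open>\<open>orth_proj\<close> describes a bounded operator, so the pointwise projections must
  be shown to form one: linearity follows from their uniqueness, and the bound 1 from
  Pythagoras.\<close>

lemma orth_proj_spec:
  fixes S :: "'h::complex_hilbert_space set"
  assumes S: "complex_vector.subspace S" "closed S"
  shows "orth_proj S x \<in> S \<and> (\<forall>y\<in>S. cinner y (x - orth_proj S x) = 0)"
proof -
  obtain f where f: "\<And>x. f x \<in> S" "\<And>x y. y \<in> S \<Longrightarrow> cinner y (x - f x) = 0"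
    using projection_exists[OF S] by metis
  have uniq: "f x = p" if "p \<in> S" "\<And>y. y \<in> S \<Longrightarrow> cinner y (x - p) = 0" for x p
    using projection_unique[OF S(1), of "f x" x p] f that by blast
  have "bounded_linear f"
  proof (rule bounded_linear_intro[where K = 1])
    show "f (x + y) = f x + f y" for x y
    proof (rule uniq)
      show "cinner z (x + y - (f x + f y)) = 0" if "z \<in> S" for z
        using f(2)[OF that, of x] f(2)[OF that, of y] by (simp add: cinner_diff_right cinner_add_right)
    qed (simp add: complex_vector.subspace_add S f)
    show "f (r *\<^sub>R x) = r *\<^sub>R f x" for r x
    proof (rule uniq)
      show "cinner z (r *\<^sub>R x - r *\<^sub>R f x) = 0" if "z \<in> S" for z
        using f(2)[OF that, of x] by (simp add: cinner_scaleR_right flip: scaleR_diff_right)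
    qed (simp add: complex_subspace_scaleR S f)
    show "norm (f x) \<le> norm x * 1" for x
      unfolding mult_1_right
    proof -
      have "(norm (f x + (x - f x)))\<^sup>2 = (norm (f x))\<^sup>2 + (norm (x - f x))\<^sup>2"
        by (rule norm_add_orthogonal) (simp add: f)
      then have "(norm (f x))\<^sup>2 \<le> (norm x)\<^sup>2"
        by simp
      then show "norm (f x) \<le> norm x"
        by (rule power2_le_imp_le) simp
    qed
  qed
  then have ap: "blinfun_apply (Blinfun f) = f"
    by (rule bounded_linear_Blinfun_apply)
  have "\<exists>!P. \<forall>x. blinfun_apply P x \<in> S \<and> (\<forall>y\<in>S. cinner y (x - blinfun_apply P x) = 0)"
  proof (rule ex1I[of _ "Blinfun f"])
    fix P assume P: "\<forall>x. blinfun_apply P x \<in> S \<and> (\<forall>y\<in>S. cinner y (x - blinfun_apply P x) = 0)"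
    show "P = Blinfun f"
      by (rule blinfun_eqI) (metis P ap uniq)
  qed (use ap f in auto)
  from theI'[OF this] show ?thesis
    unfolding orth_proj_def by blast
qed

lemma orth_proj_eqI:
  fixes S :: "'h::complex_hilbert_space set"
  assumes S: "complex_vector.subspace S" "closed S"
    and "p \<in> S" "\<And>y. y \<in> S \<Longrightarrow> cinner y (x - p) = 0"
  shows "orth_proj S x = p"
  using projection_unique[OF S(1), of "orth_proj S x" x p] orth_proj_spec[OF S] assms by blast

lemma orth_proj_scaleC:
  fixes S :: "'h::complex_hilbert_space set"
  assumes S: "complex_vector.subspace S" "closed S"
  shows "orth_proj S (c *\<^sub>C x) = c *\<^sub>C orth_proj S x"
proof (rule orth_proj_eqI[OF S])
  show "c *\<^sub>C orth_proj S x \<in> S"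
    using S orth_proj_spec[OF S] complex_vector.subspace_scale by blast
  show "cinner y (c *\<^sub>C x - c *\<^sub>C orth_proj S x) = 0" if "y \<in> S" for y
    using that orth_proj_spec[OF S]
    by (simp add: cinner_scaleC_right flip: complex_vector.scale_right_diff_distrib)
qed

lemma orth_proj_id:
  fixes S :: "'h::complex_hilbert_space set"
  assumes "complex_vector.subspace S" "closed S" "x \<in> S"
  shows "orth_proj S x = x"
  using assms by (intro orth_proj_eqI) auto

lemma orth_proj_eq_0:
  fixes S :: "'h::complex_hilbert_space set"
  assumes "complex_vector.subspace S" "closed S" "\<And>y. y \<in> S \<Longrightarrow> cinner y x = 0"
  shows "orth_proj S x = 0"
  using assms by (intro orth_proj_eqI) (auto intro: complex_vector.subspace_0)

text \<open>The Riesz theorem. With \<open>w\<close> the component of \<open>u\<close> orthogonal to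
  the kernel, \<open>x - (f x / f w) *\<^sub>C w\<close> lies in the kernel, so pairing with
  \<open>w\<close> recovers \<open>f x\<close>.\<close>

lemma functional_representation:
  fixes f :: "'h::complex_hilbert_space \<Rightarrow> complex"
  assumes f: "bounded_linear f" and fC: "\<And>c x. f (c *\<^sub>C x) = c * f x"
  shows "\<exists>z. \<forall>x. f x = cinner z x"
proof (cases "\<forall>x. f x = 0")
  case False
  then obtain u where u: "f u \<noteq> 0" by blast
  define K where "K = {x. f x = 0}"
  have K: "complex_vector.subspace K"
    by (rule complex_vector.subspaceI)
       (auto simp: K_def fC linear_0 linear_add f bounded_linear.linear)
  have cl: "closed K"
    unfolding K_def by (intro closed_Collect_eq continuous_intros linear_continuous_on f)
  define w where "w = u - orth_proj K u"
  have wK: "cinner y w = 0" if "y \<in> K" for y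
    using orth_proj_spec[OF K cl] that by (simp add: w_def)
  have fw: "f w = f u"
    using orth_proj_spec[OF K cl, of u] by (simp add: w_def linear_diff[OF bounded_linear.linear, OF f] K_def)
  then have w: "w \<noteq> 0"
    using u by (metis linear_0 bounded_linear.linear f)
  have "f x = cinner ((cnj (f w) / cinner w w) *\<^sub>C w) x" for x
  proof -
    have "f (x - (f x / f w) *\<^sub>C w) = 0"
      using fw u by (simp add: linear_diff[OF bounded_linear.linear, OF f] fC)
    then have "cinner w (x - (f x / f w) *\<^sub>C w) = 0"
      using wK by (subst cinner_eq_zero_commute) (simp add: K_def)
    then have "cinner w x = f x / f w * cinner w w"
      by (simp add: cinner_diff_right cinner_scaleC_right)
    then show ?thesis
      using w fw u by (simp add: cinner_scaleC_left cinner_self)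
  qed
  then show ?thesis by blast
qed (auto intro: exI[of _ 0])

text \<open>The operator type only guarantees real linearity, so complex linearity travels as a
  separate predicate.\<close>

definition clinear_op :: "('h::complex_hilbert_space \<Rightarrow>\<^sub>L 'h) \<Rightarrow> bool" where
  "clinear_op T \<longleftrightarrow> (\<forall>c x. blinfun_apply T (c *\<^sub>C x) = c *\<^sub>C blinfun_apply T x)"

lemma adjoint_exists:
  fixes T :: "'h::complex_hilbert_space \<Rightarrow>\<^sub>L 'h"
  assumes T: "clinear_op T"
  shows "\<exists>S::'h \<Rightarrow>\<^sub>L 'h. \<forall>x y. cinner (blinfun_apply T x) y = cinner x (blinfun_apply S y)"
proof -
  have "\<exists>z. \<forall>x. cinner y (T x) = cinner z x" for y
    by (rule functional_representation)
       (use T in \<open>auto simp: clinear_op_def cinner_scaleC_right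
          intro: bounded_linear_compose[OF bounded_linear_cinner_right] blinfun.bounded_linear_right\<close>)
  then obtain f where f: "\<And>x y. cinner y (T x) = cinner (f y) x"
    by metis
  then have f': "cinner (T x) y = cinner x (f y)" for x y
    by (metis cinner_commute)
  have "bounded_linear f"
  proof (rule bounded_linear_intro[where K = "norm T"])
    show "f (x + y) = f x + f y" for x y
      by (rule cinner_extI) (simp add: cinner_add_right flip: f')
    show "f (r *\<^sub>R x) = r *\<^sub>R f x" for r x
      by (rule cinner_extI) (simp add: cinner_scaleR_right flip: f')
    show "norm (f x) \<le> norm x * norm T" for x
    proof (cases "f x = 0")
      case False
      have "(norm (f x))\<^sup>2 = norm (cinner (f x) (f x))"
        by (simp only: cinner_self norm_of_real abs_power2)
      also have "\<dots> = norm (cinner (T (f x)) x)"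
        by (simp add: f')
      also have "\<dots> \<le> norm (T (f x)) * norm x"
        by (rule norm_cinner_le)
      also have "\<dots> \<le> (norm T * norm (f x)) * norm x"
        by (intro mult_right_mono norm_blinfun) simp
      finally show ?thesis
        using False by (simp add: power2_eq_square mult_ac)
    qed simp
  qed
  then have "blinfun_apply (Blinfun f) = f"
    by (rule bounded_linear_Blinfun_apply)
  with f' show ?thesis by metis
qed

lemma cinner_hadjoint:
  fixes T :: "'h::complex_hilbert_space \<Rightarrow>\<^sub>L 'h"
  assumes T: "clinear_op T"
  shows "cinner x (hadjoint T y) = cinner (T x) y"
proof -
  obtain S :: "'h \<Rightarrow>\<^sub>L 'h" where S: "\<forall>x y. cinner (T x) y = cinner x (S y)"
    using adjoint_exists[OF T] by blast
  have "\<exists>!S::'h \<Rightarrow>\<^sub>L 'h. \<forall>x y. cinner (T x) y = cinner x (S y)"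
  proof (rule ex1I[of _ S])
    show "R = S" if "\<forall>x y. cinner (T x) y = cinner x (R y)" for R :: "'h \<Rightarrow>\<^sub>L 'h"
      by (rule blinfun_eqI, rule cinner_extI) (metis S that)
  qed (rule S)
  from theI'[OF this, rule_format, symmetric] show ?thesis
    unfolding hadjoint_def .
qed

section \<open>Orthonormal systems\<close>

definition orthonormal :: "'h::complex_hilbert_space set \<Rightarrow> bool" where
  "orthonormal E \<longleftrightarrow> (\<forall>e\<in>E. \<forall>e'\<in>E. cinner e e' = (if e = e' then 1 else 0))"

lemma orthonormal_norm:
  assumes "orthonormal E" "e \<in> E"
  shows "norm e = 1"
proof -
  have "cinner e e = 1"
    using assms by (simp add: orthonormal_def)
  then have "(norm e)\<^sup>2 = 1"
    by (metis cinner_self of_real_eq_1_iff)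
  then show ?thesis
    using norm_ge_zero[of e] by (auto simp: power2_eq_1_iff)
qed

lemma orthonormal_subset: "orthonormal E \<Longrightarrow> F \<subseteq> E \<Longrightarrow> orthonormal F"
  unfolding orthonormal_def by blast

lemma cinner_orthonormal_sum:
  assumes "orthonormal E" "finite F" "F \<subseteq> E" "e \<in> E"
  shows "cinner e (\<Sum>x\<in>F. c x *\<^sub>C x) = (if e \<in> F then c e else 0)"
proof -
  have "cinner e (\<Sum>x\<in>F. c x *\<^sub>C x) = (\<Sum>x\<in>F. if e = x then c x else 0)"
    unfolding cinner_sum_right
    by (intro sum.cong) (use assms in \<open>auto simp: orthonormal_def cinner_scaleC_right\<close>)
  then show ?thesis
    using assms by simp
qed

lemma norm_orthonormal_sum:
  assumes "orthonormal E" "finite E"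
  shows "(norm (\<Sum>x\<in>E. c x *\<^sub>C x))\<^sup>2 = (\<Sum>x\<in>E. (norm (c x))\<^sup>2)"
proof -
  have "of_real ((norm (\<Sum>x\<in>E. c x *\<^sub>C x))\<^sup>2)
      = (\<Sum>x\<in>E. cnj (c x) * cinner x (\<Sum>x\<in>E. c x *\<^sub>C x))"
    by (simp only: flip: cinner_self) (simp add: cinner_sum_left cinner_scaleC_left)
  also have "\<dots> = (\<Sum>x\<in>E. of_real ((norm (c x))\<^sup>2))"
    by (intro sum.cong) 
       (use assms in \<open>simp_all add: cinner_orthonormal_sum[of E] complex_norm_square mult.commute del: of_real_power\<close>)
  finally show ?thesis
    by (simp flip: of_real_sum of_real_power add: of_real_eq_iff del: of_real_power)
qed

lemma cinner_residual:
  assumes "orthonormal E" "finite E" "e \<in> E"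
  shows "cinner e (x - (\<Sum>b\<in>E. cinner b x *\<^sub>C b)) = 0"
  using assms by (simp add: cinner_diff_right cinner_orthonormal_sum[of E])

lemma cinner_span_zero:
  assumes "\<And>b. b \<in> B \<Longrightarrow> cinner b x = 0" "u \<in> complex_vector.span B"
  shows "cinner u x = 0"
  using assms(2)
  by (induction rule: complex_vector.span_induct_alt) (use assms(1) in \<open>simp_all add: cinner_add_left cinner_scaleC_left\<close>)

text \<open>The residual is orthogonal to the whole span, so by Pythagoras the Fourier sum is the
  best approximation.\<close>

lemma norm_residual_le:
  assumes "orthonormal E" "finite E" "u \<in> complex_vector.span E"
  shows "norm (x - (\<Sum>b\<in>E. cinner b x *\<^sub>C b)) \<le> norm (x - u)"
proof -
  let ?p = "\<Sum>b\<in>E. cinner b x *\<^sub>C b"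
  have "?p - u \<in> complex_vector.span E"
    by (intro complex_vector.span_diff assms complex_vector.span_sum complex_vector.span_scale
        complex_vector.span_base)
  then have "cinner (?p - u) (x - ?p) = 0"
    by (rule cinner_span_zero[rotated]) (rule cinner_residual[OF assms(1,2)])
  then have "cinner (x - ?p) (?p - u) = 0"
    by (simp add: cinner_eq_zero_commute)
  then have "(norm ((x - ?p) + (?p - u)))\<^sup>2 = (norm (x - ?p))\<^sup>2 + (norm (?p - u))\<^sup>2"
    by (rule norm_add_orthogonal)
  then have "(norm (x - ?p))\<^sup>2 \<le> (norm (x - u))\<^sup>2"
    by simp
  then show ?thesis
    by (rule power2_le_imp_le) simp
qed

lemma bessel_inequality:
  assumes "orthonormal E" "finite E"
  shows "(\<Sum>b\<in>E. (norm (cinner b x))\<^sup>2) \<le> (norm x)\<^sup>2"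
proof -
  let ?p = "\<Sum>b\<in>E. cinner b x *\<^sub>C b"
  have "cinner ?p (x - ?p) = 0"
    by (rule cinner_span_zero[of E])
       (auto intro: cinner_residual[OF assms] complex_vector.span_sum complex_vector.span_scale
         complex_vector.span_base)
  then have "(norm (?p + (x - ?p)))\<^sup>2 = (norm ?p)\<^sup>2 + (norm (x - ?p))\<^sup>2"
    by (rule norm_add_orthogonal)
  then show ?thesis
    using norm_orthonormal_sum[OF assms, of "\<lambda>b. cinner b x"] by simp
qed

lemma orthonormal_independent:
  assumes "orthonormal E"
  shows "\<not> complex_vector.dependent E"
  unfolding complex_vector.independent_explicit_module
proof (intro allI impI)
  fix F u v assume *: "finite F" "F \<subseteq> E" "(\<Sum>v\<in>F. u v *\<^sub>C v) = 0" "v \<in> F"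
  then have "cinner v (\<Sum>v\<in>F. u v *\<^sub>C v) = u v"
    using assms by (subst cinner_orthonormal_sum[of E]) auto
  then show "u v = 0"
    using * by simp
qed

lemma closure_span_subspace:
  fixes B :: "'h::complex_hilbert_space set"
  shows "complex_vector.subspace (closure (complex_vector.span B))"
proof (rule complex_vector.subspaceI)
  let ?S = "complex_vector.span B"
  show "0 \<in> closure ?S"
    using complex_vector.span_zero closure_subset by blast
  show "x + y \<in> closure ?S" if "x \<in> closure ?S" "y \<in> closure ?S" for x y
  proof -
    obtain f g where "\<And>n. f n \<in> ?S" "f \<longlonglongrightarrow> x" "\<And>n. g n \<in> ?S" "g \<longlonglongrightarrow> y"
      using \<open>x \<in> closure ?S\<close> \<open>y \<in> closure ?S\<close> unfolding closure_sequential by metis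
    then have "\<forall>n. f n + g n \<in> ?S" "(\<lambda>n. f n + g n) \<longlonglongrightarrow> x + y"
      by (auto intro: complex_vector.span_add tendsto_add)
    then show ?thesis
      unfolding closure_sequential by (intro exI[of _ "\<lambda>n. f n + g n"]) simp
  qed
  show "c *\<^sub>C x \<in> closure ?S" if "x \<in> closure ?S" for c x
  proof -
    obtain f where "\<forall>n. f n \<in> ?S" "f \<longlonglongrightarrow> x"
      using \<open>x \<in> closure ?S\<close> unfolding closure_sequential by auto
    then have "\<forall>n. c *\<^sub>C f n \<in> ?S" "(\<lambda>n. c *\<^sub>C f n) \<longlonglongrightarrow> c *\<^sub>C x"
      by (auto intro: complex_vector.span_scale bounded_linear.tendsto[OF bounded_linear_scaleC])
    then show ?thesis
      unfolding closure_sequential by (intro exI[of _ "\<lambda>n. c *\<^sub>C f n"]) simp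
  qed
qed

text \<open>The additional predicate \<open>Q\<close> allows the extension by eigenvectors only.\<close>

lemma maximal_orthonormal_exists:
  fixes E :: "'h::complex_hilbert_space set"
  assumes "orthonormal E" "\<And>e. e \<in> E \<Longrightarrow> Q e"
  shows "\<exists>B. E \<subseteq> B \<and> orthonormal B \<and> (\<forall>b\<in>B. Q b) \<and>
     (\<forall>x. Q x \<and> norm x = 1 \<and> (\<forall>b\<in>B. cinner b x = 0) \<longrightarrow> False)"
proof -
  define A where "A = {B. E \<subseteq> B \<and> orthonormal B \<and> (\<forall>b\<in>B. Q b)}"
  have "\<exists>M\<in>A. \<forall>X\<in>A. M \<subseteq> X \<longrightarrow> X = M"
  proof (rule subset_Zorn_nonempty)
    show "A \<noteq> {}"
      using assms by (auto simp: A_def)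
    fix c assume c: "c \<noteq> {}" "subset.chain A c"
    have "orthonormal (\<Union>c)"
      unfolding orthonormal_def
    proof (intro ballI)
      fix e e' assume "e \<in> \<Union>c" "e' \<in> \<Union>c"
      then obtain X Y where "X \<in> c" "Y \<in> c" "e \<in> X" "e' \<in> Y" by blast
      then obtain Z where "Z \<in> c" "e \<in> Z" "e' \<in> Z"
        using c by (auto simp: subset_chain_def) (meson subsetD)
      then have "orthonormal Z"
        using c by (auto simp: subset_chain_def A_def)
      then show "cinner e e' = (if e = e' then 1 else 0)"
        using \<open>e \<in> Z\<close> \<open>e' \<in> Z\<close> by (simp add: orthonormal_def)
    qed
    then show "\<Union>c \<in> A"
      using c by (fastforce simp: subset_chain_def A_def)
  qed
  then obtain B where B: "B \<in> A" "\<And>X. X \<in> A \<Longrightarrow> B \<subseteq> X \<Longrightarrow> X = B" by blast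
  have False if x: "Q x" "norm x = 1" "\<forall>b\<in>B. cinner b x = 0" for x
  proof -
    have "orthonormal (insert x B)"
      using x B(1) by (auto simp: orthonormal_def A_def cinner_self cinner_eq_zero_commute[of x])
    then have "insert x B = B"
      using x B(1) by (intro B(2)) (auto simp: A_def)
    then have "cinner x x = 0"
      using x by blast
    then show False
      using x by (simp add: cinner_self)
  qed
  then show ?thesis
    using B(1) unfolding A_def by blast
qed

text \<open>If a vector of \<open>S\<close> lay outside the closed span of a maximal family, its
  normalised residual would extend that family.\<close>

lemma orthonormal_basis_extension:
  fixes S :: "'h::complex_hilbert_space set"
  assumes S: "complex_vector.subspace S" "closed S" and E: "orthonormal E" "E \<subseteq> S"
  shows "\<exists>B. E \<subseteq> B \<and> orthonormal_basis_of S B"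
proof -
  obtain B where B: "E \<subseteq> B" "orthonormal B" "\<forall>b\<in>B. b \<in> S"
    and max: "\<And>x. x \<in> S \<Longrightarrow> norm x = 1 \<Longrightarrow> (\<forall>b\<in>B. cinner b x = 0) \<Longrightarrow> False"
    using maximal_orthonormal_exists[of E "\<lambda>x. x \<in> S"] E by blast
  let ?C = "closure (complex_vector.span B)"
  have C: "complex_vector.subspace ?C" "closed ?C"
    by (simp_all add: closure_span_subspace)
  have CS: "?C \<subseteq> S"
    using B S by (intro closure_minimal complex_vector.span_minimal) auto
  have "x \<in> ?C" if "x \<in> S" for x
  proof (rule ccontr)
    assume "x \<notin> ?C"
    define y where "y = x - orth_proj ?C x"
    have y: "y \<noteq> 0" "y \<in> S"
      using \<open>x \<notin> ?C\<close> orth_proj_spec[OF C, of x] CS complex_vector.subspace_diff[OF S(1)] that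
      by (auto simp: y_def)
    have "cinner b y = 0" if "b \<in> B" for b
      using that orth_proj_spec[OF C, of x] complex_vector.span_base[of b B] closure_subset
      unfolding y_def by blast
    then show False
      using y by (intro max[of "(1 / norm y) *\<^sub>R y"])
        (auto simp: cinner_scaleR_right intro: complex_subspace_scaleR S)
  qed
  then have "orthonormal_basis_of S B"
    using B by (auto simp: orthonormal_basis_of_def orthonormal_def)
  with B(1) show ?thesis by blast
qed

text \<open>Once a finite set spans an approximant \<open>u\<close> of \<open>y\<close>, each
  Fourier sum over a larger set is at least as close to \<open>y\<close> as \<open>u\<close>; this
  is unconditional convergence.\<close>

lemma orthonormal_expansion:
  fixes B :: "'h::complex_hilbert_space set"
  assumes B: "orthonormal_basis_of S B" and y: "y \<in> S"
  shows "((\<lambda>b. cinner b y *\<^sub>C b) has_sum y) B"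
  unfolding has_sum_def tendsto_iff eventually_finite_subsets_at_top
proof (intro allI impI)
  fix \<epsilon> :: real assume "0 < \<epsilon>"
  have on: "orthonormal B" and "y \<in> closure (complex_vector.span B)"
    using B y by (auto simp: orthonormal_basis_of_def orthonormal_def)
  then obtain u where u: "u \<in> complex_vector.span B" "dist u y < \<epsilon>"
    using \<open>0 < \<epsilon>\<close> by (meson closure_approachable)
  obtain F where F: "finite F" "F \<subseteq> B" "u \<in> complex_vector.span F"
    using u(1) unfolding complex_vector.span_explicit
    by (auto intro!: complex_vector.span_sum complex_vector.span_scale complex_vector.span_base)
  show "\<exists>X. finite X \<and> X \<subseteq> B \<and>
      (\<forall>Y. finite Y \<and> X \<subseteq> Y \<and> Y \<subseteq> B \<longrightarrow> dist (\<Sum>b\<in>Y. cinner b y *\<^sub>C b) y < \<epsilon>)"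
  proof (intro exI[of _ F] conjI F allI impI)
    fix Y assume Y: "finite Y \<and> F \<subseteq> Y \<and> Y \<subseteq> B"
    then have "u \<in> complex_vector.span Y"
      using F complex_vector.span_mono by blast
    then have "norm (y - (\<Sum>b\<in>Y. cinner b y *\<^sub>C b)) \<le> norm (y - u)"
      using Y orthonormal_subset[OF on] by (intro norm_residual_le) auto
    then show "dist (\<Sum>b\<in>Y. cinner b y *\<^sub>C b) y < \<epsilon>"
      using u(2) by (simp add: dist_norm norm_minus_commute)
  qed
qed

lemma parseval:
  fixes B :: "'h::complex_hilbert_space set"
  assumes "orthonormal_basis_of S B" "y \<in> S"
  shows "((\<lambda>b. cinner x b * cinner b y) has_sum cinner x y) B"
proof -
  have "((\<lambda>b. cinner x (cinner b y *\<^sub>C b)) has_sum cinner x y) B"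
    by (rule has_sum_bounded_linear[OF bounded_linear_cinner_right orthonormal_expansion[OF assms]])
  then show ?thesis
    by (simp add: cinner_scaleC_right mult.commute)
qed

section \<open>Compact operators and their singular vectors\<close>

lemma clinear_op_zero: "clinear_op 0"
  and clinear_op_add: "clinear_op S \<Longrightarrow> clinear_op T \<Longrightarrow> clinear_op (S + T)"
  and clinear_op_diff: "clinear_op S \<Longrightarrow> clinear_op T \<Longrightarrow> clinear_op (S - T)"
  and clinear_op_scaleC: "clinear_op T \<Longrightarrow> clinear_op (c *\<^sub>C T)"
  and clinear_op_compose: "clinear_op S \<Longrightarrow> clinear_op T \<Longrightarrow> clinear_op (S o\<^sub>L T)"
  by (simp_all add: clinear_op_def blinfun.add_left blinfun.diff_left blinfun_apply_scaleC
      scaleC_add_right complex_vector.scale_right_diff_distrib scaleC_scaleC mult.commute)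

lemma clinear_op_hadjoint:
  assumes "clinear_op T"
  shows "clinear_op (hadjoint T)"
  unfolding clinear_op_def
  by (intro allI cinner_extI) (simp add: cinner_hadjoint[OF assms] cinner_scaleC_right)

lemma cinner_gram:
  assumes "clinear_op T"
  shows "cinner x ((hadjoint T o\<^sub>L T) y) = cinner (T x) (T y)"
    and "cinner ((hadjoint T o\<^sub>L T) x) y = cinner (T x) (T y)"
proof -
  show *: "cinner x ((hadjoint T o\<^sub>L T) y) = cinner (T x) (T y)" for x y
    by (simp add: cinner_hadjoint[OF assms])
  show "cinner ((hadjoint T o\<^sub>L T) x) y = cinner (T x) (T y)"
    using *[of y x] by (metis cinner_commute)
qed

lemma compact_operatorI:
  assumes "compact K" "\<And>x. norm x \<le> 1 \<Longrightarrow> blinfun_apply T x \<in> K"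
  shows "compact_operator T"
proof -
  have "closure (blinfun_apply T ` cball 0 1) \<subseteq> K"
    using assms compact_imp_closed by (intro closure_minimal) auto
  then show ?thesis
    unfolding compact_operator_def using assms(1) by (metis closed_closure compact_Int_closed inf.absorb_iff2)
qed

lemma compact_operator_mem:
  assumes "norm x \<le> 1"
  shows "blinfun_apply T x \<in> closure (blinfun_apply T ` cball 0 1)"
  using assms closure_subset by fastforce

lemma compact_operator_zero: "compact_operator 0"
  by (rule compact_operatorI[of "{0}"]) auto

lemma compact_operator_add:
  assumes "compact_operator S" "compact_operator T"
  shows "compact_operator (S + T)"
  using compact_sums[OF assms[unfolded compact_operator_def]]
  by (rule compact_operatorI) (auto simp: blinfun.add_left intro: compact_operator_mem)

lemma compact_operator_compose_left:
  fixes A T :: "'h::complex_hilbert_space \<Rightarrow>\<^sub>L 'h"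
  assumes "compact_operator T"
  shows "compact_operator (A o\<^sub>L T)"
  using compact_continuous_image[OF linear_continuous_on[OF blinfun.bounded_linear_right]
      assms[unfolded compact_operator_def]]
  by (rule compact_operatorI) (auto intro: compact_operator_mem)

lemma compact_operator_compose_right:
  fixes A T :: "'h::complex_hilbert_space \<Rightarrow>\<^sub>L 'h"
  assumes "compact_operator T"
  shows "compact_operator (T o\<^sub>L A)"
proof (rule compact_operatorI)
  let ?K = "closure (blinfun_apply T ` cball 0 1)"
  \<comment> \<open>\<open>A\<close> maps the unit ball into the ball of radius
    \<open>norm A\<close>; the summand 1 keeps the rescaling factor nonzero when
    \<open>A = 0\<close>.\<close>
  show "compact ((\<lambda>y. (norm A + 1) *\<^sub>R y) ` ?K)"
    using assms unfolding compact_operator_def by (rule compact_scaling)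
  fix x :: 'h assume x: "norm x \<le> 1"
  have pos: "0 < norm A + 1"
    using norm_ge_zero[of A] by linarith
  have "norm (A x) \<le> norm A * norm x"
    by (rule norm_blinfun)
  also have "\<dots> \<le> norm A * 1"
    by (intro mult_left_mono x) simp
  finally have "norm ((1 / (norm A + 1)) *\<^sub>R A x) \<le> 1"
    using pos by simp
  then have "T ((1 / (norm A + 1)) *\<^sub>R A x) \<in> ?K"
    by (rule compact_operator_mem)
  moreover have "(T o\<^sub>L A) x = (norm A + 1) *\<^sub>R T ((1 / (norm A + 1)) *\<^sub>R A x)"
    using pos by (simp add: blinfun.scaleR_right)
  ultimately show "(T o\<^sub>L A) x \<in> (\<lambda>y. (norm A + 1) *\<^sub>R y) ` ?K"
    by blast
qed

lemma compact_operator_scaleC: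
  fixes T :: "'h::complex_hilbert_space \<Rightarrow>\<^sub>L 'h"
  assumes "compact_operator T"
  shows "compact_operator (c *\<^sub>C T)"
  using compact_continuous_image[OF linear_continuous_on[OF bounded_linear_scaleC]
      assms[unfolded compact_operator_def], of c]
  by (rule compact_operatorI) (auto simp: blinfun_apply_scaleC intro: compact_operator_mem)

lemma compact_operator_subseq:
  assumes "compact_operator T" "\<And>n. norm (x n) \<le> 1"
  obtains y r where "strict_mono (r :: nat \<Rightarrow> nat)" "(\<lambda>n. blinfun_apply T (x (r n))) \<longlonglongrightarrow> y"
proof -
  have "seq_compact (closure (blinfun_apply T ` cball 0 1))"
    using assms(1) by (simp add: compact_operator_def compact_eq_seq_compact_metric)
  then show ?thesis
    using seq_compactE[of _ "\<lambda>n. T (x n)"] compact_operator_mem[OF assms(2)] that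
    by (metis (no_types, lifting) comp_apply ext)
qed

lemma eigenvector_orthogonal:
  fixes T :: "'h::complex_hilbert_space \<Rightarrow>\<^sub>L 'h"
  assumes "clinear_op T" "(hadjoint T o\<^sub>L T) x = a *\<^sub>R x" "(hadjoint T o\<^sub>L T) y = b *\<^sub>R y" "a \<noteq> b"
  shows "cinner x y = 0"
proof -
  have "of_real a * cinner x y = of_real b * cinner x y"
    using cinner_gram[OF assms(1), of x y] assms(2,3)
    by (simp add: cinner_scaleR_left cinner_scaleR_right)
  then show ?thesis
    using assms(4) by simp
qed

text \<open>Maximises \<open>norm (T x)\<close> over the unit sphere of the orthogonal complement
  \<open>W\<close> of \<open>F\<close>. The Gram operator preserves \<open>W\<close> because the
  members of \<open>F\<close> are its eigenvectors; compactness supplies a maximiser, and a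
  maximiser is an eigenvector. The threshold 0 serves to prove a family of singular vectors
  complete, an arbitrary one to bound \<open>T\<close> off the large singular values.\<close>

lemma gram_eigenvector_exists:
  fixes T :: "'h::complex_hilbert_space \<Rightarrow>\<^sub>L 'h"
  assumes T: "clinear_op T" "compact_operator T"
    and F: "\<And>e. e \<in> F \<Longrightarrow> \<exists>a. (hadjoint T o\<^sub>L T) e = a *\<^sub>R e"
    and t: "0 \<le> t" and x0: "\<And>e. e \<in> F \<Longrightarrow> cinner e x0 = 0" "t * norm x0 < norm (T x0)"
  shows "\<exists>x. norm x = 1 \<and> (\<forall>e\<in>F. cinner e x = 0) \<and> t < norm (T x) \<and>
     (hadjoint T o\<^sub>L T) x = (norm (T x))\<^sup>2 *\<^sub>R x"
proof -
  define S where "S = hadjoint T o\<^sub>L T"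
  define W where "W = {x. \<forall>e\<in>F. cinner e x = 0}"
  define D where "D = (\<lambda>x. norm (T x)) ` {x \<in> W. norm x = 1}"
  define c where "c = Sup D"
  have W_scale: "r *\<^sub>R x \<in> W" if "x \<in> W" for r x
    using that by (simp add: W_def cinner_scaleR_right)
  have W_S: "S x \<in> W" if "x \<in> W" for x
  proof -
    have "cinner e (S x) = 0" if e: "e \<in> F" for e
    proof -
      obtain a where "S e = a *\<^sub>R e"
        using F[OF e] by (auto simp: S_def)
      then have "cinner e (S x) = of_real a * cinner e x"
        using cinner_gram[OF T(1)] by (metis S_def cinner_scaleR_left)
      then show ?thesis
        using \<open>x \<in> W\<close> e by (simp add: W_def)
    qed
    then show ?thesis by (simp add: W_def)
  qed
  have W_closed: "closed W"
  proof -
    have "W = (\<Inter>e\<in>F. {x. cinner e x = 0})"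
      by (auto simp: W_def)
    then show ?thesis
      by (auto intro!: closed_INT closed_Collect_eq linear_continuous_on bounded_linear_cinner_right
          continuous_on_const)
  qed
  have bdd: "bdd_above D"
  proof (rule bdd_aboveI)
    fix d assume "d \<in> D"
    then obtain x where "d = norm (T x)" "norm x = 1"
      by (auto simp: D_def)
    then show "d \<le> norm T"
      using norm_blinfun[of T x] by simp
  qed
  have x0': "x0 \<noteq> 0"
    using x0(2) by auto
  have unit: "norm (T ((1 / norm x) *\<^sub>R x)) \<in> D" if "x \<in> W" "x \<noteq> 0" for x
    unfolding D_def using that W_scale by (intro imageI) simp
  have c_ub: "norm (T x) \<le> c * norm x" if "x \<in> W" for x
  proof (cases "x = 0")
    case False
    have "norm (T ((1 / norm x) *\<^sub>R x)) \<le> c"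
      unfolding c_def by (rule cSup_upper[OF unit[OF that False] bdd])
    then show ?thesis
      using False by (simp add: blinfun.scaleR_right field_simps)
  qed simp
  have "t < norm (T x0) / norm x0"
    using x0(2) x0' by (simp add: field_simps)
  also have "\<dots> \<le> c"
    using c_ub[of x0] x0 x0' by (simp add: W_def field_simps)
  finally have tc: "t < c" .
  then have c0: "0 < c"
    using t by simp
  have "\<exists>x. x \<in> W \<and> norm x = 1 \<and> c - 1 / real (Suc n) < norm (T x)" for n
  proof -
    have "D \<noteq> {}"
      using unit[of x0] x0 x0' by (auto simp: W_def)
    moreover have "c - 1 / real (Suc n) < Sup D"
      unfolding c_def by simp
    ultimately obtain d where "d \<in> D" "c - 1 / real (Suc n) < d"
      using less_cSupD by metis
    then show ?thesis
      by (auto simp: D_def)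
  qed
  then obtain x where x: "\<And>n. x n \<in> W" "\<And>n. norm (x n) = 1"
      "\<And>n. c - 1 / real (Suc n) < norm (T (x n))"
    by metis
  have Tx: "(\<lambda>n. norm (T (x n))) \<longlonglongrightarrow> c"
  proof (rule tendsto_sandwich)
    show "(\<lambda>n. c - 1 / real (Suc n)) \<longlonglongrightarrow> c"
      using tendsto_diff[OF tendsto_const LIMSEQ_Suc[OF lim_1_over_n], of c] by simp
    show "\<forall>\<^sub>F n in sequentially. norm (T (x n)) \<le> c"
      using c_ub[OF x(1)] x(2) by simp
  qed (use x(3) in \<open>auto intro!: always_eventually less_imp_le\<close>)
  have Sx: "norm (S y) \<le> c\<^sup>2 * norm y" if "y \<in> W" for y
  proof (cases "S y = 0")
    case False
    have "(norm (S y))\<^sup>2 = norm (cinner (S y) (S y))"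
      by (simp only: cinner_self norm_of_real abs_power2)
    also have "\<dots> = norm (cinner (T (S y)) (T y))"
      using cinner_gram[OF T(1)] by (simp add: S_def)
    also have "\<dots> \<le> norm (T (S y)) * norm (T y)"
      by (rule norm_cinner_le)
    also have "\<dots> \<le> (c * norm (S y)) * (c * norm y)"
      by (intro mult_mono c_ub W_S that) (use c0 in auto)
    finally show ?thesis
      using False by (simp add: power2_eq_square mult_ac)
  qed (use c0 in simp)
  \<comment> \<open>Along the maximising sequence the right side tends to 0, so its members become
    approximate eigenvectors for \<open>c\<^sup>2\<close>.\<close>
  have bound: "(norm (S (x n) - c\<^sup>2 *\<^sub>R x n))\<^sup>2 \<le> 2 * c\<^sup>2 * (c\<^sup>2 - (norm (T (x n)))\<^sup>2)" for n
  proof -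
    have *: "inner (S (x n)) (x n) = (norm (T (x n)))\<^sup>2"
      by (simp add: inner_eq_Re_cinner S_def cinner_gram[OF T(1)] cinner_self
          del: blinfun_compose.rep_eq blinfun_apply_blinfun_compose)
    have "(norm (S (x n) - c\<^sup>2 *\<^sub>R x n))\<^sup>2
        = (norm (S (x n)))\<^sup>2 - 2 * c\<^sup>2 * inner (S (x n)) (x n) + c\<^sup>2 * c\<^sup>2 * (norm (x n))\<^sup>2"
      by (simp add: power2_norm_eq_inner inner_simps inner_commute algebra_simps)
    also have "\<dots> \<le> (c\<^sup>2)\<^sup>2 - 2 * c\<^sup>2 * (norm (T (x n)))\<^sup>2 + c\<^sup>2 * c\<^sup>2"
      using power_mono[OF Sx[OF x(1)[of n]] norm_ge_zero, of 2] by (simp add: * x(2))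
    finally show ?thesis
      by (simp add: power2_eq_square algebra_simps)
  qed
  have "(\<lambda>n. 2 * c\<^sup>2 * (c\<^sup>2 - (norm (T (x n)))\<^sup>2)) \<longlonglongrightarrow> 2 * c\<^sup>2 * (c\<^sup>2 - c\<^sup>2)"
    by (intro tendsto_intros Tx)
  then have "(\<lambda>n. 2 * c\<^sup>2 * (c\<^sup>2 - (norm (T (x n)))\<^sup>2)) \<longlonglongrightarrow> 0"
    by simp
  then have "(\<lambda>n. (norm (S (x n) - c\<^sup>2 *\<^sub>R x n))\<^sup>2) \<longlonglongrightarrow> 0"
    by (rule Lim_null_comparison[rotated])
       (intro always_eventually allI, simp only: real_norm_def abs_power2 bound)
  then have diff0: "(\<lambda>n. S (x n) - c\<^sup>2 *\<^sub>R x n) \<longlonglongrightarrow> 0"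
    using tendsto_real_sqrt[of "\<lambda>n. (norm (S (x n) - c\<^sup>2 *\<^sub>R x n))\<^sup>2" 0]
    by (simp add: tendsto_norm_zero_iff)
  have "compact_operator S"
    unfolding S_def by (rule compact_operator_compose_left[OF T(2)])
  then obtain y r where r: "strict_mono (r :: nat \<Rightarrow> nat)" "(\<lambda>n. S (x (r n))) \<longlonglongrightarrow> y"
    using compact_operator_subseq[of S x] x(2) by (metis order_refl)
  \<comment> \<open>\<open>S (x (r n))\<close> converges by compactness and differs from
    \<open>c\<^sup>2 *\<^sub>R x (r n)\<close> by a null sequence, so the subsequence of
    \<open>x\<close> itself converges.\<close>
  have "(\<lambda>n. (1 / c\<^sup>2) *\<^sub>R (S (x (r n)) - (S (x (r n)) - c\<^sup>2 *\<^sub>R x (r n)))) \<longlonglongrightarrow> (1 / c\<^sup>2) *\<^sub>R (y - 0)"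
    by (intro tendsto_intros r LIMSEQ_subseq_LIMSEQ[OF diff0 r(1), unfolded o_def])
  then have lim: "(\<lambda>n. x (r n)) \<longlonglongrightarrow> (1 / c\<^sup>2) *\<^sub>R y"
    using c0 by simp
  define z where "z = (1 / c\<^sup>2) *\<^sub>R y"
  note lim = lim[folded z_def]
  have "z \<in> W"
    using closed_sequentially[OF W_closed _ lim] x(1) by blast
  moreover have "norm z = 1"
    using tendsto_norm[OF lim] x(2) by (simp add: LIMSEQ_const_iff)
  moreover have "norm (T z) = c"
    using tendsto_norm[OF blinfun.tendsto[OF tendsto_const lim, of T]]
      LIMSEQ_subseq_LIMSEQ[OF Tx r(1), unfolded o_def] by (rule LIMSEQ_unique)
  moreover have "S z = y"
    using blinfun.tendsto[OF tendsto_const lim, of S] r(2) by (rule LIMSEQ_unique)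
  moreover have "y = c\<^sup>2 *\<^sub>R z"
    using c0 by (simp add: z_def)
  ultimately show ?thesis
    using tc by (intro exI[of _ z]) (auto simp: S_def W_def)
qed

section \<open>Systems of singular vectors\<close>

text \<open>Right singular vectors for the nonzero singular values \<open>norm (T e)\<close>. An
  unordered set replaces the decreasing sequence of singular values: a value is repeated by having
  several vectors, and the last clause says that none is missing.\<close>

definition singular_system :: "('h::complex_hilbert_space \<Rightarrow>\<^sub>L 'h) \<Rightarrow> 'h set \<Rightarrow> bool" where
  "singular_system T E \<longleftrightarrow> clinear_op T \<and> compact_operator T \<and> orthonormal E \<and>
     (\<forall>e\<in>E. T e \<noteq> 0 \<and> (hadjoint T o\<^sub>L T) e = (norm (T e))\<^sup>2 *\<^sub>R e) \<and>
     (\<forall>x. (\<forall>e\<in>E. cinner e x = 0) \<longrightarrow> T x = 0)"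

text \<open>A maximal orthonormal family of eigenvectors outside the kernel is complete, because a
  vector orthogonal to it with nonzero image would produce a further eigenvector.\<close>

lemma singular_system_exists:
  assumes "clinear_op T" "compact_operator T"
  shows "\<exists>E. singular_system T E"
proof -
  define Q where "Q e \<longleftrightarrow> T e \<noteq> 0 \<and> (hadjoint T o\<^sub>L T) e = (norm (T e))\<^sup>2 *\<^sub>R e" for e
  obtain E where E: "orthonormal E" "\<forall>e\<in>E. Q e"
    and max: "\<And>x. Q x \<Longrightarrow> norm x = 1 \<Longrightarrow> (\<forall>b\<in>E. cinner b x = 0) \<Longrightarrow> False"
    using maximal_orthonormal_exists[of "{}" Q] unfolding orthonormal_def by blast
  have "T x = 0" if x: "\<forall>e\<in>E. cinner e x = 0" for x
  proof (rule ccontr)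
    assume "T x \<noteq> 0"
    then obtain z where "norm z = 1" "\<forall>e\<in>E. cinner e z = 0" "0 < norm (T z)"
        "(hadjoint T o\<^sub>L T) z = (norm (T z))\<^sup>2 *\<^sub>R z"
      using gram_eigenvector_exists[OF assms, of E 0 x] E x by (auto simp: Q_def)
    then show False
      using max[of z] by (auto simp: Q_def)
  qed
  then have "singular_system T E"
    using assms E by (simp add: singular_system_def Q_def)
  then show ?thesis by blast
qed

lemma singular_system_cinner:
  assumes "singular_system T E" "e \<in> E" "e' \<in> E"
  shows "cinner (T e) (T e') = (if e = e' then of_real ((norm (T e))\<^sup>2) else 0)"
proof -
  have "cinner (T e) (T e') = of_real ((norm (T e'))\<^sup>2) * cinner e e'"
    using assms cinner_gram(1)[of T e e', symmetric]
    by (simp add: singular_system_def cinner_scaleR_right del: of_real_power)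
  then show ?thesis
    using assms by (auto simp: singular_system_def orthonormal_def)
qed

text \<open>The images of singular vectors are pairwise orthogonal. Infinitely many of norm above
  \<open>t\<close> would stay more than \<open>t\<close> apart, so no subsequence could converge,
  against compactness.\<close>

lemma finite_large_singular_values:
  assumes E: "singular_system T E" and t: "0 < t"
  shows "finite {e \<in> E. t < norm (T e)}"
proof (rule ccontr)
  assume "infinite {e \<in> E. t < norm (T e)}"
  then obtain e :: "nat \<Rightarrow> _" where e: "inj e" "range e \<subseteq> {e \<in> E. t < norm (T e)}"
    using infinite_countable_subset by blast
  have "norm (e n) \<le> 1" for n
    using orthonormal_norm[of E "e n"] E e(2) by (simp add: singular_system_def image_subset_iff)
  then obtain y r where r: "strict_mono (r :: nat \<Rightarrow> nat)" "(\<lambda>n. T (e (r n))) \<longlonglongrightarrow> y"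
    using compact_operator_subseq[of T e] E by (metis singular_system_def)
  then have "Cauchy (\<lambda>n. T (e (r n)))"
    using LIMSEQ_imp_Cauchy by blast
  then obtain N where N: "\<And>m n. m \<ge> N \<Longrightarrow> n \<ge> N \<Longrightarrow> dist (T (e (r m))) (T (e (r n))) < t"
    using t unfolding Cauchy_def by metis
  define a b where "a = e (r N)" and "b = e (r (Suc N))"
  have ab: "a \<in> E" "b \<in> E" "t < norm (T a)" "t < norm (T b)"
    using e(2) by (auto simp: a_def b_def)
  have "a \<noteq> b"
    using injD[OF e(1), of "r N" "r (Suc N)"] strict_monoD[OF r(1), of N "Suc N"]
    by (auto simp: a_def b_def)
  then have "cinner (T a) (- T b) = 0"
    using singular_system_cinner[OF E ab(1,2)] cinner_diff_right[of "T a" 0 "T b"] by simp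
  then have "(norm (T a - T b))\<^sup>2 = (norm (T a))\<^sup>2 + (norm (T b))\<^sup>2"
    using norm_add_orthogonal[of "T a" "- T b"] by simp
  moreover have "(norm (T a - T b))\<^sup>2 < t\<^sup>2"
    using N[of N "Suc N"] t by (intro power_strict_mono) (auto simp: a_def b_def dist_norm)
  moreover have "t\<^sup>2 < (norm (T a))\<^sup>2"
    using ab t by (intro power_strict_mono) auto
  ultimately show False
    using zero_le_power2[of "norm (T b)"] by linarith
qed

text \<open>Otherwise an eigenvector \<open>z\<close> with \<open>t < norm (T z)\<close> exists
  orthogonally to the large singular vectors. It is orthogonal to the small ones too, having a
  different eigenvalue, so completeness gives \<open>T z = 0\<close>.\<close>

lemma singular_system_bound:
  assumes E: "singular_system T E" and t: "0 \<le> t"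
    and x: "\<And>e. e \<in> E \<Longrightarrow> t < norm (T e) \<Longrightarrow> cinner e x = 0"
  shows "norm (T x) \<le> t * norm x"
proof (rule ccontr)
  assume "\<not> norm (T x) \<le> t * norm x"
  let ?F = "{e \<in> E. t < norm (T e)}"
  have T: "clinear_op T" "compact_operator T"
    using E by (auto simp: singular_system_def)
  have "\<exists>z. norm z = 1 \<and> (\<forall>e\<in>?F. cinner e z = 0) \<and> t < norm (T z) \<and>
      (hadjoint T o\<^sub>L T) z = (norm (T z))\<^sup>2 *\<^sub>R z"
  proof (rule gram_eigenvector_exists[OF T _ t])
    show "\<exists>a. (hadjoint T o\<^sub>L T) e = a *\<^sub>R e" if "e \<in> ?F" for e
      using E that unfolding singular_system_def by blast
    show "t * norm x < norm (T x)"
      using \<open>\<not> norm (T x) \<le> t * norm x\<close> by simp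
  qed (use x in auto)
  then obtain z where z: "\<forall>e\<in>?F. cinner e z = 0" "t < norm (T z)"
      "(hadjoint T o\<^sub>L T) z = (norm (T z))\<^sup>2 *\<^sub>R z"
    by blast
  have "cinner e z = 0" if "e \<in> E" for e
  proof (cases "t < norm (T e)")
    case False
    then have "norm (T e) < norm (T z)"
      using z(2) by linarith
    then have "(norm (T e))\<^sup>2 \<noteq> (norm (T z))\<^sup>2"
      by simp
    with that E show ?thesis
      by (intro eigenvector_orthogonal[OF T(1) _ z(3)]) (auto simp: singular_system_def)
  qed (use that z in auto)
  then have "T z = 0"
    using E unfolding singular_system_def by blast
  then show False
    using z(2) t by simp
qed

lemma finite_singular_value_fibre:
  assumes "singular_system T E" "0 < s"
  shows "finite {e \<in> E. norm (T e) = s}"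
  by (rule finite_subset[OF _ finite_large_singular_values[OF assms(1), of "s / 2"]])
     (use assms(2) in auto)

text \<open>Removing from an eigenvector for \<open>s\<^sup>2\<close> its components along the fibre
  over \<open>s\<close> leaves an eigenvector orthogonal to all of \<open>E\<close>. By completeness
  \<open>T\<close> kills it, and \<open>s > 0\<close> makes it zero.\<close>

lemma singular_multiplicity_eq_card:
  assumes E: "singular_system T E" and s: "0 < s"
  shows "singular_multiplicity T s = card {e \<in> E. norm (T e) = s}"
proof -
  define S where "S = hadjoint T o\<^sub>L T"
  define B where "B = {e \<in> E. norm (T e) = s}"
  define V where "V = {x. S x = s\<^sup>2 *\<^sub>R x}"
  have T: "clinear_op T" and on: "orthonormal E"
    using E by (auto simp: singular_system_def)
  have clS: "clinear_op S"
    unfolding S_def by (intro clinear_op_compose clinear_op_hadjoint T)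
  have fin: "finite B"
    unfolding B_def by (rule finite_singular_value_fibre[OF E s])
  have onB: "orthonormal B"
    by (rule orthonormal_subset[OF on]) (auto simp: B_def)
  have BV: "B \<subseteq> V"
    using E by (auto simp: B_def V_def S_def singular_system_def)
  have "V \<subseteq> complex_vector.span B"
  proof
    fix x assume x: "x \<in> V"
    define p where "p = (\<Sum>b\<in>B. cinner b x *\<^sub>C b)"
    define y where "y = x - p"
    have pB: "p \<in> complex_vector.span B"
      unfolding p_def
      by (intro complex_vector.span_sum complex_vector.span_scale complex_vector.span_base)
    have "S b = s\<^sup>2 *\<^sub>R b" if "b \<in> B" for b
      using BV that by (auto simp: V_def)
    then have "S p = s\<^sup>2 *\<^sub>R p"
      unfolding p_def using clS
      by (simp add: blinfun.sum_right clinear_op_def scaleR_sum_right scaleR_scaleC scaleC_scaleC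
          complex_vector.scale_sum_right mult.commute)
    then have Sy: "S y = s\<^sup>2 *\<^sub>R y"
      using x by (simp add: y_def V_def blinfun.diff_right scaleR_diff_right)
    have "cinner e y = 0" if "e \<in> E" for e
    proof (cases "norm (T e) = s")
      case True
      then show ?thesis
        using cinner_residual[OF onB fin, of e x] that by (simp add: B_def y_def p_def)
    next
      case False
      then have "(norm (T e))\<^sup>2 \<noteq> s\<^sup>2"
        using s by simp
      then show ?thesis
        using that E by (intro eigenvector_orthogonal[OF T _ Sy[unfolded S_def]])
          (auto simp: singular_system_def)
    qed
    then have "T y = 0"
      using E unfolding singular_system_def by blast
    then have "s\<^sup>2 *\<^sub>R y = 0"
      using Sy by (simp add: S_def)
    then show "x \<in> complex_vector.span B"
      using s pB by (simp add: y_def)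
  qed
  then have "complex_vector.dim V = card B"
    using BV orthonormal_independent[OF onB] by (intro complex_vector.dim_unique) auto
  then show ?thesis
    by (simp add: singular_multiplicity_def V_def S_def B_def)
qed

lemma summable_on_nonnegI:
  fixes f :: "'a \<Rightarrow> real"
  assumes "\<And>x. x \<in> A \<Longrightarrow> 0 \<le> f x" "\<And>F. finite F \<Longrightarrow> F \<subseteq> A \<Longrightarrow> sum f F \<le> C"
  shows "f summable_on A"
  by (rule nonneg_bdd_above_summable_on) (use assms in \<open>auto intro!: bdd_aboveI[of _ C]\<close>)

text \<open>Translates the sum in \<open>schatten\<close>, which is grouped by singular values, into
  a sum over singular vectors; each group is finite because \<open>s > 0\<close>.\<close>

lemma summable_singular_values_iff:
  assumes E: "singular_system T E"
  shows "(\<lambda>s. real (singular_multiplicity T s) * s powr p) summable_on {0<..} \<longleftrightarrow>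
     (\<lambda>e. norm (T e) powr p) summable_on E"
proof -
  define B where "B s = {e \<in> E. norm (T e) = s}" for s
  have fin: "finite (B s)" if "0 < s" for s
    unfolding B_def by (rule finite_singular_value_fibre[OF E that])
  have mult: "real (singular_multiplicity T s) * s powr p = (\<Sum>e\<in>B s. norm (T e) powr p)"
    if "0 < s" for s
    by (simp add: singular_multiplicity_eq_card[OF E that] B_def)
  have pos: "0 < norm (T e)" if "e \<in> E" for e
    using E that by (auto simp: singular_system_def)
  show ?thesis
  proof
    assume *: "(\<lambda>s. real (singular_multiplicity T s) * s powr p) summable_on {0<..}"
    show "(\<lambda>e. norm (T e) powr p) summable_on E"
    proof (rule summable_on_nonnegI)
      fix F assume F: "finite F" "F \<subseteq> E"
      have "(\<Sum>e\<in>F. norm (T e) powr p)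
          = (\<Sum>s\<in>(\<lambda>e. norm (T e)) ` F. \<Sum>e | e \<in> F \<and> norm (T e) = s. norm (T e) powr p)"
        by (rule sum.image_gen[OF F(1)])
      also have "\<dots> \<le> (\<Sum>s\<in>(\<lambda>e. norm (T e)) ` F. real (singular_multiplicity T s) * s powr p)"
      proof (rule sum_mono)
        fix s assume "s \<in> (\<lambda>e. norm (T e)) ` F"
        then have s: "0 < s"
          using pos F by blast
        show "(\<Sum>e | e \<in> F \<and> norm (T e) = s. norm (T e) powr p)
            \<le> real (singular_multiplicity T s) * s powr p"
          unfolding mult[OF s] by (rule sum_mono2[OF fin[OF s]]) (use F in \<open>auto simp: B_def\<close>)
      qed
      also have "\<dots> \<le> (\<Sum>\<^sub>\<infinity>s\<in>{0<..}. real (singular_multiplicity T s) * s powr p)"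
        using F pos by (intro finite_sum_le_infsum *) auto
      finally show "(\<Sum>e\<in>F. norm (T e) powr p)
          \<le> (\<Sum>\<^sub>\<infinity>s\<in>{0<..}. real (singular_multiplicity T s) * s powr p)" .
    qed simp
  next
    assume *: "(\<lambda>e. norm (T e) powr p) summable_on E"
    show "(\<lambda>s. real (singular_multiplicity T s) * s powr p) summable_on {0<..}"
    proof (rule summable_on_nonnegI)
      fix F :: "real set" assume F: "finite F" "F \<subseteq> {0<..}"
      have "(\<Sum>s\<in>F. real (singular_multiplicity T s) * s powr p)
          = (\<Sum>s\<in>F. \<Sum>e\<in>B s. norm (T e) powr p)"
        using F by (intro sum.cong) (auto simp: mult)
      also have "\<dots> = (\<Sum>e\<in>(\<Union>s\<in>F. B s). norm (T e) powr p)"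
        using F fin by (intro sum.UNION_disjoint[symmetric]) (auto simp: B_def)
      also have "\<dots> \<le> (\<Sum>\<^sub>\<infinity>e\<in>E. norm (T e) powr p)"
        using F fin by (intro finite_sum_le_infsum *) (auto simp: B_def)
      finally show "(\<Sum>s\<in>F. real (singular_multiplicity T s) * s powr p)
          \<le> (\<Sum>\<^sub>\<infinity>e\<in>E. norm (T e) powr p)" .
    qed simp
  qed
qed

text \<open>After extension of \<open>E\<close> to a basis of the ambient space, the added vectors
  are orthogonal to \<open>E\<close> and hence killed by \<open>T\<close>.\<close>

lemma singular_expansion:
  fixes T :: "'h::complex_hilbert_space \<Rightarrow>\<^sub>L 'h"
  assumes E: "singular_system T E"
  shows "((\<lambda>e. cinner e x *\<^sub>C T e) has_sum T x) E"
proof -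
  have on: "orthonormal E" and T: "clinear_op T"
    using E by (auto simp: singular_system_def)
  obtain B where B: "E \<subseteq> B" "orthonormal_basis_of UNIV B"
    using orthonormal_basis_extension[of UNIV E] on by (auto simp: complex_vector.subspace_UNIV)
  have "T b = 0" if "b \<in> B" "b \<notin> E" for b
  proof -
    have "cinner e b = 0" if "e \<in> E" for e
      using B \<open>b \<in> B\<close> \<open>b \<notin> E\<close> that unfolding orthonormal_basis_of_def by (metis subsetD)
    then show ?thesis
      using E unfolding singular_system_def by blast
  qed
  moreover have "((\<lambda>b. T (cinner b x *\<^sub>C b)) has_sum T x) B"
    by (rule has_sum_bounded_linear[OF blinfun.bounded_linear_right orthonormal_expansion[OF B(2)]]) simp
  ultimately have "((\<lambda>b. cinner b x *\<^sub>C T b) has_sum T x) B" "\<And>b. b \<in> B - E \<Longrightarrow> T b = 0"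
    using T by (auto simp: clinear_op_def)
  then show ?thesis
    using B(1) has_sum_cong_neutral[of E B "\<lambda>b. cinner b x *\<^sub>C T b" "\<lambda>b. cinner b x *\<^sub>C T b" "T x"]
    by auto
qed

section \<open>Approximation by operators of finite rank\<close>

text \<open>A bound on approximation numbers: \<open>t\<close> bounds the distance from
  \<open>T\<close> to the operators of rank at most \<open>r\<close>. Rank is expressed by a finite
  spanning set of the range, so sums and products need only unions and images of such sets.\<close>

definition approximable :: "('h::complex_hilbert_space \<Rightarrow>\<^sub>L 'h) \<Rightarrow> nat \<Rightarrow> real \<Rightarrow> bool" where
  "approximable T r t \<longleftrightarrow> (\<exists>R B. clinear_op R \<and> finite B \<and> card B \<le> r \<and>
     range (blinfun_apply R) \<subseteq> complex_vector.span B \<and> norm (T - R) \<le> t)"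

lemma norm_scaleC_blinfun_le: "norm (c *\<^sub>C T) \<le> norm c * norm T"
  for T :: "'h::complex_hilbert_space \<Rightarrow>\<^sub>L 'h"
  by (rule norm_blinfun_bound)
     (use norm_blinfun[of T] in \<open>auto simp: blinfun_apply_scaleC norm_scaleC mult.assoc intro: mult_left_mono\<close>)

lemma approximable_norm: "norm T \<le> t \<Longrightarrow> approximable T r t"
  unfolding approximable_def
  by (rule exI[of _ 0], rule exI[of _ "{}"]) (auto simp: clinear_op_zero)

lemma approximable_mono: "approximable T r t \<Longrightarrow> t \<le> t' \<Longrightarrow> approximable T r t'"
  unfolding approximable_def by (meson order_trans)

lemma approximable_add:
  assumes "approximable S r t" "approximable T s u"
  shows "approximable (S + T) (r + s) (t + u)"
proof -
  obtain Q A R B where *: "clinear_op Q" "finite A" "card A \<le> r"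
      "range (blinfun_apply Q) \<subseteq> complex_vector.span A" "norm (S - Q) \<le> t"
      "clinear_op R" "finite B" "card B \<le> s"
      "range (blinfun_apply R) \<subseteq> complex_vector.span B" "norm (T - R) \<le> u"
    using assms unfolding approximable_def by metis
  have "Q x + R x \<in> complex_vector.span (A \<union> B)" for x
    using * complex_vector.span_mono[of A "A \<union> B"] complex_vector.span_mono[of B "A \<union> B"]
    by (intro complex_vector.span_add) auto
  moreover have "card (A \<union> B) \<le> r + s"
    using * card_Un_le[of A B] by linarith
  moreover have "norm (S + T - (Q + R)) \<le> t + u"
    using * norm_triangle_ineq[of "S - Q" "T - R"] by (simp add: algebra_simps)
  ultimately show ?thesis
    unfolding approximable_def using *
    by (intro exI[of _ "Q + R"] exI[of _ "A \<union> B"]) (auto simp: clinear_op_add blinfun.add_left)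
qed

lemma approximable_scaleC:
  assumes "approximable T r t"
  shows "approximable (c *\<^sub>C T) r (norm c * t)"
proof -
  obtain R B where *: "clinear_op R" "finite B" "card B \<le> r"
      "range (blinfun_apply R) \<subseteq> complex_vector.span B" "norm (T - R) \<le> t"
    using assms unfolding approximable_def by metis
  have "norm (c *\<^sub>C (T - R)) \<le> norm c * t"
    using norm_scaleC_blinfun_le mult_left_mono[OF *(5) norm_ge_zero] by (rule order_trans)
  then show ?thesis
    unfolding approximable_def using *
    by (intro exI[of _ "c *\<^sub>C R"] exI[of _ B])
       (auto simp: clinear_op_scaleC blinfun_apply_scaleC complex_vector.scale_right_diff_distrib
         intro: complex_vector.span_scale)
qed

text \<open>If \<open>Q\<close> and \<open>R\<close> approximate \<open>S\<close> and \<open>T\<close>, then \<open>(S - Q)(T - R)\<close> differs from \<open>ST\<close> by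
  \<open>QT + (S - Q)R\<close>, so errors multiply while ranks add.\<close>

lemma approximable_compose:
  assumes S: "clinear_op S" and T: "clinear_op T"
    and "approximable S r t" "approximable T s u"
  shows "approximable (S o\<^sub>L T) (r + s) (t * u)"
proof -
  obtain Q A R B where *: "clinear_op Q" "finite A" "card A \<le> r"
      "range (blinfun_apply Q) \<subseteq> complex_vector.span A" "norm (S - Q) \<le> t"
      "clinear_op R" "finite B" "card B \<le> s"
      "range (blinfun_apply R) \<subseteq> complex_vector.span B" "norm (T - R) \<le> u"
    using assms unfolding approximable_def by metis
  define C where "C = blinfun_apply (S - Q) ` B"
  define P where "P = (Q o\<^sub>L T) + ((S - Q) o\<^sub>L R)"
  have clSQ: "clinear_op (S - Q)"
    by (rule clinear_op_diff[OF S *(1)])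
  have SQ: "(S - Q) x \<in> complex_vector.span C" if "x \<in> complex_vector.span B" for x
    using that
  proof (induction rule: complex_vector.span_induct_alt)
    case (step c x y)
    then have "c *\<^sub>C (S - Q) x + (S - Q) y \<in> complex_vector.span C"
      unfolding C_def
      by (intro complex_vector.span_add complex_vector.span_scale)
         (auto intro: complex_vector.span_base)
    then show ?case
      using clSQ by (simp add: clinear_op_def blinfun.add_right)
  qed (simp add: complex_vector.span_zero)
  have "P x \<in> complex_vector.span (A \<union> C)" for x
  proof -
    have "Q (T x) \<in> complex_vector.span (A \<union> C)"
      using *(4) complex_vector.span_mono[of A "A \<union> C"] by auto
    moreover have "(S - Q) (R x) \<in> complex_vector.span (A \<union> C)"
      using *(9) SQ complex_vector.span_mono[of C "A \<union> C"] by blast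
    ultimately show ?thesis
      unfolding P_def by (simp add: blinfun.add_left complex_vector.span_add)
  qed
  moreover have "card (A \<union> C) \<le> r + s"
    using * card_Un_le[of A C] card_image_le[of B "blinfun_apply (S - Q)"]
    unfolding C_def by linarith
  moreover have "norm ((S o\<^sub>L T) - P) \<le> t * u"
  proof -
    have "(S o\<^sub>L T) - P = (S - Q) o\<^sub>L (T - R)"
      by (rule blinfun_eqI) (simp add: P_def blinfun.add_left blinfun.diff_left blinfun.diff_right)
    also have "norm \<dots> \<le> norm (S - Q) * norm (T - R)"
      by (rule norm_blinfun_compose)
    also have "\<dots> \<le> t * u"
      using *(5,10) order_trans[OF norm_ge_zero *(5)] by (intro mult_mono) auto
    finally show ?thesis .
  qed
  moreover have "clinear_op P"
    unfolding P_def by (intro clinear_op_add clinear_op_compose * T clSQ)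
  ultimately show ?thesis
    unfolding approximable_def using * by (intro exI[of _ P] exI[of _ "A \<union> C"]) (auto simp: C_def)
qed

lemma bounded_linear_scaleC_left: "bounded_linear (\<lambda>c. c *\<^sub>C x)"
  for x :: "'h::complex_hilbert_space"
  by (rule bounded_linear_intro[where K = "norm x"])
     (simp_all add: scaleC_add_left scaleR_scaleC[where 'a = 'h] scaleC_scaleC scaleR_conv_of_real
       norm_scaleC)

text \<open>The approximant is the singular expansion truncated to the values above
  \<open>t\<close>. The error is \<open>T\<close> applied to a residual orthogonal to the retained
  vectors, which \<open>singular_system_bound\<close> controls.\<close>

lemma approximable_singular_values:
  fixes T :: "'h::complex_hilbert_space \<Rightarrow>\<^sub>L 'h"
  assumes E: "singular_system T E" and t: "0 < t"
  shows "approximable T (card {e \<in> E. t < norm (T e)}) t"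
proof -
  define F where "F = {e \<in> E. t < norm (T e)}"
  have fin: "finite F"
    unfolding F_def by (rule finite_large_singular_values[OF E t])
  have T: "clinear_op T" and on: "orthonormal F"
    using E orthonormal_subset[of E F] by (auto simp: singular_system_def F_def)
  define R where "R = Blinfun (\<lambda>x. \<Sum>e\<in>F. cinner e x *\<^sub>C T e)"
  have "bounded_linear (\<lambda>x. \<Sum>e\<in>F. cinner e x *\<^sub>C T e)"
    by (intro bounded_linear_sum bounded_linear_compose[OF bounded_linear_scaleC_left]
        bounded_linear_cinner_right)
  then have R: "R x = (\<Sum>e\<in>F. cinner e x *\<^sub>C T e)" for x
    unfolding R_def by (simp add: bounded_linear_Blinfun_apply)
  have "clinear_op R"
    by (simp add: clinear_op_def R cinner_scaleC_right complex_vector.scale_sum_right scaleC_scaleC)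
  moreover have "range (blinfun_apply R) \<subseteq> complex_vector.span (blinfun_apply T ` F)"
    by (auto simp: R intro!: complex_vector.span_sum complex_vector.span_scale
        intro: complex_vector.span_base)
  moreover have "norm (T - R) \<le> t"
  proof (rule norm_blinfun_bound)
    fix x
    define y where "y = x - (\<Sum>e\<in>F. cinner e x *\<^sub>C e)"
    have "(T - R) x = T y"
      using T by (simp add: y_def R blinfun.diff_left blinfun.diff_right blinfun.sum_right clinear_op_def)
    moreover have "norm (T y) \<le> t * norm y"
      by (rule singular_system_bound[OF E]) (use t cinner_residual[OF on fin] in \<open>auto simp: y_def F_def\<close>)
    moreover have "norm y \<le> norm x"
      using norm_residual_le[OF on fin complex_vector.span_zero, of x] by (simp add: y_def)
    ultimately show "norm ((T - R) x) \<le> t * norm x"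
      using t by (smt (verit) mult_left_mono)
  qed (use t in simp)
  ultimately show ?thesis
    unfolding approximable_def F_def[symmetric]
    using fin card_image_le[OF fin] by (intro exI[of _ R] exI[of _ "blinfun_apply T ` F"]) auto
qed

text \<open>On the span of \<open>F\<close> the operator \<open>T\<close> stretches every nonzero
  vector by more than \<open>t\<close>, so an \<open>R\<close> within \<open>t\<close> of
  \<open>T\<close> has no kernel there. It maps \<open>F\<close> to independent vectors in the span
  of \<open>B\<close>.\<close>

lemma singular_values_le_rank:
  fixes T :: "'h::complex_hilbert_space \<Rightarrow>\<^sub>L 'h"
  assumes E: "singular_system T E" and ap: "approximable T r t"
    and F: "finite F" "F \<subseteq> {e \<in> E. t < norm (T e)}"
  shows "card F \<le> r"
proof -
  have T: "clinear_op T" and on: "orthonormal F" and onE: "orthonormal E"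
    using E F orthonormal_subset[of E F] by (auto simp: singular_system_def)
  obtain R B where R: "clinear_op R" "finite B" "card B \<le> r"
      "range (blinfun_apply R) \<subseteq> complex_vector.span B" "norm (T - R) \<le> t"
    using ap unfolding approximable_def by metis
  have t: "0 \<le> t"
    using R(5) norm_ge_zero[of "T - R"] by linarith
  interpret R: module_hom scaleC scaleC "blinfun_apply R"
    by unfold_locales
       (use R(1) in \<open>simp_all add: clinear_op_def blinfun.add_right scaleC_add_right scaleC_add_left
         scaleC_scaleC scaleC_one\<close>)
  have ker: "x = 0" if x: "x \<in> complex_vector.span F" "R x = 0" for x
  proof -
    obtain c where c: "x = (\<Sum>e\<in>F. c e *\<^sub>C e)"
      using x(1) complex_vector.span_finite[OF F(1)] by auto
    have "norm (T x) = norm ((T - R) x)"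
      using x(2) by (simp add: blinfun.diff_left)
    also have "\<dots> \<le> norm (T - R) * norm x"
      by (rule norm_blinfun)
    also have "\<dots> \<le> t * norm x"
      by (intro mult_right_mono R) simp
    finally have "(norm (T x))\<^sup>2 \<le> t\<^sup>2 * (norm x)\<^sup>2"
      using power_mono[of "norm (T x)" "t * norm x" 2] by (simp add: power_mult_distrib)
    also have "(norm x)\<^sup>2 = (\<Sum>e\<in>F. (norm (c e))\<^sup>2)"
      unfolding c by (rule norm_orthonormal_sum[OF on F(1)])
    also have "(norm (T x))\<^sup>2 = (\<Sum>e\<in>F. (norm (T e))\<^sup>2 * (norm (c e))\<^sup>2)"
    proof -
      have Tx: "T x = (\<Sum>e\<in>F. c e *\<^sub>C T e)"
        using T by (simp add: c blinfun.sum_right clinear_op_def)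
      have "cinner (T x) (T x) = (\<Sum>e\<in>F. cnj (c e) * cinner (T e) (T x))"
        by (subst Tx) (simp add: cinner_sum_left cinner_scaleC_left)
      also have "\<dots> = (\<Sum>e\<in>F. cnj (c e) * (\<Sum>e'\<in>F. c e' * cinner (T e) (T e')))"
        by (simp add: Tx cinner_sum_right cinner_scaleC_right)
      also have "\<dots> = (\<Sum>e\<in>F. cnj (c e) * (\<Sum>e'\<in>F. if e = e' then c e' * of_real ((norm (T e))\<^sup>2) else 0))"
        using F(2) by (intro sum.cong arg_cong2[of _ _ _ _ "(*)"] refl)
          (auto simp: subset_iff singular_system_cinner[OF E])
      also have "\<dots> = (\<Sum>e\<in>F. of_real ((norm (T e))\<^sup>2 * (norm (c e))\<^sup>2))"
        using F(1) by (intro sum.cong) (simp_all add: complex_norm_square mult_ac del: of_real_power)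
      finally have "complex_of_real ((norm (T x))\<^sup>2) = of_real (\<Sum>e\<in>F. (norm (T e))\<^sup>2 * (norm (c e))\<^sup>2)"
        by (simp only: cinner_self of_real_sum)
      then show ?thesis
        by (simp only: of_real_eq_iff)
    qed
    finally have le: "(\<Sum>e\<in>F. ((norm (T e))\<^sup>2 - t\<^sup>2) * (norm (c e))\<^sup>2) \<le> 0"
      by (simp add: algebra_simps sum_subtractf sum_distrib_left)
    have pos: "0 < (norm (T e))\<^sup>2 - t\<^sup>2" if "e \<in> F" for e
      using F(2) that t power_strict_mono[of t "norm (T e)" 2] by auto
    then have "(\<Sum>e\<in>F. ((norm (T e))\<^sup>2 - t\<^sup>2) * (norm (c e))\<^sup>2) = 0"
      by (intro antisym le sum_nonneg mult_nonneg_nonneg) (auto simp: less_imp_le)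
    then have "\<forall>e\<in>F. ((norm (T e))\<^sup>2 - t\<^sup>2) * (norm (c e))\<^sup>2 = 0"
      using F(1) pos by (subst (asm) sum_nonneg_eq_0_iff) (auto simp: less_imp_le)
    then have "\<forall>e\<in>F. c e = 0"
      using pos by force
    then show ?thesis
      by (simp add: c)
  qed
  have inj: "inj_on (blinfun_apply R) (complex_vector.span F)"
  proof (rule inj_onI)
    fix x y assume "x \<in> complex_vector.span F" "y \<in> complex_vector.span F" "R x = R y"
    then show "x = y"
      using ker[of "x - y"] complex_vector.span_diff[of x F y] by (simp add: blinfun.diff_right)
  qed
  have "\<not> complex_vector.dependent (blinfun_apply R ` F)"
    by (rule R.independent_injective_image[OF orthonormal_independent[OF on] inj])
  then have "card (blinfun_apply R ` F) \<le> card B"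
    using complex_vector.independent_span_bound[OF R(2)] R(4) by blast
  moreover have "card (blinfun_apply R ` F) = card F"
    using inj_on_subset[OF inj] complex_vector.span_superset by (intro card_image) auto
  ultimately show ?thesis
    using R(3) by simp
qed

section \<open>Powers of a Schatten ideal\<close>

text \<open>\<open>schatten_power p k\<close> plays the role of the Schatten class with exponent \<open>p / k\<close>, of which
  the products of \<open>k\<close> operators of class \<open>p\<close> are members by Hoelder's inequality.  Testing
  the errors \<open>2\<^sup>-\<^sup>k\<^sup>j\<close> makes multiplicativity in \<open>k\<close> immediate.\<close>

definition schatten_power :: "real \<Rightarrow> nat \<Rightarrow> ('h::complex_hilbert_space \<Rightarrow>\<^sub>L 'h) set" where
  "schatten_power p k = {T. clinear_op T \<and> (0 < k \<longrightarrow> compact_operator T) \<and>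
     (\<exists>K r. 0 \<le> K \<and> (\<forall>j. approximable T (r j) (K * (1/2) ^ (k * j))) \<and>
        summable (\<lambda>j. real (r j) * (1/2) powr (p * real j)))}"

text \<open>For \<open>k = 0\<close> the permitted error does not depend on \<open>j\<close>, so
  rank 0 suffices with \<open>K = norm T\<close>.\<close>

lemma schatten_power_bounded:
  assumes "clinear_op T"
  shows "T \<in> schatten_power p 0"
  unfolding schatten_power_def
  using assms approximable_norm[OF order_refl, of T 0]
  by (auto intro!: exI[of _ "norm T"] exI[of _ "\<lambda>_. 0"])

lemma schatten_power_zero: "0 \<in> schatten_power p k"
  unfolding schatten_power_def
  by (auto simp: clinear_op_zero compact_operator_zero
      intro!: exI[of _ 0] exI[of _ "\<lambda>_. 0"] approximable_norm)

lemma schatten_power_add: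
  assumes "S \<in> schatten_power p k" "T \<in> schatten_power p k"
  shows "S + T \<in> schatten_power p k"
proof -
  obtain K r L s where *: "0 \<le> K" "\<And>j. approximable S (r j) (K * (1/2) ^ (k * j))"
      "summable (\<lambda>j. real (r j) * (1/2) powr (p * real j))"
      "0 \<le> L" "\<And>j. approximable T (s j) (L * (1/2) ^ (k * j))"
      "summable (\<lambda>j. real (s j) * (1/2) powr (p * real j))"
    using assms unfolding schatten_power_def by blast
  have "approximable (S + T) (r j + s j) ((K + L) * (1/2) ^ (k * j))" for j
    using approximable_add[OF *(2) *(5), of j j] by (simp add: algebra_simps)
  moreover have "summable (\<lambda>j. real (r j + s j) * (1/2) powr (p * real j))"
    using summable_add[OF *(3,6)] by (simp add: distrib_right)
  ultimately show ?thesis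
    using assms * unfolding schatten_power_def
    by (auto intro!: clinear_op_add compact_operator_add exI[of _ "K + L"] exI[of _ "\<lambda>j. r j + s j"])
qed

lemma schatten_power_scaleC:
  assumes "T \<in> schatten_power p k"
  shows "c *\<^sub>C T \<in> schatten_power p k"
proof -
  obtain K r where *: "0 \<le> K" "\<And>j. approximable T (r j) (K * (1/2) ^ (k * j))"
      "summable (\<lambda>j. real (r j) * (1/2) powr (p * real j))"
    using assms unfolding schatten_power_def by blast
  have "approximable (c *\<^sub>C T) (r j) (norm c * K * (1/2) ^ (k * j))" for j
    using approximable_scaleC[OF *(2)] by (simp add: mult.assoc)
  then show ?thesis
    using assms * unfolding schatten_power_def
    by (auto intro!: clinear_op_scaleC compact_operator_scaleC exI[of _ "norm c * K"] exI[of _ r])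
qed

lemma schatten_power_compose:
  assumes "S \<in> schatten_power p k" "T \<in> schatten_power p l"
  shows "S o\<^sub>L T \<in> schatten_power p (k + l)"
proof -
  obtain K r L s where *: "0 \<le> K" "\<And>j. approximable S (r j) (K * (1/2) ^ (k * j))"
      "summable (\<lambda>j. real (r j) * (1/2) powr (p * real j))"
      "0 \<le> L" "\<And>j. approximable T (s j) (L * (1/2) ^ (l * j))"
      "summable (\<lambda>j. real (s j) * (1/2) powr (p * real j))"
    using assms unfolding schatten_power_def by blast
  have cl: "clinear_op S" "clinear_op T"
    using assms by (auto simp: schatten_power_def)
  have "approximable (S o\<^sub>L T) (r j + s j) (K * L * (1/2) ^ ((k + l) * j))" for j
    using approximable_compose[OF cl *(2) *(5), of j j]
    by (simp add: algebra_simps power_add)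
  moreover have "summable (\<lambda>j. real (r j + s j) * (1/2) powr (p * real j))"
    using summable_add[OF *(3,6)] by (simp add: distrib_right)
  moreover have "compact_operator (S o\<^sub>L T)" if "0 < k + l"
    using that assms unfolding schatten_power_def
    by (cases "0 < k") (auto intro: compact_operator_compose_left compact_operator_compose_right)
  ultimately show ?thesis
    using * cl unfolding schatten_power_def
    by (auto intro!: clinear_op_compose exI[of _ "K * L"] exI[of _ "\<lambda>j. r j + s j"])
qed

text \<open>A geometric series from the first level \<open>i\<close> with
  \<open>(1/2) ^ i < s\<close>; its leading term is at most \<open>s powr p\<close>. This bounds
  what one singular value \<open>s\<close> contributes to the dyadic sum.\<close>

lemma sum_dyadic_le:
  fixes s p :: real
  assumes "0 < s" "0 < p"
  shows "(\<Sum>j | j < J \<and> (1/2) ^ j < s. (1/2) powr (p * real j)) \<le> s powr p / (1 - (1/2) powr p)"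
proof (cases "{j. j < J \<and> (1/2) ^ j < s} = {}")
  case True
  have "(1/2) powr p < (1::real)"
    using assms powr_less_mono2[of p "1/2" 1] by simp
  then show ?thesis
    unfolding True by simp
next
  case False
  define a where "a = (1/2::real) powr p"
  define i where "i = (LEAST j. (1/2::real) ^ j < s)"
  have a: "0 < a" "a < 1"
    using assms powr_less_mono2[of p "1/2" 1] by (simp_all add: a_def)
  have i: "(1/2) ^ i < s"
    unfolding i_def by (rule LeastI_ex) (use False in auto)
  have pw: "(1/2) powr (p * real j) = a ^ j" for j
    by (simp add: a_def powr_powr[symmetric] powr_realpow)
  have "(\<Sum>j | j < J \<and> (1/2) ^ j < s. a ^ j) \<le> (\<Sum>j\<in>{i..<i + J}. a ^ j)"
    by (rule sum_mono2) (use a in \<open>auto simp: i_def intro: Least_le\<close>)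
  also have "\<dots> = a ^ i * (\<Sum>j<J. a ^ j)"
    using sum.shift_bounds_nat_ivl[of "\<lambda>j. a ^ j" 0 i J]
    by (simp add: add.commute power_add sum_distrib_left mult.commute atLeast0LessThan)
  also have "\<dots> \<le> a ^ i * (1 / (1 - a))"
    using a by (intro mult_left_mono) (simp_all add: sum_gp_strict divide_right_mono)
  also have "a ^ i = ((1/2) ^ i) powr p"
    by (simp add: a_def powr_powr mult.commute flip: powr_realpow)
  also have "\<dots> \<le> s powr p"
    using i assms by (intro powr_mono2) auto
  finally show ?thesis
    using a by (simp add: pw a_def[symmetric] divide_right_mono)
qed

text \<open>The ranks are the numbers of singular values above \<open>(1/2) ^ j\<close>. Exchanging
  the sums over levels and over singular vectors leaves, for each vector, a geometric series
  comparable to \<open>norm (T e) powr p\<close>.\<close>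

lemma schatten_imp_schatten_power:
  assumes T: "T \<in> schatten p V W" and p: "0 < p"
  shows "T \<in> schatten_power p 1"
proof -
  have cT: "clinear_op T" "compact_operator T"
    using T by (auto simp: schatten_def operators_def clinear_op_def)
  obtain E where E: "singular_system T E"
    using singular_system_exists[OF cT] by blast
  have sm: "(\<lambda>e. norm (T e) powr p) summable_on E"
    using T summable_singular_values_iff[OF E] by (simp add: schatten_def)
  define F where "F j = {e \<in> E. (1/2) ^ j < norm (T e)}" for j :: nat
  have fin: "finite (F j)" for j
    unfolding F_def by (rule finite_large_singular_values[OF E]) simp
  have F_mono: "F i \<subseteq> F j" if "i \<le> j" for i j
  proof -
    have "(1/2::real) ^ j \<le> (1/2) ^ i"
      using that by (intro power_decreasing) auto
    then show ?thesis
      unfolding F_def using le_less_trans by blast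
  qed
  have "summable (\<lambda>j. real (card (F j)) * (1/2) powr (p * real j))"
  proof (rule summableI_nonneg_bounded)
    fix J
    have "(\<Sum>j<J. real (card (F j)) * (1/2) powr (p * real j))
        = (\<Sum>j<J. \<Sum>e\<in>F J. if (1/2) ^ j < norm (T e) then (1/2) powr (p * real j) else 0)"
    proof (rule sum.cong[OF refl])
      fix j assume "j \<in> {..<J}"
      then have "F j = {e \<in> F J. (1/2) ^ j < norm (T e)}"
        using F_mono[of j J] by (auto simp: F_def)
      then show "real (card (F j)) * (1/2) powr (p * real j)
          = (\<Sum>e\<in>F J. if (1/2) ^ j < norm (T e) then (1/2) powr (p * real j) else 0)"
        using fin[of J] by (simp add: sum.If_cases Int_def)
    qed
    also have "\<dots> = (\<Sum>e\<in>F J. \<Sum>j<J. if (1/2) ^ j < norm (T e) then (1/2) powr (p * real j) else 0)"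
      by (rule sum.swap)
    also have "\<dots> = (\<Sum>e\<in>F J. \<Sum>j | j < J \<and> (1/2) ^ j < norm (T e). (1/2) powr (p * real j))"
      by (simp add: sum.inter_filter[symmetric])
    also have "\<dots> \<le> (\<Sum>e\<in>F J. norm (T e) powr p / (1 - (1/2) powr p))"
    proof (rule sum_mono)
      fix e assume "e \<in> F J"
      then have "0 < norm (T e)"
        by (auto simp: F_def intro: less_trans[rotated])
      then show "(\<Sum>j | j < J \<and> (1/2) ^ j < norm (T e). (1/2) powr (p * real j))
          \<le> norm (T e) powr p / (1 - (1/2) powr p)"
        by (rule sum_dyadic_le[OF _ p])
    qed
    also have "\<dots> = (\<Sum>e\<in>F J. norm (T e) powr p) / (1 - (1/2) powr p)"
      by (simp add: sum_divide_distrib)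
    also have "\<dots> \<le> (\<Sum>\<^sub>\<infinity>e\<in>E. norm (T e) powr p) / (1 - (1/2) powr p)"
      by (intro divide_right_mono finite_sum_le_infsum sm fin)
         (use p powr_less_mono2[of p "1/2" 1] in \<open>auto simp: F_def\<close>)
    finally show "(\<Sum>j<J. real (card (F j)) * (1/2) powr (p * real j))
        \<le> (\<Sum>\<^sub>\<infinity>e\<in>E. norm (T e) powr p) / (1 - (1/2) powr p)" .
  qed simp
  moreover have "approximable T (card (F j)) (1 * (1/2) ^ (1 * j))" for j
    using approximable_singular_values[OF E, of "(1/2) ^ j"] by (simp add: F_def)
  ultimately show ?thesis
    using cT unfolding schatten_power_def by (auto intro!: exI[of _ 1] exI[of _ "\<lambda>j. card (F j)"])
qed

text \<open>Sorts the singular values by the first level \<open>K * q ^ j\<close> below them. At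
  most \<open>r j\<close> of them belong to level \<open>j\<close>, each of order
  \<open>q ^ j\<close>, and \<open>q ^ j = (1/2) ^ (k * j)\<close> is at most
  \<open>(1/2) powr (p * real j)\<close> because \<open>p \<le> k\<close>.\<close>

lemma schatten_power_imp_summable:
  assumes T: "T \<in> schatten_power p k" and k: "0 < k" "p \<le> real k"
    and E: "singular_system T E"
  shows "(\<lambda>e. norm (T e)) summable_on E"
proof -
  obtain K0 r where *: "0 \<le> K0" "\<And>j. approximable T (r j) (K0 * (1/2) ^ (k * j))"
      and sm: "summable (\<lambda>j. real (r j) * (1/2) powr (p * real j))"
    using T unfolding schatten_power_def by blast
  define q where "q = (1/2::real) ^ k"
  have q: "0 < q" "q < 1"
    using k by (simp_all add: q_def power_less_one_iff)
  \<comment> \<open>\<open>K0\<close> may be 0; the larger constant can be divided by, and the same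
    ranks still suffice for the larger errors.\<close>
  define K where "K = K0 + 1"
  have K: "0 < K"
    using * by (simp add: K_def)
  have ap: "approximable T (r j) (K * q ^ j)" for j
    by (rule approximable_mono[OF *(2)]) (simp add: K_def q_def power_mult distrib_right)
  define j0 where "j0 e = (LEAST j. K * q ^ j < norm (T e))" for e
  \<comment> \<open>Minimality bounds a singular value by the preceding level, which gives the
    factor \<open>K / q\<close>; the summand \<open>norm T\<close> covers level 0, which has no
    predecessor.\<close>
  have j0: "K * q ^ j0 e < norm (T e)" "norm (T e) \<le> (K / q + norm T) * q ^ j0 e" if e: "e \<in> E" for e
  proof -
    have pos: "0 < norm (T e)"
      using e E by (simp add: singular_system_def)
    have "\<exists>j. q ^ j < norm (T e) / K"
      using real_arch_pow_inv[of "norm (T e) / K" q] pos K q by simp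
    then have "\<exists>j. K * q ^ j < norm (T e)"
      using K by (simp add: field_simps)
    then show "K * q ^ j0 e < norm (T e)"
      unfolding j0_def by (rule LeastI_ex)
    show "norm (T e) \<le> (K / q + norm T) * q ^ j0 e"
    proof (cases "j0 e")
      case 0
      have "norm (T e) \<le> norm T"
        using norm_blinfun[of T e] orthonormal_norm[of E e] E e by (simp add: singular_system_def)
      also have "\<dots> \<le> K / q + norm T"
        using K q by simp
      finally show ?thesis
        by (simp add: 0)
    next
      case (Suc i)
      then have "\<not> K * q ^ i < norm (T e)"
        using not_less_Least[of i "\<lambda>j. K * q ^ j < norm (T e)"] by (simp add: j0_def)
      then have "norm (T e) \<le> K / q * q ^ j0 e"
        using q by (simp add: Suc)
      also have "\<dots> \<le> (K / q + norm T) * q ^ j0 e"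
        using q by (intro mult_right_mono) auto
      finally show ?thesis .
    qed
  qed
  define A where "A = (\<Sum>j. real (r j) * (1/2) powr (p * real j))"
  show ?thesis
  proof (rule summable_on_nonnegI)
    fix F assume F: "finite F" "F \<subseteq> E"
    have "(\<Sum>e\<in>F. norm (T e)) \<le> (\<Sum>e\<in>F. (K / q + norm T) * q ^ j0 e)"
      using F j0(2) by (intro sum_mono) auto
    also have "\<dots> = (K / q + norm T) * (\<Sum>e\<in>F. q ^ j0 e)"
      by (simp add: sum_distrib_left)
    also have "(\<Sum>e\<in>F. q ^ j0 e) = (\<Sum>j\<in>j0 ` F. \<Sum>e | e \<in> F \<and> j0 e = j. q ^ j0 e)"
      by (rule sum.image_gen[OF F(1)])
    also have "\<dots> = (\<Sum>j\<in>j0 ` F. real (card {e \<in> F. j0 e = j}) * q ^ j)"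
      by simp
    also have "\<dots> \<le> (\<Sum>j\<in>j0 ` F. real (r j) * (1/2) powr (p * real j))"
    proof (intro sum_mono mult_mono)
      fix j
      have "card {e \<in> F. j0 e = j} \<le> r j"
        by (rule singular_values_le_rank[OF E ap]) (use F j0(1) in auto)
      then show "real (card {e \<in> F. j0 e = j}) \<le> real (r j)"
        by simp
      have "q ^ j = (1/2) powr (real k * real j)"
        unfolding q_def using powr_realpow[of "1/2" "k * j"] by (simp add: power_mult)
      also have "\<dots> \<le> (1/2) powr (p * real j)"
        using k(2) by (intro powr_mono') (auto intro: mult_right_mono)
      finally show "q ^ j \<le> (1/2) powr (p * real j)" .
    qed (use q in auto)
    also have "\<dots> \<le> A"
      unfolding A_def by (intro sum_le_suminf sm) (use F in auto)
    finally show "(\<Sum>e\<in>F. norm (T e)) \<le> (K / q + norm T) * A"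
      using K q by (simp add: mult_left_mono)
  qed simp
qed

lemma schatten_power_imp_trace_class:
  assumes T: "T \<in> schatten_power p k" "T \<in> operators V W" and k: "0 < k" "p \<le> real k"
  shows "T \<in> schatten 1 V W"
proof -
  have cT: "clinear_op T" "compact_operator T"
    using T k by (auto simp: schatten_power_def)
  obtain E where E: "singular_system T E"
    using singular_system_exists[OF cT] by blast
  have "(\<lambda>e. norm (T e)) summable_on E"
    by (rule schatten_power_imp_summable[OF T(1) k E])
  then have "(\<lambda>s. real (singular_multiplicity T s) * s powr 1) summable_on {0<..}"
    unfolding summable_singular_values_iff[OF E] by simp
  then show ?thesis
    using T cT by (simp add: schatten_def)
qed

section \<open>Operators between graded spaces and their trace\<close>

lemma graded_parts:
  assumes "graded_hilbert V"
  shows "complex_vector.subspace (even_part V)" "closed (even_part V)"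
    and "complex_vector.subspace (odd_part V)" "closed (odd_part V)"
    and "x \<in> even_part V \<Longrightarrow> y \<in> odd_part V \<Longrightarrow> cinner x y = 0"
  using assms by (auto simp: graded_hilbert_def separable_subspace_def)

lemma even_in_space: "graded_hilbert V \<Longrightarrow> x \<in> even_part V \<Longrightarrow> x \<in> space_of V"
  using complex_vector.subspace_0[OF graded_parts(3)] by (force simp: space_of_def)

lemma odd_in_space: "graded_hilbert V \<Longrightarrow> x \<in> odd_part V \<Longrightarrow> x \<in> space_of V"
  using complex_vector.subspace_0[OF graded_parts(1)] by (force simp: space_of_def)

lemma graded_projections:
  assumes V: "graded_hilbert V" and xy: "x \<in> even_part V" "y \<in> odd_part V"
  shows "orth_proj (even_part V) (x + y) = x" "orth_proj (odd_part V) (x + y) = y"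
proof -
  have orth: "cinner a b = 0" "cinner b a = 0" if "a \<in> even_part V" "b \<in> odd_part V" for a b
    using graded_parts(5)[OF V that] cinner_eq_zero_commute by auto
  show "orth_proj (even_part V) (x + y) = x"
    by (rule orth_proj_eqI[OF graded_parts(1,2)[OF V]]) (use xy orth in auto)
  show "orth_proj (odd_part V) (x + y) = y"
    by (rule orth_proj_eqI[OF graded_parts(3,4)[OF V]]) (use xy orth in auto)
qed

lemma space_of_subspace:
  assumes V: "graded_hilbert V"
  shows "complex_vector.subspace (space_of V)" "closed (space_of V)"
proof -
  show "complex_vector.subspace (space_of V)"
    unfolding space_of_def by (rule complex_vector.subspace_sums; rule graded_parts[OF V])
  have "space_of V = {x. orth_proj (even_part V) x + orth_proj (odd_part V) x = x}"
  proof (intro set_eqI iffI)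
    fix x assume "x \<in> {x. orth_proj (even_part V) x + orth_proj (odd_part V) x = x}"
    moreover have "orth_proj (even_part V) x \<in> even_part V" "orth_proj (odd_part V) x \<in> odd_part V"
      using orth_proj_spec graded_parts[OF V] by blast+
    ultimately show "x \<in> space_of V"
      unfolding space_of_def by force
  qed (auto simp: space_of_def graded_projections[OF V])
  then show "closed (space_of V)"
    by (simp add: closed_Collect_eq continuous_on_add linear_continuous_on blinfun.bounded_linear_right)
qed

lemma ident_op_apply:
  assumes V: "graded_hilbert V"
  shows "ident_op V x \<in> space_of V" "\<And>v. v \<in> space_of V \<Longrightarrow> cinner v (x - ident_op V x) = 0"
    and "x \<in> space_of V \<Longrightarrow> ident_op V x = x"
  using orth_proj_spec[OF space_of_subspace[OF V]] orth_proj_id[OF space_of_subspace[OF V]]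
  by (auto simp: ident_op_def)

lemma operators_clinear: "T \<in> operators V W \<Longrightarrow> clinear_op T"
  by (simp add: operators_def clinear_op_def)

lemma operators_ident_right:
  assumes "graded_hilbert V" "T \<in> operators V W"
  shows "T o\<^sub>L ident_op V = T"
proof (rule blinfun_eqI)
  fix x
  have "T (x - ident_op V x) = 0"
    using assms ident_op_apply(2)[OF assms(1)] unfolding operators_def by blast
  then show "(T o\<^sub>L ident_op V) x = T x"
    by (simp add: blinfun.diff_right)
qed

lemma operators_range:
  assumes "graded_hilbert V" "T \<in> operators V W"
  shows "T x \<in> space_of W"
proof -
  have "T (ident_op V x) \<in> space_of W"
    using assms ident_op_apply(1)[OF assms(1)] unfolding operators_def by blast
  then show ?thesis
    using operators_ident_right[OF assms] by (metis blinfun_apply_blinfun_compose)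
qed

lemma operators_ident_left:
  assumes "graded_hilbert V" "graded_hilbert W" "T \<in> operators V W"
  shows "ident_op W o\<^sub>L T = T"
  by (rule blinfun_eqI) (simp add: ident_op_apply(3)[OF assms(2)] operators_range[OF assms(1,3)])

lemma operators_eqI:
  assumes V: "graded_hilbert V" and "S \<in> operators V W" "T \<in> operators V W'"
    and "\<And>x. x \<in> even_part V \<Longrightarrow> S x = T x" "\<And>x. x \<in> odd_part V \<Longrightarrow> S x = T x"
  shows "S = T"
proof (rule blinfun_eqI)
  fix x
  obtain y z where "y \<in> even_part V" "z \<in> odd_part V" "ident_op V x = y + z"
    using ident_op_apply(1)[OF V, of x] by (auto simp: space_of_def)
  then have "S (ident_op V x) = T (ident_op V x)"
    using assms by (simp add: blinfun.add_right)
  then show "S x = T x"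
    using operators_ident_right[OF V] assms(2,3) by (metis blinfun_apply_blinfun_compose)
qed

lemma operators_subspace:
  assumes "graded_hilbert W"
  shows "complex_vector.subspace (operators V W)"
  using space_of_subspace(1)[OF assms]
  by (intro complex_vector.subspaceI)
     (auto simp: operators_def blinfun.add_left blinfun_apply_scaleC scaleC_add_right
       scaleC_scaleC mult.commute complex_vector.subspace_add complex_vector.subspace_scale
       complex_vector.subspace_0)

lemma operators_compose:
  assumes "S \<in> operators U V" "T \<in> operators V W"
  shows "T o\<^sub>L S \<in> operators U W"
  using assms by (auto simp: operators_def)

lemma ident_op_operators:
  assumes V: "graded_hilbert V"
  shows "ident_op V \<in> operators V V"
  using ident_op_apply(1)[OF V] orth_proj_scaleC[OF space_of_subspace[OF V]]
    orth_proj_eq_0[OF space_of_subspace[OF V]]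
  by (auto simp: operators_def ident_op_def)

lemma grading_op_operators:
  assumes V: "graded_hilbert V"
  shows "grading_op V \<in> operators V V"
proof -
  note E = graded_parts(1,2)[OF V] and O = graded_parts(3,4)[OF V]
  have "orth_proj (even_part V) x - orth_proj (odd_part V) x \<in> space_of V" for x
    using orth_proj_spec[OF E, of x] orth_proj_spec[OF O, of x] even_in_space[OF V]
      odd_in_space[OF V] space_of_subspace(1)[OF V] complex_vector.subspace_diff by metis
  then show ?thesis
    using orth_proj_eq_0[OF E] orth_proj_eq_0[OF O] even_in_space[OF V] odd_in_space[OF V]
    by (auto simp: operators_def grading_op_def blinfun.diff_left orth_proj_scaleC[OF E]
        orth_proj_scaleC[OF O] complex_vector.scale_right_diff_distrib)
qed

lemma grading_op_even: "graded_hilbert V \<Longrightarrow> x \<in> even_part V \<Longrightarrow> grading_op V x = x"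
  and grading_op_odd: "graded_hilbert V \<Longrightarrow> x \<in> odd_part V \<Longrightarrow> grading_op V x = - x"
  using graded_projections[of V x 0] graded_projections[of V 0 x]
    complex_vector.subspace_0[OF graded_parts(1)[of V]]
    complex_vector.subspace_0[OF graded_parts(3)[of V]]
  by (auto simp: grading_op_def blinfun.diff_left)

lemma grading_op_degree0:
  assumes VW: "graded_hilbert V" "graded_hilbert W"
    and T: "T \<in> operators V W" "degree0_op V W T"
  shows "grading_op W o\<^sub>L T = T o\<^sub>L grading_op V"
  by (rule operators_eqI[OF VW(1) operators_compose[OF T(1) grading_op_operators[OF VW(2)]]
        operators_compose[OF grading_op_operators[OF VW(1)] T(1)]])
     (use T(2) in \<open>auto simp: degree0_op_def grading_op_even grading_op_odd VW blinfun.minus_right\<close>)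

lemma grading_op_degree1:
  assumes VW: "graded_hilbert V" "graded_hilbert W"
    and T: "T \<in> operators V W" "degree1_op V W T"
  shows "grading_op W o\<^sub>L T = - (T o\<^sub>L grading_op V)"
proof -
  have "- (T o\<^sub>L grading_op V) \<in> operators V W"
    by (intro complex_vector.subspace_neg operators_subspace VW
        operators_compose[OF grading_op_operators[OF VW(1)] T(1)])
  then show ?thesis
    by (rule operators_eqI[OF VW(1) operators_compose[OF T(1) grading_op_operators[OF VW(2)]]])
       (use T(2) in \<open>auto simp: degree1_op_def grading_op_even grading_op_odd VW blinfun.minus_right
          blinfun.minus_left\<close>)
qed

text \<open>The trace of \<open>T = \<Sum>\<^sub>e \<langle>e, \<cdot>\<rangle> T e\<close> is \<open>\<Sum>\<^sub>e \<langle>e, T e\<rangle>\<close>: by Bessel's inequality the double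
  series over \<open>e\<close> and a basis converges absolutely.\<close>

lemma trace_has_sum_singular:
  fixes T :: "'h::complex_hilbert_space \<Rightarrow>\<^sub>L 'h"
  assumes V: "graded_hilbert V" and T: "T \<in> operators V V" and E: "singular_system T E"
    and sm: "(\<lambda>e. norm (T e)) summable_on E" and B: "orthonormal_basis_of (space_of V) B"
  shows "((\<lambda>b. cinner b (T b)) has_sum (\<Sum>\<^sub>\<infinity>e\<in>E. cinner e (T e))) B"
proof -
  define f where "f = (\<lambda>(e, b). cinner e b * cinner b (T e))"
  have on: "orthonormal B" and onE: "orthonormal E"
    using B E by (auto simp: orthonormal_basis_of_def orthonormal_def singular_system_def)
  have row: "(\<Sum>b\<in>G. norm (cinner e b) * norm (cinner b (T e))) \<le> norm (T e)"
    if e: "e \<in> E" and G: "finite G" "G \<subseteq> B" for e G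
  proof -
    have onG: "orthonormal G"
      by (rule orthonormal_subset[OF on G(2)])
    have norm_le: "L2_set (\<lambda>b. norm (cinner b x)) G \<le> norm x" for x
      unfolding L2_set_def by (rule real_le_lsqrt) (use bessel_inequality[OF onG G(1), of x] in auto)
    have "(\<Sum>b\<in>G. norm (cinner e b) * norm (cinner b (T e)))
        = (\<Sum>b\<in>G. \<bar>norm (cinner b e)\<bar> * \<bar>norm (cinner b (T e))\<bar>)"
      by (intro sum.cong refl) (metis abs_norm_cancel cinner_commute complex_mod_cnj)
    also have "\<dots> \<le> L2_set (\<lambda>b. norm (cinner b e)) G * L2_set (\<lambda>b. norm (cinner b (T e))) G"
      by (rule L2_set_mult_ineq)
    also have "\<dots> \<le> norm e * norm (T e)"
      by (intro mult_mono norm_le L2_set_nonneg) auto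
    finally show ?thesis
      using orthonormal_norm[OF onE e] by simp
  qed
  have "(\<lambda>z. norm (f z)) summable_on E \<times> B"
  proof (rule summable_on_nonnegI)
    fix G assume G: "finite G" "G \<subseteq> E \<times> B"
    have "(\<Sum>z\<in>G. norm (f z)) \<le> (\<Sum>z\<in>fst ` G \<times> snd ` G. norm (f z))"
      by (rule sum_mono2) (use G in \<open>auto simp: image_iff intro!: rev_bexI\<close>)
    also have "\<dots> = (\<Sum>e\<in>fst ` G. \<Sum>b\<in>snd ` G. norm (cinner e b) * norm (cinner b (T e)))"
      by (simp add: sum.cartesian_product f_def norm_mult case_prod_unfold)
    also have "\<dots> \<le> (\<Sum>e\<in>fst ` G. norm (T e))"
      by (intro sum_mono row) (use G in auto)
    also have "\<dots> \<le> (\<Sum>\<^sub>\<infinity>e\<in>E. norm (T e))"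
      by (intro finite_sum_le_infsum sm) (use G in auto)
    finally show "(\<Sum>z\<in>G. norm (f z)) \<le> (\<Sum>\<^sub>\<infinity>e\<in>E. norm (T e))" .
  qed simp
  then obtain t where t: "(f has_sum t) (E \<times> B)"
    using abs_summable_summable unfolding summable_on_def by blast
  have "((\<lambda>e. cinner e (T e)) has_sum t) E"
  proof (rule has_sum_SigmaD[OF t])
    fix e assume "e \<in> E"
    show "((\<lambda>b. f (e, b)) has_sum cinner e (T e)) B"
      using parseval[OF B operators_range[OF V T, of e], of e] by (simp add: f_def)
  qed
  then have t_eq: "t = (\<Sum>\<^sub>\<infinity>e\<in>E. cinner e (T e))"
    by (simp add: infsumI)
  have t': "((\<lambda>(b, e). f (e, b)) has_sum t) (B \<times> E)"
    using t by (subst has_sum_swap) simp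
  have "((\<lambda>b. cinner b (T b)) has_sum t) B"
  proof (rule has_sum_SigmaD[OF t'])
    fix b assume "b \<in> B"
    have "((\<lambda>e. cinner b (cinner e b *\<^sub>C T e)) has_sum cinner b (T b)) E"
      by (rule has_sum_bounded_linear[OF bounded_linear_cinner_right singular_expansion[OF E]])
    then show "((\<lambda>e. case (b, e) of (b, e) \<Rightarrow> f (e, b)) has_sum cinner b (T b)) E"
      by (simp add: f_def cinner_scaleC_right)
  qed
  then show ?thesis
    by (simp add: t_eq)
qed

lemma has_sum_restrict_support:
  assumes "(f has_sum s) B" "\<And>x. x \<in> B - A \<Longrightarrow> f x = 0" "A \<subseteq> B"
  shows "(f has_sum s) A"
  using assms by (subst has_sum_cong_neutral[of B A f f]) auto

lemma schatten_1_summable: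
  assumes "T \<in> schatten 1 V W" "singular_system T E"
  shows "(\<lambda>e. norm (T e)) summable_on E"
  using assms(1) summable_singular_values_iff[OF assms(2), of 1] by (simp add: schatten_def)

text \<open>The sum over a singular system does not mention the basis, so it meets the definite
  description for all bases at once; the given basis makes the value unique.\<close>

lemma op_trace_has_sum:
  fixes T :: "'h::complex_hilbert_space \<Rightarrow>\<^sub>L 'h"
  assumes V: "graded_hilbert V" and T: "T \<in> schatten 1 V V"
    and B: "orthonormal_basis_of (space_of V) B"
  shows "((\<lambda>b. cinner b (T b)) has_sum op_trace V T) B"
proof -
  have T': "T \<in> operators V V" "clinear_op T" "compact_operator T"
    using T operators_clinear by (auto simp: schatten_def)
  obtain E where E: "singular_system T E"
    using singular_system_exists[OF T'(2,3)] by blast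
  let ?t = "\<Sum>\<^sub>\<infinity>e\<in>E. cinner e (T e)"
  have *: "((\<lambda>b. cinner b (T b)) has_sum ?t) B" if "orthonormal_basis_of (space_of V) B" for B
    by (rule trace_has_sum_singular[OF V T'(1) E schatten_1_summable[OF T E] that])
  have "op_trace V T = ?t"
    unfolding op_trace_def
  proof (rule the_equality)
    show "t = ?t" if "\<forall>B. orthonormal_basis_of (space_of V) B \<longrightarrow> ((\<lambda>e. cinner e (T e)) has_sum t) B" for t
      using that B *[OF B] has_sum_unique by blast
  qed (use * in blast)
  with *[OF B] show ?thesis
    by simp
qed

lemma basis_exists:
  assumes V: "graded_hilbert V"
  shows "\<exists>B. orthonormal_basis_of (space_of V) B"
  using orthonormal_basis_extension[OF space_of_subspace[OF V], of "{}"] by (auto simp: orthonormal_def)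

lemma op_trace_add:
  assumes V: "graded_hilbert V"
    and "S \<in> schatten 1 V V" "T \<in> schatten 1 V V" "S + T \<in> schatten 1 V V"
  shows "op_trace V (S + T) = op_trace V S + op_trace V T"
proof -
  obtain B where B: "orthonormal_basis_of (space_of V) B"
    using basis_exists[OF V] by blast
  have "((\<lambda>b. cinner b ((S + T) b)) has_sum op_trace V S + op_trace V T) B"
    using has_sum_add[OF op_trace_has_sum[OF V assms(2) B] op_trace_has_sum[OF V assms(3) B]]
    by (simp add: blinfun.add_left cinner_add_right)
  then show ?thesis
    using op_trace_has_sum[OF V assms(4) B] has_sum_unique by blast
qed

lemma op_trace_scaleC:
  assumes V: "graded_hilbert V" and "T \<in> schatten 1 V V" "c *\<^sub>C T \<in> schatten 1 V V"
  shows "op_trace V (c *\<^sub>C T) = c * op_trace V T"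
proof -
  obtain B where B: "orthonormal_basis_of (space_of V) B"
    using basis_exists[OF V] by blast
  have "((\<lambda>b. cinner b ((c *\<^sub>C T) b)) has_sum c * op_trace V T) B"
    using has_sum_cmult_right[OF op_trace_has_sum[OF V assms(2) B], of c]
    by (simp add: blinfun_apply_scaleC cinner_scaleC_right)
  then show ?thesis
    using op_trace_has_sum[OF V assms(3) B] has_sum_unique by blast
qed

text \<open>With the singular vectors \<open>e\<close> of \<open>A\<close>, extend the system of the \<open>e\<close> to a basis of \<open>V\<close> and
  that of the vectors \<open>A e / \<parallel>A e\<parallel>\<close> to a basis of \<open>W\<close>: both traces become
  \<open>\<Sum>\<^sub>e \<langle>e, B A e\<rangle>\<close>.\<close>

lemma op_trace_commute:
  fixes A B :: "'h::complex_hilbert_space \<Rightarrow>\<^sub>L 'h"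
  assumes V: "graded_hilbert V" and W: "graded_hilbert W"
    and A: "A \<in> operators V W" "compact_operator A" and B: "B \<in> operators W V"
    and BA: "B o\<^sub>L A \<in> schatten 1 V V" and AB: "A o\<^sub>L B \<in> schatten 1 W W"
  shows "op_trace V (B o\<^sub>L A) = op_trace W (A o\<^sub>L B)"
proof -
  have clA: "clinear_op A"
    by (rule operators_clinear[OF A(1)])
  obtain E where E: "singular_system A E"
    using singular_system_exists[OF clA A(2)] by blast
  have onE: "orthonormal E" and pos: "\<And>e. e \<in> E \<Longrightarrow> A e \<noteq> 0"
    and eig: "\<And>e. e \<in> E \<Longrightarrow> (hadjoint A o\<^sub>L A) e = (norm (A e))\<^sup>2 *\<^sub>R e"
    using E by (auto simp: singular_system_def)
  have EV: "E \<subseteq> space_of V"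
  proof
    fix e assume e: "e \<in> E"
    \<comment> \<open>\<open>A\<close> kills the part \<open>y\<close> of \<open>e\<close>
      orthogonal to \<open>V\<close>. As the Gram operator multiplies \<open>e\<close> by a nonzero
      scalar, \<open>y\<close> is orthogonal to \<open>e\<close>, hence to itself.\<close>
    define y where "y = e - ident_op V e"
    have "A y = 0"
      using operators_ident_right[OF V A(1)] unfolding y_def
      by (metis blinfun.diff_right blinfun_apply_blinfun_compose diff_self)
    then have "cinner ((hadjoint A o\<^sub>L A) e) y = 0"
      using cinner_gram(2)[OF clA, of e y] by simp
    then have "cinner e y = 0"
      using pos[OF e] by (simp add: eig[OF e] cinner_scaleR_left del: blinfun_apply_blinfun_compose)
    moreover have "cinner (ident_op V e) y = 0"
      unfolding y_def using ident_op_apply[OF V] by blast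
    ultimately have "cinner y y = 0"
      by (subst (1) y_def) (simp add: cinner_diff_left)
    then show "e \<in> space_of V"
      using ident_op_apply(1)[OF V, of e] by (simp add: cinner_self y_def)
  qed
  obtain BV where BV: "E \<subseteq> BV" "orthonormal_basis_of (space_of V) BV"
    using orthonormal_basis_extension[OF space_of_subspace[OF V] onE EV] by blast
  define h where "h e = (1 / norm (A e)) *\<^sub>R A e" for e
  have h_cinner: "cinner (h e) (h e') = (if e = e' then 1 else 0)" if "e \<in> E" "e' \<in> E" for e e'
    using that pos[of e] singular_system_cinner[OF E that]
    by (auto simp: h_def cinner_scaleR_left cinner_scaleR_right power2_eq_square)
  have inj: "inj_on h E"
    using h_cinner by (intro inj_onI) (metis zero_neq_one)
  have onH: "orthonormal (h ` E)"
    unfolding orthonormal_def using h_cinner inj by (auto simp: inj_on_eq_iff)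
  have HW: "h ` E \<subseteq> space_of W"
    using operators_range[OF V A(1)] space_of_subspace(1)[OF W]
    by (auto simp: h_def intro: complex_subspace_scaleR)
  obtain BW where BW: "h ` E \<subseteq> BW" "orthonormal_basis_of (space_of W) BW"
    using orthonormal_basis_extension[OF space_of_subspace[OF W] onH HW] by blast
  have "((\<lambda>b. cinner b ((B o\<^sub>L A) b)) has_sum op_trace V (B o\<^sub>L A)) BV"
    by (rule op_trace_has_sum[OF V BA BV(2)])
  moreover have "cinner b ((B o\<^sub>L A) b) = 0" if "b \<in> BV - E" for b
  proof -
    have "\<forall>e\<in>E. cinner e b = 0"
      using that BV unfolding orthonormal_basis_of_def by (metis Diff_iff subsetD)
    then have "A b = 0"
      using E unfolding singular_system_def by blast
    then show ?thesis
      by simp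
  qed
  ultimately have 1: "((\<lambda>e. cinner e ((B o\<^sub>L A) e)) has_sum op_trace V (B o\<^sub>L A)) E"
    by (rule has_sum_restrict_support[OF _ _ BV(1)])
  have "((\<lambda>b. cinner b ((A o\<^sub>L B) b)) has_sum op_trace W (A o\<^sub>L B)) BW"
    by (rule op_trace_has_sum[OF W AB BW(2)])
  \<comment> \<open>By the singular expansion the range of \<open>A\<close> lies in the closed span
    of the vectors \<open>h e\<close>, to all of which \<open>b\<close> is orthogonal.\<close>
  moreover have "cinner b ((A o\<^sub>L B) b) = 0" if b: "b \<in> BW - h ` E" for b
  proof -
    have "cinner b (A e) = 0" if "e \<in> E" for e
    proof -
      have "cinner b (h e) = 0"
        using that b BW unfolding orthonormal_basis_of_def by (metis DiffD1 DiffD2 imageI subsetD)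
      then show ?thesis
        using pos[OF that] by (simp add: h_def cinner_scaleR_right)
    qed
    moreover have "((\<lambda>e. cinner b (cinner e (B b) *\<^sub>C A e)) has_sum cinner b (A (B b))) E"
      by (rule has_sum_bounded_linear[OF bounded_linear_cinner_right singular_expansion[OF E]])
    ultimately have "((\<lambda>e. 0) has_sum cinner b (A (B b))) E"
      by (subst (asm) has_sum_cong[where g = "\<lambda>e. 0"]) (auto simp: cinner_scaleC_right)
    then show ?thesis
      using has_sum_unique[OF _ has_sum_0] by force
  qed
  ultimately have "((\<lambda>b. cinner b ((A o\<^sub>L B) b)) has_sum op_trace W (A o\<^sub>L B)) (h ` E)"
    by (rule has_sum_restrict_support[OF _ _ BW(1)])
  then have "((\<lambda>e. cinner (h e) ((A o\<^sub>L B) (h e))) has_sum op_trace W (A o\<^sub>L B)) E"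
    by (simp add: has_sum_reindex[OF inj] o_def)
  moreover have "cinner (h e) ((A o\<^sub>L B) (h e)) = cinner e ((B o\<^sub>L A) e)" if e: "e \<in> E" for e
  proof -
    let ?s = "norm (A e)"
    have "cinner (h e) ((A o\<^sub>L B) (h e)) = of_real (1 / ?s\<^sup>2) * cinner (A e) (A (B (A e)))"
      by (simp add: h_def blinfun.scaleR_right cinner_scaleR_left cinner_scaleR_right power2_eq_square)
    also have "cinner (A e) (A (B (A e))) = cinner ((hadjoint A o\<^sub>L A) e) (B (A e))"
      by (rule cinner_gram(2)[OF clA, symmetric])
    also have "\<dots> = of_real (?s\<^sup>2) * cinner e (B (A e))"
      by (simp add: eig[OF e] cinner_scaleR_left del: blinfun_apply_blinfun_compose)
    finally show ?thesis
      using pos[OF e] by simp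
  qed
  ultimately have "((\<lambda>e. cinner e ((B o\<^sub>L A) e)) has_sum op_trace W (A o\<^sub>L B)) E"
    by (subst (asm) has_sum_cong) auto
  with 1 show ?thesis
    by (rule has_sum_unique)
qed

section \<open>The DG-semicategory of a Fredholm module\<close>

lemma blinfun_compose_assoc: "(S o\<^sub>L T) o\<^sub>L U = S o\<^sub>L (T o\<^sub>L U)"
  by (rule blinfun_eqI) simp

lemma blinfun_compose_scaleC_left: "(c *\<^sub>C S) o\<^sub>L T = c *\<^sub>C (S o\<^sub>L T)"
  by (rule blinfun_eqI) (simp add: blinfun_apply_scaleC)

lemma blinfun_compose_scaleC_right: "clinear_op S \<Longrightarrow> S o\<^sub>L (c *\<^sub>C T) = c *\<^sub>C (S o\<^sub>L T)"
  by (rule blinfun_eqI) (simp add: blinfun_apply_scaleC clinear_op_def)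

lemmas blinfun_compose_simps =
  bounded_bilinear.add_left[OF bounded_bilinear_blinfun_compose]
  bounded_bilinear.add_right[OF bounded_bilinear_blinfun_compose]
  bounded_bilinear.diff_left[OF bounded_bilinear_blinfun_compose]
  bounded_bilinear.diff_right[OF bounded_bilinear_blinfun_compose]
  bounded_bilinear.minus_left[OF bounded_bilinear_blinfun_compose]
  bounded_bilinear.minus_right[OF bounded_bilinear_blinfun_compose]
  bounded_bilinear.scaleR_left[OF bounded_bilinear_blinfun_compose]
  bounded_bilinear.scaleR_right[OF bounded_bilinear_blinfun_compose]
  blinfun_compose_assoc

text \<open>Composition respects complex scalars in its right factor only when the left factor is
  complex linear, hence the hypothesis on \<open>A\<close>.\<close>

lemma span_compose_mem:
  assumes cl: "\<And>a. a \<in> A \<Longrightarrow> clinear_op a" and S: "complex_vector.subspace S"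
    and AB: "\<And>a b. a \<in> A \<Longrightarrow> b \<in> B \<Longrightarrow> a o\<^sub>L b \<in> S"
    and a: "a \<in> complex_vector.span A" and b: "b \<in> complex_vector.span B"
  shows "a o\<^sub>L b \<in> S"
  using a
proof (induction rule: complex_vector.span_induct_alt)
  case base
  show ?case using complex_vector.subspace_0[OF S] by simp
next
  case (step c x y)
  have "x o\<^sub>L b \<in> S"
    using b
  proof (induction rule: complex_vector.span_induct_alt)
    case base
    show ?case using complex_vector.subspace_0[OF S] by simp
  next
    case (step c' b b')
    then show ?case
      using cl[OF \<open>x \<in> A\<close>] AB[OF \<open>x \<in> A\<close>] S
      by (simp add: blinfun_compose_simps blinfun_compose_scaleC_right
          complex_vector.subspace_add complex_vector.subspace_scale)
  qed
  then show ?case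
    using step S by (simp add: blinfun_compose_simps blinfun_compose_scaleC_left
          complex_vector.subspace_add complex_vector.subspace_scale)
qed

lemma clinear_on_add: "clinear_on S f \<Longrightarrow> x \<in> S \<Longrightarrow> y \<in> S \<Longrightarrow> f (x + y) = f x + f y"
  by (simp add: clinear_on_def)

lemma clinear_on_scale: "clinear_on S f \<Longrightarrow> x \<in> S \<Longrightarrow> f (c *\<^sub>C x) = c *\<^sub>C f x"
  by (simp add: clinear_on_def)

lemma clinear_on_subset: "clinear_on S f \<Longrightarrow> R \<subseteq> S \<Longrightarrow> clinear_on R f"
  unfolding clinear_on_def by blast

lemma comm_word_cong:
  assumes "\<And>k. 1 \<le> k \<Longrightarrow> k \<le> Suc j \<Longrightarrow> X k = X' k" "\<And>k. 1 \<le> k \<Longrightarrow> k \<le> j \<Longrightarrow> f k = f' k"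
  shows "comm_word M X f A j = comm_word M X' f' A j"
  using assms by (induction j) auto

lemma comm_word_left: "comm_word M X f (B o\<^sub>L A) j = B o\<^sub>L comm_word M X f A j"
  by (induction j) (simp_all add: blinfun_compose_assoc)

lemma comm_word_add: "comm_word M X f (A + B) j = comm_word M X f A j + comm_word M X f B j"
  by (induction j) (simp_all add: blinfun_compose_simps)

lemma comm_word_scaleC: "comm_word M X f (c *\<^sub>C A) j = c *\<^sub>C comm_word M X f A j"
  by (induction j) (simp_all add: blinfun_compose_scaleC_left)

lemma comm_word_split:
  "comm_word M X f A (i + j) =
     comm_word M (\<lambda>k. X (k + i)) (\<lambda>k. f (k + i)) (comm_word M X f A i) j"
  by (induction j) (simp_all add: add.commute[of i])

section \<open>A fixed Fredholm module and its differential\<close>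

locale fredholm_module =
  fixes C :: "('o, 'a::complex_vector) category"
    and M :: "('o, 'a, 'h::complex_hilbert_space) fredholm_data"
    and p :: real
  assumes C: "linear_category C" and p: "1 \<le> p" and M: "even_fredholm_module p C M"
begin

abbreviation H where "H \<equiv> Hmap M"
abbreviation F where "F \<equiv> Fop M"
abbreviation V where "V \<equiv> Hsp M"
abbreviation I where "I X \<equiv> ident_op (Hsp M X)"
abbreviation \<epsilon> where "\<epsilon> X \<equiv> grading_op (Hsp M X)"
abbreviation d where "d \<equiv> commutator M"
abbreviation \<delta> where "\<delta> \<equiv> Omega_diff M"

lemma Hom_subspace: "X \<in> Obj C \<Longrightarrow> Y \<in> Obj C \<Longrightarrow> complex_vector.subspace (Hom C X Y)"
  using C by (simp add: linear_category_def)

lemma Comp_in_Hom: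
  "X \<in> Obj C \<Longrightarrow> Y \<in> Obj C \<Longrightarrow> Z \<in> Obj C \<Longrightarrow> f \<in> Hom C X Y \<Longrightarrow> g \<in> Hom C Y Z \<Longrightarrow>
     Comp C g f \<in> Hom C X Z"
  using C by (simp add: linear_category_def)

lemma graded: "X \<in> Obj C \<Longrightarrow> graded_hilbert (V X)"
  using M by (simp add: even_fredholm_module_def graded_hilbert_functor_def)

lemma H_linear: "X \<in> Obj C \<Longrightarrow> Y \<in> Obj C \<Longrightarrow> clinear_on (Hom C X Y) (H X Y)"
  using M by (simp add: even_fredholm_module_def graded_hilbert_functor_def)

lemma H_operators:
  assumes "X \<in> Obj C" "Y \<in> Obj C" "f \<in> Hom C X Y"
  shows "H X Y f \<in> operators (V X) (V Y)" "degree0_op (V X) (V Y) (H X Y f)"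
  using M assms by (simp_all add: even_fredholm_module_def graded_hilbert_functor_def)

lemma H_Comp:
  assumes "X \<in> Obj C" "Y \<in> Obj C" "Z \<in> Obj C" "f \<in> Hom C X Y" "g \<in> Hom C Y Z"
  shows "H X Z (Comp C g f) = H Y Z g o\<^sub>L H X Y f"
  using M assms unfolding even_fredholm_module_def graded_hilbert_functor_def by blast

lemma H_zero: "X \<in> Obj C \<Longrightarrow> Y \<in> Obj C \<Longrightarrow> H X Y 0 = 0"
  using clinear_on_scale[OF H_linear, of X Y 0 0] complex_vector.subspace_0[OF Hom_subspace]
  by simp

lemma F_operators:
  assumes "X \<in> Obj C"
  shows "F X \<in> operators (V X) (V X)" "degree1_op (V X) (V X) (F X)" "F X o\<^sub>L F X = I X"
  using M assms by (simp_all add: even_fredholm_module_def)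

lemma d_schatten: "X \<in> Obj C \<Longrightarrow> Y \<in> Obj C \<Longrightarrow> f \<in> Hom C X Y \<Longrightarrow> d X Y f \<in> schatten p (V X) (V Y)"
  using M by (simp add: even_fredholm_module_def)

lemma d_operators: "X \<in> Obj C \<Longrightarrow> Y \<in> Obj C \<Longrightarrow> f \<in> Hom C X Y \<Longrightarrow> d X Y f \<in> operators (V X) (V Y)"
  using d_schatten by (simp add: schatten_def)

lemma I_left: "X \<in> Obj C \<Longrightarrow> Y \<in> Obj C \<Longrightarrow> T \<in> operators (V X) (V Y) \<Longrightarrow> I Y o\<^sub>L T = T"
  by (rule operators_ident_left) (auto intro: graded)

lemma I_right: "X \<in> Obj C \<Longrightarrow> Y \<in> Obj C \<Longrightarrow> T \<in> operators (V X) (V Y) \<Longrightarrow> T o\<^sub>L I X = T"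
  by (rule operators_ident_right) (auto intro: graded)

lemma d_linear: "X \<in> Obj C \<Longrightarrow> Y \<in> Obj C \<Longrightarrow> clinear_on (Hom C X Y) (d X Y)"
  using H_linear[of X Y] operators_clinear[OF F_operators(1)[of Y]]
  by (auto simp: clinear_on_def commutator_def blinfun_compose_simps blinfun_compose_scaleC_left
      blinfun_compose_scaleC_right complex_vector.scale_right_diff_distrib)

lemma d_Comp:
  assumes "X \<in> Obj C" "Y \<in> Obj C" "Z \<in> Obj C" "f \<in> Hom C X Y" "g \<in> Hom C Y Z"
  shows "d X Z (Comp C g f) = (d Y Z g o\<^sub>L H X Y f) + (H Y Z g o\<^sub>L d X Y f)"
  by (simp add: commutator_def H_Comp[OF assms] blinfun_compose_simps)

lemma diff_leibniz:
  "\<delta> (i + j) X Z (S o\<^sub>L T) = (\<delta> i Y Z S o\<^sub>L T) + (- 1) ^ i *\<^sub>R (S o\<^sub>L \<delta> j X Y T)"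
  by (simp add: Omega_diff_def blinfun_compose_simps power_add algebra_simps)

text \<open>The two mixed terms \<open>F T F\<close> have opposite signs; what remains is
  \<open>F F T - T F F\<close>, which vanishes because \<open>F\<close> squares to the
  identity.\<close>

lemma diff_diff:
  assumes "X \<in> Obj C" "Y \<in> Obj C" "T \<in> operators (V X) (V Y)"
  shows "\<delta> (Suc j) X Y (\<delta> j X Y T) = 0"
proof -
  have "\<delta> (Suc j) X Y (\<delta> j X Y T) = ((F Y o\<^sub>L F Y) o\<^sub>L T) - (T o\<^sub>L (F X o\<^sub>L F X))"
    by (simp add: Omega_diff_def blinfun_compose_simps scaleR_diff_right flip: power_add mult_2)
  then show ?thesis
    by (simp add: F_operators assms I_left[OF assms] I_right[OF assms])
qed

lemma d_eq_diff: "d X Y f = \<delta> 0 X Y (H X Y f)"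
  by (simp add: commutator_def Omega_diff_def)

lemma diff_d: "X \<in> Obj C \<Longrightarrow> Y \<in> Obj C \<Longrightarrow> f \<in> Hom C X Y \<Longrightarrow> \<delta> (Suc 0) X Y (d X Y f) = 0"
  unfolding d_eq_diff by (rule diff_diff) (auto intro: H_operators)

lemma diff_linear:
  assumes "Y \<in> Obj C"
  shows "\<delta> j X Y (S + T) = \<delta> j X Y S + \<delta> j X Y T" "\<delta> j X Y (c *\<^sub>C T) = c *\<^sub>C \<delta> j X Y T"
  using operators_clinear[OF F_operators(1)[OF assms]]
  by (simp_all add: Omega_diff_def blinfun_compose_simps blinfun_compose_scaleC_left
      blinfun_compose_scaleC_right scaleC_add_right complex_vector.scale_right_diff_distrib
      scaleR_scaleC scaleC_scaleC mult.commute)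

text \<open>Unlike \<open>Omega_hom\<close>, the spaces \<open>words\<close> admit the unit also in degree 0, so that every word
  of positive length is a shorter one times a commutator.\<close>

inductive word :: "nat \<Rightarrow> 'o \<Rightarrow> 'o \<Rightarrow> ('h \<Rightarrow>\<^sub>L 'h) \<Rightarrow> bool" where
  unit: "X \<in> Obj C \<Longrightarrow> Y \<in> Obj C \<Longrightarrow> f \<in> Hom C X Y \<Longrightarrow> (X \<noteq> Y \<longrightarrow> \<mu> = 0) \<Longrightarrow>
    word 0 X Y (H X Y f + \<mu> *\<^sub>C I Y)"
| step: "word j Z Y w \<Longrightarrow> X \<in> Obj C \<Longrightarrow> f \<in> Hom C X Z \<Longrightarrow>
    word (Suc j) X Y (w o\<^sub>L d X Z f)"

definition words :: "nat \<Rightarrow> 'o \<Rightarrow> 'o \<Rightarrow> ('h \<Rightarrow>\<^sub>L 'h) set" where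
  "words j X Y = Collect (word j X Y)"

lemma words_unit:
  "X \<in> Obj C \<Longrightarrow> Y \<in> Obj C \<Longrightarrow> f \<in> Hom C X Y \<Longrightarrow> (X \<noteq> Y \<longrightarrow> \<mu> = 0) \<Longrightarrow>
    H X Y f + \<mu> *\<^sub>C I Y \<in> words 0 X Y"
  by (simp add: words_def word.unit)

lemma words_step:
  "w \<in> words j Z Y \<Longrightarrow> X \<in> Obj C \<Longrightarrow> f \<in> Hom C X Z \<Longrightarrow> w o\<^sub>L d X Z f \<in> words (Suc j) X Y"
  by (simp add: words_def word.step)

lemma words_induct [consumes 1, case_names unit step]:
  assumes "w \<in> words j X Y"
    and "\<And>X Y f \<mu>. X \<in> Obj C \<Longrightarrow> Y \<in> Obj C \<Longrightarrow> f \<in> Hom C X Y \<Longrightarrow> (X \<noteq> Y \<longrightarrow> \<mu> = 0) \<Longrightarrow>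
      P 0 X Y (H X Y f + \<mu> *\<^sub>C I Y)"
    and "\<And>w j Z Y X f. w \<in> words j Z Y \<Longrightarrow> P j Z Y w \<Longrightarrow> X \<in> Obj C \<Longrightarrow> f \<in> Hom C X Z \<Longrightarrow>
      P (Suc j) X Y (w o\<^sub>L d X Z f)"
  shows "P j X Y w"
  using assms unfolding words_def mem_Collect_eq by (rule word.induct)

lemma words_0E:
  assumes "A \<in> words 0 X Y"
  obtains (unit) f \<mu> where "A = H X Y f + \<mu> *\<^sub>C I Y" "X \<in> Obj C" "Y \<in> Obj C" "f \<in> Hom C X Y"
    "X \<noteq> Y \<longrightarrow> \<mu> = 0"
  using assms unfolding words_def mem_Collect_eq by (cases rule: word.cases) auto

lemma words_Obj: "w \<in> words j X Y \<Longrightarrow> X \<in> Obj C \<and> Y \<in> Obj C"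
  by (induction rule: words_induct) auto

definition unital_hom :: "nat \<Rightarrow> 'o \<Rightarrow> 'o \<Rightarrow> ('h \<Rightarrow>\<^sub>L 'h) set" where
  "unital_hom j X Y = complex_vector.span (words j X Y)"

lemma unital_hom_subspace: "complex_vector.subspace (unital_hom j X Y)"
  by (simp add: unital_hom_def)

lemma words_unital_hom: "w \<in> words j X Y \<Longrightarrow> w \<in> unital_hom j X Y"
  by (simp add: unital_hom_def complex_vector.span_base)

lemma H_words: "X \<in> Obj C \<Longrightarrow> Y \<in> Obj C \<Longrightarrow> f \<in> Hom C X Y \<Longrightarrow> H X Y f \<in> words 0 X Y"
  using words_unit[of X Y f 0] by simp

lemma I_words: "X \<in> Obj C \<Longrightarrow> I X \<in> words 0 X X"
  using words_unit[of X X 0 1] complex_vector.subspace_0[OF Hom_subspace, of X X]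
  by (simp add: H_zero scaleC_one)

text \<open>A lone commutator is a word because the unit may stand in front of it.\<close>

lemma d_words: "X \<in> Obj C \<Longrightarrow> Y \<in> Obj C \<Longrightarrow> f \<in> Hom C X Y \<Longrightarrow> d X Y f \<in> words (Suc 0) X Y"
  using words_step[OF I_words, of Y X f] by (simp add: I_left d_operators)

lemma words_eq_comm_word:
  assumes "w \<in> words j X Y"
  shows "\<exists>Xs fs \<mu>. w = comm_word M Xs fs (H (Xs 1) (Xs 0) (fs 0) + \<mu> *\<^sub>C I Y) j \<and>
     Xs 0 = Y \<and> Xs (Suc j) = X \<and> (\<forall>i\<le>Suc j. Xs i \<in> Obj C) \<and>
     (\<forall>i\<le>j. fs i \<in> Hom C (Xs (Suc i)) (Xs i)) \<and> (Xs 1 \<noteq> Y \<longrightarrow> \<mu> = 0)"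
  using assms
proof (induction rule: words_induct)
  case (unit X Y f \<mu>)
  then show ?case
    by (intro exI[of _ "\<lambda>i. if i = 0 then Y else X"] exI[of _ "\<lambda>_. f"] exI[of _ \<mu>]) auto
next
  case (step w j Z Y X f)
  then obtain Xs fs \<mu> where *: "w = comm_word M Xs fs (H (Xs 1) (Xs 0) (fs 0) + \<mu> *\<^sub>C I Y) j"
     "Xs 0 = Y" "Xs (Suc j) = Z" "\<forall>i\<le>Suc j. Xs i \<in> Obj C"
     "\<forall>i\<le>j. fs i \<in> Hom C (Xs (Suc i)) (Xs i)" "Xs 1 \<noteq> Y \<longrightarrow> \<mu> = 0"
    by blast
  let ?Xs = "Xs(Suc (Suc j) := X)" and ?fs = "fs(Suc j := f)"
  have "w = comm_word M ?Xs ?fs (H (Xs 1) (Xs 0) (fs 0) + \<mu> *\<^sub>C I Y) j"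
    unfolding *(1) by (rule comm_word_cong) auto
  then have "w o\<^sub>L d X Z f = comm_word M ?Xs ?fs (H (?Xs 1) (?Xs 0) (?fs 0) + \<mu> *\<^sub>C I Y) (Suc j)"
    using *(3) by simp
  moreover have "?Xs 0 = Y \<and> ?Xs (Suc (Suc j)) = X \<and> (\<forall>i\<le>Suc (Suc j). ?Xs i \<in> Obj C) \<and>
      (\<forall>i\<le>Suc j. ?fs i \<in> Hom C (?Xs (Suc i)) (?Xs i)) \<and> (?Xs 1 \<noteq> Y \<longrightarrow> \<mu> = 0)"
    using *(2-6) step.hyps by (auto simp: le_Suc_eq)
  ultimately show ?case by blast
qed

lemma comm_word_words:
  assumes "A \<in> words i (Xs 1) Y" "\<And>k. 1 \<le> k \<Longrightarrow> k \<le> Suc j \<Longrightarrow> Xs k \<in> Obj C"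
    "\<And>k. 1 \<le> k \<Longrightarrow> k \<le> j \<Longrightarrow> fs k \<in> Hom C (Xs (Suc k)) (Xs k)"
  shows "comm_word M Xs fs A j \<in> words (i + j) (Xs (Suc j)) Y"
  using assms
proof (induction j)
  case (Suc j)
  then show ?case
    by (auto intro!: words_step)
qed simp

text \<open>Matches the recursive form, suited to induction, with the explicit generators of
  \<open>Omega_hom\<close>.\<close>

lemma words_eq:
  "words j X Y = {comm_word M Xs fs (H (Xs 1) (Xs 0) (fs 0) + \<mu> *\<^sub>C I Y) j | Xs fs \<mu>.
     Xs 0 = Y \<and> Xs (Suc j) = X \<and> (\<forall>i\<le>Suc j. Xs i \<in> Obj C) \<and>
     (\<forall>i\<le>j. fs i \<in> Hom C (Xs (Suc i)) (Xs i)) \<and> (Xs 1 \<noteq> Y \<longrightarrow> \<mu> = 0)}" (is "_ = ?R")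
proof (intro set_eqI iffI)
  fix w assume "w \<in> ?R"
  then obtain Xs fs \<mu> where *: "w = comm_word M Xs fs (H (Xs 1) (Xs 0) (fs 0) + \<mu> *\<^sub>C I Y) j"
     "Xs 0 = Y" "Xs (Suc j) = X" "\<forall>i\<le>Suc j. Xs i \<in> Obj C"
     "\<forall>i\<le>j. fs i \<in> Hom C (Xs (Suc i)) (Xs i)" "Xs 1 \<noteq> Y \<longrightarrow> \<mu> = 0"
    by blast
  have "H (Xs 1) (Xs 0) (fs 0) + \<mu> *\<^sub>C I Y \<in> words 0 (Xs 1) Y"
    using * words_unit[of "Xs 1" Y "fs 0" \<mu>] by auto
  then show "w \<in> words j X Y"
    using comm_word_words[of _ 0 Xs Y j fs] * by auto
qed (use words_eq_comm_word in blast)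

lemma Omega_hom_Suc: "Omega_hom C M (Suc j) X Y = unital_hom (Suc j) X Y"
  unfolding Omega_hom_def unital_hom_def words_eq by simp

lemma H_in_Omega_hom_0:
  assumes "X \<in> Obj C" "Y \<in> Obj C" "f \<in> Hom C X Y"
  shows "H X Y f \<in> Omega_hom C M 0 X Y"
  unfolding Omega_hom_def
  by (rule complex_vector.span_base)
     (use assms in \<open>auto intro!: exI[of _ "\<lambda>i. if i = 0 then Y else X"] exI[of _ "\<lambda>_. f"] exI[of _ 0]\<close>)

text \<open>In degree 0 the generators form the linear image of a subspace, so the span adds nothing
  to them.\<close>

lemma Omega_hom_0E:
  assumes XY: "X \<in> Obj C" "Y \<in> Obj C" and T: "T \<in> Omega_hom C M 0 X Y"
  obtains f where "f \<in> Hom C X Y" "T = H X Y f"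
proof -
  have "complex_vector.subspace (H X Y ` Hom C X Y)"
  proof (rule complex_vector.subspaceI)
    show "0 \<in> H X Y ` Hom C X Y"
      using H_zero[OF XY] complex_vector.subspace_0[OF Hom_subspace[OF XY]] by (metis imageI)
    show "x + y \<in> H X Y ` Hom C X Y" if "x \<in> H X Y ` Hom C X Y" "y \<in> H X Y ` Hom C X Y" for x y
      using that clinear_on_add[OF H_linear[OF XY]] complex_vector.subspace_add[OF Hom_subspace[OF XY]]
      by (elim imageE) (metis imageI)
    show "c *\<^sub>C x \<in> H X Y ` Hom C X Y" if "x \<in> H X Y ` Hom C X Y" for c x
      using that clinear_on_scale[OF H_linear[OF XY]] complex_vector.subspace_scale[OF Hom_subspace[OF XY]]
      by (elim imageE) (metis imageI)
  qed
  then have "Omega_hom C M 0 X Y \<subseteq> H X Y ` Hom C X Y"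
    unfolding Omega_hom_def by (intro complex_vector.span_minimal) auto
  then show ?thesis
    using T that by blast
qed

lemma Omega_hom_unital:
  assumes "X \<in> Obj C" "Y \<in> Obj C" "T \<in> Omega_hom C M j X Y"
  shows "T \<in> unital_hom j X Y"
proof (cases j)
  case 0
  then show ?thesis
    using assms Omega_hom_0E[of X Y T] words_unital_hom H_words by metis
qed (use assms Omega_hom_Suc in auto)

lemma words_operators: "w \<in> words j X Y \<Longrightarrow> w \<in> operators (V X) (V Y)"
proof (induction rule: words_induct)
  case (unit X Y f \<mu>)
  have "\<mu> *\<^sub>C I Y \<in> operators (V X) (V Y)"
  proof (cases "X = Y")
    case True
    then show ?thesis
      using unit ident_op_operators[OF graded, of Y]
        complex_vector.subspace_scale[OF operators_subspace[OF graded]] by blast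
  next
    case False
    then show ?thesis
      using unit complex_vector.subspace_0[OF operators_subspace[OF graded]] by simp
  qed
  then show ?case
    using unit H_operators complex_vector.subspace_add[OF operators_subspace[OF graded]] by blast
next
  case (step w j Z Y X f)
  then show ?case
    using words_Obj d_operators operators_compose by blast
qed

lemma unital_hom_operators:
  assumes "Y \<in> Obj C" "T \<in> unital_hom j X Y"
  shows "T \<in> operators (V X) (V Y)"
  using assms complex_vector.span_minimal[OF _ operators_subspace[OF graded]] words_operators
  unfolding unital_hom_def by blast

lemma schatten_power_subspace: "complex_vector.subspace (schatten_power p k)"
  by (intro complex_vector.subspaceI schatten_power_zero schatten_power_add schatten_power_scaleC)

text \<open>Each commutator contributes one factor of class \<open>p\<close>, while the head is
  merely bounded and counts as exponent 0.\<close>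

lemma unital_hom_schatten_power: "T \<in> unital_hom j X Y \<Longrightarrow> T \<in> schatten_power p j"
proof -
  have "w \<in> schatten_power p j" if "w \<in> words j X Y" for w
    using that
  proof (induction rule: words_induct)
    case (unit X Y f \<mu>)
    then show ?case
      by (intro schatten_power_bounded operators_clinear[OF words_operators[OF words_unit]])
  next
    case (step w j Z Y X f)
    then show ?case
      using schatten_power_compose[of w p j "d X Z f" 1]
        schatten_imp_schatten_power[OF d_schatten] p words_Obj by simp
  qed
  then show "T \<in> unital_hom j X Y \<Longrightarrow> T \<in> schatten_power p j"
    using complex_vector.span_minimal[OF _ schatten_power_subspace] unfolding unital_hom_def by blast
qed

section \<open>Signs under the grading operator\<close>

lemma grading_H:
  assumes "X \<in> Obj C" "Y \<in> Obj C" "f \<in> Hom C X Y"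
  shows "\<epsilon> Y o\<^sub>L H X Y f = H X Y f o\<^sub>L \<epsilon> X"
  using assms by (intro grading_op_degree0 graded H_operators)

lemma grading_F: "X \<in> Obj C \<Longrightarrow> \<epsilon> X o\<^sub>L F X = - (F X o\<^sub>L \<epsilon> X)"
  by (intro grading_op_degree1 graded F_operators)

lemma grading_d:
  assumes "X \<in> Obj C" "Y \<in> Obj C" "f \<in> Hom C X Y"
  shows "\<epsilon> Y o\<^sub>L d X Y f = - (d X Y f o\<^sub>L \<epsilon> X)"
proof -
  have "\<epsilon> Y o\<^sub>L d X Y f = ((\<epsilon> Y o\<^sub>L F Y) o\<^sub>L H X Y f) - ((\<epsilon> Y o\<^sub>L H X Y f) o\<^sub>L F X)"
    by (simp add: commutator_def blinfun_compose_simps)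
  also have "\<dots> = - (F Y o\<^sub>L (\<epsilon> Y o\<^sub>L H X Y f)) - (H X Y f o\<^sub>L (\<epsilon> X o\<^sub>L F X))"
    using assms by (simp add: grading_F grading_H[OF assms] blinfun_compose_simps)
  also have "\<dots> = - (d X Y f o\<^sub>L \<epsilon> X)"
    using assms by (simp add: grading_F grading_H[OF assms] commutator_def blinfun_compose_simps)
  finally show ?thesis .
qed

lemma grading_I: "X \<in> Obj C \<Longrightarrow> \<epsilon> X o\<^sub>L I X = I X o\<^sub>L \<epsilon> X"
  using I_left[of X X "\<epsilon> X"] I_right[of X X "\<epsilon> X"] grading_op_operators[OF graded] by simp

lemma grading_clinear: "X \<in> Obj C \<Longrightarrow> clinear_op (\<epsilon> X)"
  using operators_clinear grading_op_operators[OF graded] by blast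

text \<open>The grading commutes with the head of a word and anticommutes with each commutator, so
  the sign counts the degree.\<close>

lemma grading_unital_hom:
  assumes Y: "Y \<in> Obj C" and T: "T \<in> unital_hom j X Y"
  shows "\<epsilon> Y o\<^sub>L T = (- 1) ^ j *\<^sub>R (T o\<^sub>L \<epsilon> X)"
proof -
  have word: "\<epsilon> Y o\<^sub>L w = (- 1) ^ j *\<^sub>R (w o\<^sub>L \<epsilon> X)" if "w \<in> words j X Y" for w
    using that
  proof (induction rule: words_induct)
    case (unit X Y f \<mu>)
    then show ?case
      by (cases "X = Y") (auto simp: blinfun_compose_simps grading_H blinfun_compose_scaleC_left
          blinfun_compose_scaleC_right[OF grading_clinear] grading_I)
  next
    case (step w j Z Y X f)
    have "\<epsilon> Y o\<^sub>L (w o\<^sub>L d X Z f) = (\<epsilon> Y o\<^sub>L w) o\<^sub>L d X Z f"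
      by (simp add: blinfun_compose_assoc)
    also have "\<dots> = (- 1) ^ j *\<^sub>R (w o\<^sub>L (\<epsilon> Z o\<^sub>L d X Z f))"
      by (simp add: step.IH blinfun_compose_simps)
    also have "\<dots> = (- 1) ^ Suc j *\<^sub>R ((w o\<^sub>L d X Z f) o\<^sub>L \<epsilon> X)"
      using step words_Obj[OF step.hyps(1)] by (simp add: grading_d blinfun_compose_simps)
    finally show ?case .
  qed
  have "complex_vector.subspace {T. \<epsilon> Y o\<^sub>L T = (- 1) ^ j *\<^sub>R (T o\<^sub>L \<epsilon> X)}"
    by (rule complex_vector.subspaceI)
       (simp_all add: blinfun_compose_simps scaleC_add_right blinfun_compose_scaleC_left
         blinfun_compose_scaleC_right[OF grading_clinear[OF Y]] scaleR_scaleC scaleC_scaleC mult.commute)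
  then have "unital_hom j X Y \<subseteq> {T. \<epsilon> Y o\<^sub>L T = (- 1) ^ j *\<^sub>R (T o\<^sub>L \<epsilon> X)}"
    unfolding unital_hom_def using word by (intro complex_vector.span_minimal) auto
  then show ?thesis
    using T by blast
qed

section \<open>Closure under composition and under the differential\<close>

lemma words_clinear: "w \<in> words j X Y \<Longrightarrow> clinear_op w"
  using words_operators operators_clinear by blast

lemma unital_hom_compose_d:
  assumes "T \<in> unital_hom j Z Y" "X \<in> Obj C" "f \<in> Hom C X Z"
  shows "T o\<^sub>L d X Z f \<in> unital_hom (Suc j) X Y"
  by (rule span_compose_mem[where A = "words j Z Y" and B = "{d X Z f}"])
     (use assms unital_hom_subspace in
       \<open>auto simp: unital_hom_def intro: complex_vector.span_base words_step words_clinear\<close>)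

text \<open>For two heads, the product expands into four terms. A unit term has coefficient 0 unless
  its endpoints coincide, and then it is a scaled generator. A longer word only adds commutators on
  the right.\<close>

lemma words_compose_0:
  assumes "w \<in> words j X Y" "A \<in> words 0 Y Z"
  shows "A o\<^sub>L w \<in> unital_hom j X Z"
  using assms
proof (induction rule: words_induct)
  case (unit X Y f \<mu>)
  from unit.prems show ?case
  proof (cases rule: words_0E)
    case (unit g \<nu>)
    have f: "f \<in> Hom C X Y" "X \<in> Obj C" "Y \<in> Obj C" "Z \<in> Obj C" "g \<in> Hom C Y Z"
      using \<open>f \<in> Hom C X Y\<close> \<open>X \<in> Obj C\<close> unit by auto
    have "A o\<^sub>L (H X Y f + \<mu> *\<^sub>C I Y) = H X Z (Comp C g f) + \<nu> *\<^sub>C (I Z o\<^sub>L H X Y f)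
        + \<mu> *\<^sub>C (H Y Z g o\<^sub>L I Y) + (\<nu> * \<mu>) *\<^sub>C (I Z o\<^sub>L I Y)"
      using f unit(1) operators_clinear[OF H_operators(1)] operators_clinear[OF ident_op_operators[OF graded]]
      by (simp add: H_Comp[of X Y Z] blinfun_compose_simps blinfun_compose_scaleC_left
          blinfun_compose_scaleC_right scaleC_scaleC)
    moreover have "H X Z (Comp C g f) \<in> unital_hom 0 X Z"
      using f by (intro words_unital_hom H_words Comp_in_Hom)
    moreover have "\<nu> *\<^sub>C (I Z o\<^sub>L H X Y f) \<in> unital_hom 0 X Z"
    proof (cases "Y = Z")
      case True
      then show ?thesis
        using f by (simp add: I_left[of X] H_operators complex_vector.subspace_scale[OF unital_hom_subspace]
            words_unital_hom H_words)
    qed (use unit complex_vector.subspace_0[OF unital_hom_subspace] in simp)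
    moreover have "\<mu> *\<^sub>C (H Y Z g o\<^sub>L I Y) \<in> unital_hom 0 X Z"
    proof (cases "X = Y")
      case True
      then show ?thesis
        using f by (simp add: I_right[of Y Z] H_operators complex_vector.subspace_scale[OF unital_hom_subspace]
            words_unital_hom H_words)
    qed (use \<open>X \<noteq> Y \<longrightarrow> \<mu> = 0\<close> complex_vector.subspace_0[OF unital_hom_subspace] in simp)
    moreover have "(\<nu> * \<mu>) *\<^sub>C (I Z o\<^sub>L I Y) \<in> unital_hom 0 X Z"
    proof (cases "X = Y \<and> Y = Z")
      case True
      then show ?thesis
        using f by (simp add: I_right[of Z Z] ident_op_operators graded
            complex_vector.subspace_scale[OF unital_hom_subspace] words_unital_hom I_words)
    qed (use unit \<open>X \<noteq> Y \<longrightarrow> \<mu> = 0\<close> complex_vector.subspace_0[OF unital_hom_subspace] in auto)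
    ultimately show ?thesis
      by (simp add: complex_vector.subspace_add[OF unital_hom_subspace])
  qed
next
  case (step w j Z' Y X f)
  then show ?case
    using unital_hom_compose_d[of "A o\<^sub>L w" j Z' Z X f] by (simp add: blinfun_compose_assoc)
qed

text \<open>The identity \<open>[F, f] g = [F, f g] - f [F, g]\<close> moves an operator \<open>g\<close> to the left.\<close>

lemma words_compose_0_right:
  assumes "w \<in> words i Y Z" "A \<in> words 0 X Y"
  shows "w o\<^sub>L A \<in> unital_hom i X Z"
  using assms
proof (induction arbitrary: X A rule: words_induct)
  case (unit Y Z f \<mu>)
  then show ?case
    using words_compose_0[OF _ words_unit] by blast
next
  case (step w j V' Z Y f)
  from step.prems show ?case
  proof (cases rule: words_0E)
    case (unit g \<nu>)
    have f: "V' \<in> Obj C" "Y \<in> Obj C" "X \<in> Obj C" "f \<in> Hom C Y V'" "g \<in> Hom C X Y"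
      using step unit words_Obj by auto
    have "w \<in> unital_hom j V' Z"
      using step words_unital_hom by blast
    then have 1: "w o\<^sub>L d X V' (Comp C f g) \<in> unital_hom (Suc j) X Z"
      using f by (intro unital_hom_compose_d Comp_in_Hom)
    have "w o\<^sub>L H Y V' f \<in> unital_hom j Y Z"
      using f by (intro step.IH H_words)
    then have 2: "(w o\<^sub>L H Y V' f) o\<^sub>L d X Y g \<in> unital_hom (Suc j) X Z"
      using f by (intro unital_hom_compose_d)
    have 3: "\<nu> *\<^sub>C (w o\<^sub>L (d Y V' f o\<^sub>L I Y)) \<in> unital_hom (Suc j) X Z"
    proof (cases "X = Y")
      case True
      then show ?thesis
        using f step.hyps by (simp add: I_right[of Y V'] d_operators words_unital_hom words_step
            complex_vector.subspace_scale[OF unital_hom_subspace])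
    qed (use unit complex_vector.subspace_0[OF unital_hom_subspace] in simp)
    have "(w o\<^sub>L d Y V' f) o\<^sub>L A = (w o\<^sub>L d X V' (Comp C f g)) - ((w o\<^sub>L H Y V' f) o\<^sub>L d X Y g)
        + \<nu> *\<^sub>C (w o\<^sub>L (d Y V' f o\<^sub>L I Y))"
      using f operators_clinear[OF d_operators[of Y V' f]] words_clinear[OF step.hyps(1)]
      by (simp add: unit(1) d_Comp[of X Y V'] blinfun_compose_simps blinfun_compose_scaleC_right)
    then show ?thesis
      using 1 2 3 by (simp add: complex_vector.subspace_add[OF unital_hom_subspace]
          complex_vector.subspace_diff[OF unital_hom_subspace])
  qed
qed

lemma words_compose:
  assumes "v \<in> words j X Y" "w \<in> words i Y Z"
  shows "w o\<^sub>L v \<in> unital_hom (i + j) X Z"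
  using assms
proof (induction arbitrary: w i rule: words_induct)
  case (unit X Y f \<mu>)
  then show ?case
    using words_compose_0_right[OF _ words_unit] by simp
next
  case (step v j Z' Y X f)
  then show ?case
    using unital_hom_compose_d[of "w o\<^sub>L v" "i + j" Z' Z X f] by (simp add: blinfun_compose_assoc)
qed

lemma unital_hom_compose:
  assumes "T \<in> unital_hom j X Y" "S \<in> unital_hom i Y Z"
  shows "S o\<^sub>L T \<in> unital_hom (i + j) X Z"
  by (rule span_compose_mem[where A = "words i Y Z" and B = "words j X Y"])
     (use assms unital_hom_subspace words_compose words_clinear in \<open>auto simp: unital_hom_def\<close>)

text \<open>Commutators are closed, so the differential acts on the head alone; there it annihilates
  the unit and turns \<open>H X Y f\<close> into a commutator.\<close>

lemma words_diff:
  assumes "w \<in> words j X Y"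
  shows "\<delta> j X Y w \<in> unital_hom (Suc j) X Y"
  using assms
proof (induction rule: words_induct)
  case (unit X Y f \<mu>)
  have "\<delta> 0 X Y (H X Y f + \<mu> *\<^sub>C I Y) = d X Y f"
  proof (cases "X = Y")
    case True
    then have "\<delta> 0 X Y (I Y) = 0"
      using unit by (simp add: Omega_diff_def I_left[of Y Y] I_right[of Y Y] F_operators)
    then show ?thesis
      using unit by (simp add: diff_linear d_eq_diff)
  qed (use unit in \<open>simp add: d_eq_diff\<close>)
  then show ?case
    using unit by (simp add: words_unital_hom d_words)
next
  case (step w j Z Y X f)
  have "\<delta> (Suc j) X Y (w o\<^sub>L d X Z f) = \<delta> j Z Y w o\<^sub>L d X Z f"
    using diff_leibniz[of j "Suc 0" X Y w "d X Z f" Z] step words_Obj[OF step.hyps(1)]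
    by (simp add: diff_d)
  then show ?case
    using step unital_hom_compose_d by simp
qed

lemma unital_hom_diff:
  assumes Y: "Y \<in> Obj C" and T: "T \<in> unital_hom j X Y"
  shows "\<delta> j X Y T \<in> unital_hom (Suc j) X Y"
  using T unfolding unital_hom_def[of j]
proof (induction rule: complex_vector.span_induct_alt)
  case base
  show ?case
    using complex_vector.subspace_0[OF unital_hom_subspace] by (simp add: Omega_diff_def)
next
  case (step c x y)
  then show ?case
    by (simp add: diff_linear[OF Y] words_diff complex_vector.subspace_add[OF unital_hom_subspace]
        complex_vector.subspace_scale[OF unital_hom_subspace])
qed

text \<open>Total degree 0 is separate because \<open>unital_hom\<close> would admit the unit there;
  multiplicativity of \<open>H\<close> keeps the product in its image.\<close>

lemma Omega_hom_compose:
  assumes "X \<in> Obj C" "Y \<in> Obj C" "Z \<in> Obj C"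
    and T: "T \<in> Omega_hom C M j X Y" and S: "S \<in> Omega_hom C M i Y Z"
  shows "S o\<^sub>L T \<in> Omega_hom C M (i + j) X Z"
proof (cases "i + j")
  case 0
  then obtain f g where "f \<in> Hom C X Y" "T = H X Y f" "g \<in> Hom C Y Z" "S = H Y Z g"
    using assms Omega_hom_0E by (metis add_is_0)
  then show ?thesis
    using 0 assms H_in_Omega_hom_0[of X Z "Comp C g f"] Comp_in_Hom by (simp add: H_Comp[of X Y Z])
next
  case (Suc k)
  then show ?thesis
    using unital_hom_compose[OF Omega_hom_unital[OF _ _ T] Omega_hom_unital[OF _ _ S]] assms
    by (simp add: Omega_hom_Suc)
qed

lemma Omega_dg_semicategory: "dg_semicategory (Omega C M) \<delta>"
  unfolding dg_semicategory_def
proof (intro conjI ballI allI; (simp only: Omega_def graded_semicategory.simps)?)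
  fix X Y j assume "X \<in> Obj C" "Y \<in> Obj C"
  show "complex_vector.subspace (Omega_hom C M j X Y)"
    by (simp add: Omega_hom_def)
next
  fix X Y Z i j f g assume "X \<in> Obj C" "Y \<in> Obj C" "Z \<in> Obj C"
    "f \<in> Omega_hom C M j X Y" "g \<in> Omega_hom C M i Y Z"
  then show "g o\<^sub>L f \<in> Omega_hom C M (i + j) X Z"
    by (rule Omega_hom_compose)
next
  fix X Y Z i j f assume "X \<in> Obj C" "Y \<in> Obj C" "Z \<in> Obj C" "f \<in> Omega_hom C M j X Y"
  show "clinear_on (Omega_hom C M i Y Z) (\<lambda>g. g o\<^sub>L f)"
    by (simp add: clinear_on_def blinfun_compose_simps blinfun_compose_scaleC_left)
next
  fix X Y Z i j g assume "X \<in> Obj C" "Y \<in> Obj C" "Z \<in> Obj C" "g \<in> Omega_hom C M i Y Z"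
  then have "clinear_op g"
    using operators_clinear unital_hom_operators Omega_hom_unital by blast
  then show "clinear_on (Omega_hom C M j X Y) (\<lambda>f. g o\<^sub>L f)"
    by (simp add: clinear_on_def blinfun_compose_simps blinfun_compose_scaleC_right)
next
  fix f g h :: "'h \<Rightarrow>\<^sub>L 'h"
  show "(h o\<^sub>L g) o\<^sub>L f = h o\<^sub>L (g o\<^sub>L f)"
    by (rule blinfun_compose_assoc)
next
  fix X Y j assume XY: "X \<in> Obj C" "Y \<in> Obj C"
  then show "clinear_on (Omega_hom C M j X Y) (\<delta> j X Y)"
    by (simp add: clinear_on_def diff_linear)
  fix f assume "f \<in> Omega_hom C M j X Y"
  then have f: "f \<in> unital_hom j X Y"
    using XY Omega_hom_unital by blast
  show "\<delta> j X Y f \<in> Omega_hom C M (Suc j) X Y"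
    using unital_hom_diff[OF XY(2) f] by (simp add: Omega_hom_Suc)
  show "\<delta> (Suc j) X Y (\<delta> j X Y f) = 0"
    by (rule diff_diff[OF XY unital_hom_operators[OF XY(2) f]])
next
  fix X Y Z i j f g
  show "\<delta> (i + j) X Z (g o\<^sub>L f) = (\<delta> i Y Z g o\<^sub>L f) + (- 1) ^ i *\<^sub>R (g o\<^sub>L \<delta> j X Y f)"
    by (rule diff_leibniz)
qed

section \<open>The graded trace\<close>

text \<open>A linear space containing all trace arguments, so that their sums remain of trace class;
  \<open>Suc (2 * m)\<close> counts the commutators after differentiation.\<close>

definition trace_ideal :: "nat \<Rightarrow> 'o \<Rightarrow> ('h \<Rightarrow>\<^sub>L 'h) set" where
  "trace_ideal m X = schatten_power p (Suc (2 * m)) \<inter> operators (V X) (V X)"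

lemma trace_ideal_subspace: "X \<in> Obj C \<Longrightarrow> complex_vector.subspace (trace_ideal m X)"
  unfolding trace_ideal_def
  by (intro complex_vector.subspace_inter schatten_power_subspace operators_subspace graded)

lemma trace_ideal_schatten:
  assumes "p - 1 \<le> real (2 * m)" "T \<in> trace_ideal m X"
  shows "T \<in> schatten 1 (V X) (V X)"
  using assms schatten_power_imp_trace_class[of T p "Suc (2 * m)"] by (simp add: trace_ideal_def)

lemma strace_arg_mem:
  assumes X: "X \<in> Obj C" and T: "T \<in> unital_hom (2 * m) X X"
  shows "strace_arg M m X T \<in> trace_ideal m X"
  unfolding trace_ideal_def
proof (rule IntI)
  have T': "\<delta> (2 * m) X X T \<in> unital_hom (Suc (2 * m)) X X"
    by (rule unital_hom_diff[OF X T])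
  have EF: "\<epsilon> X o\<^sub>L F X \<in> operators (V X) (V X)"
    using operators_compose[OF F_operators(1)[OF X] grading_op_operators[OF graded[OF X]]] .
  show "strace_arg M m X T \<in> operators (V X) (V X)"
    unfolding strace_arg_def by (rule operators_compose[OF unital_hom_operators[OF X T'] EF])
  show "strace_arg M m X T \<in> schatten_power p (Suc (2 * m))"
    unfolding strace_arg_def
    using schatten_power_compose[OF schatten_power_bounded[OF operators_clinear[OF EF]]
        unital_hom_schatten_power[OF T']] by simp
qed

lemma strace_linear:
  assumes X: "X \<in> Obj C" and m: "p - 1 \<le> real (2 * m)"
  shows "clinear_on (unital_hom (2 * m) X X) (strace M m X)"
proof -
  have cl: "clinear_op (\<epsilon> X o\<^sub>L F X)"
    by (intro clinear_op_compose grading_clinear operators_clinear[OF F_operators(1)] X)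
  have mem: "strace_arg M m X T \<in> schatten 1 (V X) (V X)" if "T \<in> unital_hom (2 * m) X X" for T
    by (rule trace_ideal_schatten[OF m strace_arg_mem[OF X that]])
  have add: "strace_arg M m X (S + T) = strace_arg M m X S + strace_arg M m X T" for S T
    by (simp add: strace_arg_def diff_linear[OF X] blinfun_compose_simps)
  have scale: "strace_arg M m X (c *\<^sub>C T) = c *\<^sub>C strace_arg M m X T" for c T
    by (simp add: strace_arg_def diff_linear[OF X] blinfun_compose_scaleC_right[OF cl])
  show ?thesis
    unfolding clinear_on_def
  proof (intro conjI ballI allI)
    fix S T assume ST: "S \<in> unital_hom (2 * m) X X" "T \<in> unital_hom (2 * m) X X"
    then have "op_trace (V X) (strace_arg M m X S + strace_arg M m X T)
        = op_trace (V X) (strace_arg M m X S) + op_trace (V X) (strace_arg M m X T)"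
      using mem[OF complex_vector.subspace_add[OF unital_hom_subspace ST]]
      by (intro op_trace_add graded X mem) (auto simp: add)
    then show "strace M m X (S + T) = strace M m X S + strace M m X T"
      by (simp add: strace_def add distrib_left)
  next
    fix c T assume T: "T \<in> unital_hom (2 * m) X X"
    then have "op_trace (V X) (c *\<^sub>C strace_arg M m X T) = c * op_trace (V X) (strace_arg M m X T)"
      using mem[OF complex_vector.subspace_scale[OF unital_hom_subspace T]]
      by (intro op_trace_scaleC graded X mem) (auto simp: scale)
    then show "strace M m X (c *\<^sub>C T) = c *\<^sub>C strace M m X T"
      by (simp add: strace_def scale scaleC_complex_def)
  qed
qed

text \<open>No cancellation inside the trace is involved: the argument contains the differential
  twice and is zero. That the trace of 0 is 0 comes from homogeneity.\<close>

lemma strace_diff: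
  assumes X: "X \<in> Obj C" and T: "T \<in> operators (V X) (V X)" and k: "Suc k = 2 * m"
    and m: "p - 1 \<le> real (2 * m)"
  shows "strace M m X (\<delta> k X X T) = 0"
proof -
  have 0: "strace_arg M m X 0 = 0"
    by (simp add: strace_arg_def Omega_diff_def)
  have "strace_arg M m X (\<delta> k X X T) = 0"
    using diff_diff[OF X X T, of k] k by (simp add: strace_arg_def)
  then have "strace M m X (\<delta> k X X T) = strace M m X 0"
    by (simp add: strace_def 0)
  also have "\<dots> = 0"
    using clinear_on_scale[OF strace_linear[OF X m], of 0 0]
      complex_vector.subspace_0[OF unital_hom_subspace] by (simp add: scaleC_complex_def)
  finally show ?thesis .
qed

lemma strace_arg_compose:
  assumes XY: "X \<in> Obj C" "Y \<in> Obj C" and ij: "i + j = 2 * m"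
    and S: "S \<in> unital_hom i Y X" and T: "T \<in> unital_hom j X Y"
  shows "strace_arg M m X (S o\<^sub>L T) =
     (\<delta> i Y X S o\<^sub>L (\<epsilon> Y o\<^sub>L F Y o\<^sub>L T)) + (- 1) ^ i *\<^sub>R ((\<epsilon> X o\<^sub>L F X o\<^sub>L S) o\<^sub>L \<delta> j X Y T)"
proof -
  let ?a = "\<delta> i Y X S"
  have a: "?a \<in> unital_hom (Suc i) Y X"
    by (rule unital_hom_diff[OF XY(1) S])
  have "\<delta> (Suc i) Y X ?a = 0"
    by (rule diff_diff[OF XY(2,1) unital_hom_operators[OF XY(1) S]])
  then have Fa: "F X o\<^sub>L ?a = (- 1) ^ Suc i *\<^sub>R (?a o\<^sub>L F Y)"
    unfolding Omega_diff_def[of M "Suc i"] by (rule right_minus_eq[THEN iffD1])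
  have "\<epsilon> X o\<^sub>L F X o\<^sub>L ?a = (- 1) ^ Suc i *\<^sub>R ((\<epsilon> X o\<^sub>L ?a) o\<^sub>L F Y)"
    by (simp only: blinfun_compose_assoc Fa) (simp add: blinfun_compose_simps)
  also have "\<dots> = ?a o\<^sub>L (\<epsilon> Y o\<^sub>L F Y)"
    by (simp add: grading_unital_hom[OF XY(1) a] blinfun_compose_simps flip: power_add mult_2)
  finally have *: "\<epsilon> X o\<^sub>L F X o\<^sub>L ?a = ?a o\<^sub>L (\<epsilon> Y o\<^sub>L F Y)" .
  have "strace_arg M m X (S o\<^sub>L T) = ((\<epsilon> X o\<^sub>L F X o\<^sub>L ?a) o\<^sub>L T)
      + (- 1) ^ i *\<^sub>R ((\<epsilon> X o\<^sub>L F X o\<^sub>L S) o\<^sub>L \<delta> j X Y T)"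
    by (simp add: strace_arg_def ij[symmetric] diff_leibniz[of i j X X S T Y] blinfun_compose_simps)
  then show ?thesis
    by (simp only: *) (simp add: blinfun_compose_assoc)
qed

lemma strace_commute:
  assumes XY: "X \<in> Obj C" "Y \<in> Obj C" and ij: "i + j = 2 * m"
    and S: "S \<in> unital_hom i Y X" and T: "T \<in> unital_hom j X Y" and m: "p - 1 \<le> real (2 * m)"
  shows "strace M m X (S o\<^sub>L T) = (- 1) ^ (i * j) * strace M m Y (T o\<^sub>L S)"
proof -
  define h where "h X = \<epsilon> X o\<^sub>L F X" for X
  have h: "h X \<in> operators (V X) (V X)" if "X \<in> Obj C" for X
    using operators_compose[OF F_operators(1) grading_op_operators[OF graded]] that
    by (simp add: h_def)
  \<comment> \<open>Quantified over all objects and factors because it is used a second time with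
    the roles of \<open>S\<close> and \<open>T\<close> exchanged.\<close>
  have comm: "op_trace (V X) (\<delta> i Y X S o\<^sub>L (h Y o\<^sub>L T)) = op_trace (V Y) ((h Y o\<^sub>L T) o\<^sub>L \<delta> i Y X S)"
      and mem: "\<delta> i Y X S o\<^sub>L (h Y o\<^sub>L T) \<in> trace_ideal m X"
         "(h Y o\<^sub>L T) o\<^sub>L \<delta> i Y X S \<in> trace_ideal m Y"
    if XY: "X \<in> Obj C" "Y \<in> Obj C" and ij: "i + j = 2 * m"
    and S: "S \<in> unital_hom i Y X" and T: "T \<in> unital_hom j X Y" for X Y i j S T
  proof -
    have a: "\<delta> i Y X S \<in> unital_hom (Suc i) Y X"
      by (rule unital_hom_diff[OF XY(1) S])
    have aO: "\<delta> i Y X S \<in> operators (V Y) (V X)" "\<delta> i Y X S \<in> schatten_power p (Suc i)"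
      using unital_hom_operators[OF XY(1) a] unital_hom_schatten_power[OF a] by auto
    have hT: "h Y o\<^sub>L T \<in> operators (V X) (V Y)" "h Y o\<^sub>L T \<in> schatten_power p j"
      using operators_compose[OF unital_hom_operators[OF XY(2) T] h[OF XY(2)]]
        schatten_power_compose[OF schatten_power_bounded[OF operators_clinear[OF h[OF XY(2)]]]
          unital_hom_schatten_power[OF T]] by auto
    show 1: "\<delta> i Y X S o\<^sub>L (h Y o\<^sub>L T) \<in> trace_ideal m X"
      using schatten_power_compose[OF aO(2) hT(2)] ij operators_compose[OF hT(1) aO(1)]
      by (simp add: trace_ideal_def)
    show 2: "(h Y o\<^sub>L T) o\<^sub>L \<delta> i Y X S \<in> trace_ideal m Y"
      using schatten_power_compose[OF hT(2) aO(2)] ij operators_compose[OF aO(1) hT(1)]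
      by (simp add: trace_ideal_def add.commute)
    have "compact_operator (\<delta> i Y X S)"
      using aO(2) by (simp add: schatten_power_def)
    then show "op_trace (V X) (\<delta> i Y X S o\<^sub>L (h Y o\<^sub>L T)) = op_trace (V Y) ((h Y o\<^sub>L T) o\<^sub>L \<delta> i Y X S)"
      using op_trace_commute[OF graded[OF XY(2)] graded[OF XY(1)] aO(1) _ hT(1)
          trace_ideal_schatten[OF m 2] trace_ideal_schatten[OF m 1]] by simp
  qed
  have lin: "op_trace (V X) (A + (- 1) ^ k *\<^sub>R B) = op_trace (V X) A + (- 1) ^ k * op_trace (V X) B"
    if X: "X \<in> Obj C" and AB: "A \<in> trace_ideal m X" "B \<in> trace_ideal m X" for X A B k
  proof -
    note S = trace_ideal_subspace[OF X] and tc = trace_ideal_schatten[OF m]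
    have k: "(- 1) ^ k *\<^sub>R B = (- 1) ^ k *\<^sub>C B"
      by (simp add: scaleR_scaleC)
    have kB: "(- 1) ^ k *\<^sub>C B \<in> trace_ideal m X"
      by (rule complex_vector.subspace_scale[OF S AB(2)])
    then have "op_trace (V X) (A + (- 1) ^ k *\<^sub>C B) = op_trace (V X) A + op_trace (V X) ((- 1) ^ k *\<^sub>C B)"
      using complex_vector.subspace_add[OF S AB(1) kB] by (intro op_trace_add graded X tc AB)
    also have "op_trace (V X) ((- 1) ^ k *\<^sub>C B) = (- 1) ^ k * op_trace (V X) B"
      using kB by (intro op_trace_scaleC graded X tc AB)
    finally show ?thesis
      by (simp only: k)
  qed
  let ?\<alpha> = "op_trace (V X) (\<delta> i Y X S o\<^sub>L (h Y o\<^sub>L T))"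
  let ?\<beta> = "op_trace (V Y) (\<delta> j X Y T o\<^sub>L (h X o\<^sub>L S))"
  have ji: "j + i = 2 * m"
    using ij by simp
  have arg: "strace_arg M m X (S o\<^sub>L T) = (\<delta> i Y X S o\<^sub>L (h Y o\<^sub>L T)) + (- 1) ^ i *\<^sub>R ((h X o\<^sub>L S) o\<^sub>L \<delta> j X Y T)"
     "strace_arg M m Y (T o\<^sub>L S) = (\<delta> j X Y T o\<^sub>L (h X o\<^sub>L S)) + (- 1) ^ j *\<^sub>R ((h Y o\<^sub>L T) o\<^sub>L \<delta> i Y X S)"
    using strace_arg_compose[OF XY ij S T] strace_arg_compose[OF XY(2,1) ji T S] by (simp_all add: h_def)
  have tX: "strace M m X (S o\<^sub>L T) = 1 / 2 * (?\<alpha> + (- 1) ^ i * ?\<beta>)"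
    using lin[OF XY(1) mem(1)[OF XY ij S T] mem(2)[OF XY(2,1) ji T S], of i]
      comm[OF XY(2,1) ji T S] by (simp add: strace_def arg)
  have tY: "strace M m Y (T o\<^sub>L S) = 1 / 2 * (?\<beta> + (- 1) ^ j * ?\<alpha>)"
    using lin[OF XY(2) mem(1)[OF XY(2,1) ji T S] mem(2)[OF XY ij S T], of j]
      comm[OF XY ij S T] by (simp add: strace_def arg)
  \<comment> \<open>The degrees have equal parity. If even, both traces are half of
    \<open>?\<alpha> + ?\<beta>\<close>; if odd, they are half of
    \<open>?\<alpha> - ?\<beta>\<close> and of its negative, which is the sign demanded.\<close>
  have "even i \<longleftrightarrow> even j"
    using ij by (metis dvd_triv_left even_add)
  then show ?thesis
    unfolding tX tY by (cases "even i") (simp_all add: algebra_simps)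
qed

lemma Omega_cycle:
  assumes m: "p - 1 \<le> real (2 * m)"
  shows "cycle_over C (2 * m) (Omega C M) \<delta> (strace M m) (\<lambda>X. X) H"
  unfolding cycle_over_def
proof (intro conjI Omega_dg_semicategory)
  show "closed_graded_trace (2 * m) (Omega C M) \<delta> (strace M m)"
    unfolding closed_graded_trace_def
  proof (intro conjI ballI allI impI; simp only: Omega_def graded_semicategory.simps)
    fix X assume X: "X \<in> Obj C"
    show "clinear_on (Omega_hom C M (2 * m) X X) (strace M m X)"
      by (rule clinear_on_subset[OF strace_linear[OF X m]]) (use Omega_hom_unital X in blast)
  next
    fix X k f assume "X \<in> Obj C" "Suc k = 2 * m" "f \<in> Omega_hom C M k X X"
    then show "strace M m X (\<delta> k X X f) = 0"
      by (intro strace_diff m unital_hom_operators Omega_hom_unital)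
  next
    fix X Y i j g g' assume "X \<in> Obj C" "Y \<in> Obj C" "i + j = 2 * m"
      "g \<in> Omega_hom C M i Y X" "g' \<in> Omega_hom C M j X Y"
    then show "strace M m X (g o\<^sub>L g') = (- 1) ^ (i * j) * strace M m Y (g' o\<^sub>L g)"
      by (intro strace_commute m Omega_hom_unital)
  qed
  show "linear_semifunctor C (Omega C M) (\<lambda>X. X) H"
    unfolding linear_semifunctor_def
    by (auto simp: Omega_def H_linear H_in_Omega_hom_0 H_Comp)
qed

end

section \<open>The character is a cyclic cocycle\<close>

context fredholm_module
begin

lemma comm_word_unital_hom:
  assumes "A \<in> unital_hom i (X 1) Y" "\<And>k. 1 \<le> k \<Longrightarrow> k \<le> Suc j \<Longrightarrow> X k \<in> Obj C"
    "\<And>k. 1 \<le> k \<Longrightarrow> k \<le> j \<Longrightarrow> f k \<in> Hom C (X (Suc k)) (X k)"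
  shows "comm_word M X f A j \<in> unital_hom (i + j) (X (Suc j)) Y"
  using assms
proof (induction j)
  case (Suc j)
  then show ?case
    by (auto intro!: unital_hom_compose_d)
qed simp

lemma H_unital_hom:
  "X \<in> Obj C \<Longrightarrow> Y \<in> Obj C \<Longrightarrow> f \<in> Hom C X Y \<Longrightarrow> H X Y f \<in> unital_hom 0 X Y"
  by (intro words_unital_hom H_words)

lemma unital_hom_clinear: "Y \<in> Obj C \<Longrightarrow> T \<in> unital_hom j X Y \<Longrightarrow> clinear_op T"
  using unital_hom_operators operators_clinear by blast

text \<open>The induction peels off the last commutator. If the varied slot is that commutator,
  complex linearity of the prefix is needed; otherwise only that of composition in its left
  factor.\<close>

lemma comm_word_linear_slot:
  assumes "1 \<le> i" "i \<le> j" "A \<in> unital_hom 0 (X 1) Y" "Y \<in> Obj C"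
    and "\<And>k. 1 \<le> k \<Longrightarrow> k \<le> Suc j \<Longrightarrow> X k \<in> Obj C"
    and "\<And>k. 1 \<le> k \<Longrightarrow> k \<le> j \<Longrightarrow> f k \<in> Hom C (X (Suc k)) (X k)"
  shows "clinear_on (Hom C (X (Suc i)) (X i)) (\<lambda>g. comm_word M X (f(i := g)) A j)"
  using assms(2,5,6)
proof (induction j)
  case 0
  then show ?case using \<open>1 \<le> i\<close> by simp
next
  case (Suc j)
  show ?case
  proof (cases "i = Suc j")
    case True
    have cong: "comm_word M X (f(i := g)) A j = comm_word M X f A j" for g
      by (rule comm_word_cong) (use True in auto)
    have "comm_word M X f A j \<in> unital_hom (0 + j) (X (Suc j)) Y"
      by (rule comm_word_unital_hom) (use Suc.prems assms in auto)
    then have cl: "clinear_op (comm_word M X f A j)"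
      by (rule unital_hom_clinear[OF \<open>Y \<in> Obj C\<close>])
    have lin: "clinear_on (Hom C (X (Suc i)) (X i)) (d (X (Suc i)) (X i))"
      using Suc.prems \<open>1 \<le> i\<close> by (intro d_linear) auto
    have eq: "comm_word M X (f(i := g)) A (Suc j)
        = comm_word M X f A j o\<^sub>L d (X (Suc i)) (X i) g" for g
      using True by (simp flip: cong[of g])
    show ?thesis
      unfolding clinear_on_def eq
      by (simp add: clinear_on_add[OF lin] clinear_on_scale[OF lin] blinfun_compose_simps
          blinfun_compose_scaleC_right[OF cl])
  next
    case False
    have lin: "clinear_on (Hom C (X (Suc i)) (X i)) (\<lambda>g. comm_word M X (f(i := g)) A j)"
      by (rule Suc.IH) (use False Suc.prems in auto)
    have eq: "comm_word M X (f(i := g)) A (Suc j)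
        = comm_word M X (f(i := g)) A j o\<^sub>L d (X (Suc (Suc j))) (X (Suc j)) (f (Suc j))" for g
      using False by simp
    show ?thesis
      unfolding clinear_on_def eq
      by (intro conjI ballI allI)
         (simp_all only: clinear_on_add[OF lin] clinear_on_scale[OF lin] blinfun_compose_simps
          blinfun_compose_scaleC_left)
  qed
qed

lemma clinear_on_compose:
  assumes "clinear_on S f" "clinear_on T t" "\<And>x. x \<in> S \<Longrightarrow> f x \<in> T"
  shows "clinear_on S (\<lambda>x. t (f x))"
  using assms by (simp add: clinear_on_def)

lemma character_cochain:
  assumes m: "p - 1 \<le> real (2 * m)"
  shows "cochain C (2 * m) (character M m)"
  unfolding cochain_def
proof (intro allI impI)
  fix Xs fs i assume pt: "pure_tensor C (2 * m) Xs fs" and i: "i \<le> 2 * m"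
  define n where "n = 2 * m"
  define X where "X k = Xs ! (k mod Suc n)" for k
  have len: "length fs = Suc n"
    using pt by (simp add: pure_tensor_def n_def)
  have XO: "X k \<in> Obj C" for k
    using pt by (auto simp: pure_tensor_def X_def n_def)
  have fH: "fs ! k \<in> Hom C (X (Suc k)) (X k)" if "k \<le> n" for k
    using pt that by (simp add: pure_tensor_def X_def n_def)
  have Xn: "X (Suc n) = X 0"
    by (simp add: X_def)
  define w where "w g = comm_word M X ((!) (fs[i := g])) (H (X 1) (X 0) (fs[i := g] ! 0)) n" for g
  have ch: "character M m Xs (fs[i := g]) = strace M m (X 0) (w g)" for g
    by (simp add: character_def w_def X_def[abs_def] n_def Let_def)
  let ?S = "Hom C (X (Suc i)) (X i)"
  have w_mem: "w g \<in> unital_hom (2 * m) (X 0) (X 0)" if g: "g \<in> ?S" for g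
  proof -
    have gH: "fs[i := g] ! k \<in> Hom C (X (Suc k)) (X k)" if "k \<le> n" for k
      using g fH[OF that] by (cases "k = i") (use i len in \<open>auto simp: n_def\<close>)
    have "w g \<in> unital_hom (0 + n) (X (Suc n)) (X 0)"
      unfolding w_def
      by (rule comm_word_unital_hom) (use XO gH[of 0] gH in \<open>auto intro!: H_unital_hom\<close>)
    then show ?thesis
      using Xn unfolding n_def by simp
  qed
  have "clinear_on ?S w"
  \<comment> \<open>Slot 0 enters through \<open>H\<close> as the head of the word, every other slot
    through a commutator.\<close>
  proof (cases "i = 0")
    case True
    have "w g = comm_word M X ((!) fs) (H (X 1) (X 0) g) n" for g
    proof -
      have "comm_word M X ((!) (fs[i := g])) A n = comm_word M X ((!) fs) A n" for A
        by (rule comm_word_cong) (use True in auto)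
      then show ?thesis
        using True len by (simp add: w_def)
    qed
    then show ?thesis
      using H_linear[OF XO XO, of 1 0] True
      by (simp add: clinear_on_def comm_word_add comm_word_scaleC)
  next
    case False
    have "(!) (fs[i := g]) = ((!) fs)(i := g)" for g
      using i len by (auto simp: fun_eq_iff nth_list_update n_def)
    then have "w g = comm_word M X (((!) fs)(i := g)) (H (X 1) (X 0) (fs ! 0)) n" for g
      using False by (simp add: w_def)
    moreover have "clinear_on ?S (\<lambda>g. comm_word M X (((!) fs)(i := g)) (H (X 1) (X 0) (fs ! 0)) n)"
      by (rule comm_word_linear_slot[where Y = "X 0"])
         (use False i XO fH[of 0] fH in \<open>auto simp: n_def intro!: H_unital_hom\<close>)
    ultimately show ?thesis
      by presburger
  qed
  then have "clinear_on ?S (\<lambda>g. strace M m (X 0) (w g))"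
    by (rule clinear_on_compose[OF _ strace_linear[OF XO m] w_mem])
  moreover have "X i = Xs ! i" "X (Suc i) = Xs ! (Suc i mod Suc (2 * m))"
    using i by (auto simp: X_def n_def)
  ultimately show "clinear_on (Hom C (Xs ! (Suc i mod Suc (2 * m))) (Xs ! i))
      (\<lambda>g. character M m Xs (fs[i := g]))"
    by (simp add: ch)
qed

lemma pure_tensor_simps:
  assumes "pure_tensor C n Xs fs"
  defines "X \<equiv> \<lambda>k. Xs ! (k mod Suc n)"
  shows "length Xs = Suc n" "length fs = Suc n" "X k \<in> Obj C"
    "k \<le> n \<Longrightarrow> fs ! k \<in> Hom C (X (Suc k)) (X k)" "X (Suc n) = X 0"
  using assms by (auto simp: pure_tensor_def)

text \<open>With \<open>P i = f\<^sup>0 [F, f\<^sup>1] \<cdots> [F, f\<^sup>i]\<close>, write \<open>W i\<close> for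
  \<open>P i f\<^sup>i\<^sup>+\<^sup>1 [F, f\<^sup>i\<^sup>+\<^sup>2] \<cdots> [F, f\<^sup>n\<^sup>+\<^sup>1]\<close>.  By the Leibniz rule the \<open>i\<close>-th term of the coboundary
  comes from \<open>W i + W (i - 1)\<close>, so the alternating sum telescopes to \<open>W n\<close>, and the
  last term cancels this by the trace property.\<close>

lemma character_hochschild:
  assumes m: "p - 1 \<le> real (2 * m)" and pt: "pure_tensor C (Suc (2 * m)) Xs fs"
  shows "hochschild_b C (2 * m) (character M m) Xs fs = 0"
proof -
  define n where "n = 2 * m"
  define X where "X k = Xs ! (k mod Suc (Suc n))" for k
  define f where "f k = fs ! k" for k
  have len: "length Xs = Suc (Suc n)" "length fs = Suc (Suc n)"
    and XO: "\<And>k. X k \<in> Obj C" and fH: "\<And>k. k \<le> Suc n \<Longrightarrow> f k \<in> Hom C (X (Suc k)) (X k)"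
    and Xn: "X (Suc (Suc n)) = X 0"
    using pure_tensor_simps[OF pt] by (auto simp: X_def f_def n_def)
  have Xs_nth: "Xs ! k = X k" if "k \<le> Suc n" for k
    using that by (simp add: X_def)
  define P where "P j = comm_word M X f (H (X 1) (X 0) (f 0)) j" for j
  define U where "U i = P i o\<^sub>L H (X (Suc (Suc i))) (X (Suc i)) (f (Suc i))" for i
  \<comment> \<open>\<open>A\<close> followed by the commutators of \<open>f (i + 1)\<close> up to
    \<open>f (i + l)\<close>; shifting the families allows a word to be cut in the middle.\<close>
  define Q where "Q i A l = comm_word M (\<lambda>k. X (k + i)) (\<lambda>k. f (k + i)) A l" for i A l
  define W where "W i = Q (Suc i) (U i) (n - i)" for i
  have P_mem: "P j \<in> unital_hom j (X (Suc j)) (X 0)" if "j \<le> Suc n" for j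
    using comm_word_unital_hom[of "H (X 1) (X 0) (f 0)" 0 X "X 0" j f] that XO fH fH[of 0]
    by (simp add: P_def H_unital_hom)
  have U_mem: "U i \<in> unital_hom i (X (Suc (Suc i))) (X 0)" if "i \<le> n" for i
    using unital_hom_compose[OF H_unital_hom P_mem, of "X (Suc (Suc i))" i "f (Suc i)"] XO fH[of "Suc i"] that
    by (simp add: U_def)
  have W_mem: "W i \<in> unital_hom n (X 0) (X 0)" if "i \<le> n" for i
  proof -
    have "Q (Suc i) (U i) (n - i) \<in> unital_hom (i + (n - i)) (X (Suc (n - i) + Suc i)) (X 0)"
      unfolding Q_def by (rule comm_word_unital_hom) (use U_mem[OF that] XO fH that in auto)
    then show ?thesis
      using that by (simp add: W_def Xn)
  qed
  define \<tau> where "\<tau> = strace M m (X 0)"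
  have \<tau>_add: "\<tau> (S + T) = \<tau> S + \<tau> T" if "S \<in> unital_hom n (X 0) (X 0)" "T \<in> unital_hom n (X 0) (X 0)" for S T
    using clinear_on_add[OF strace_linear[OF XO m]] that by (simp add: \<tau>_def n_def)
  define t where "t i = character M m (take (Suc i) Xs @ drop (Suc (Suc i)) Xs)
      (take i fs @ Comp C (fs ! i) (fs ! Suc i) # drop (Suc (Suc i)) fs)" for i
  \<comment> \<open>For \<open>i = 0\<close> the product stands in the head, where \<open>H\<close>
    is multiplicative and gives one term; elsewhere it stands in a commutator and gives two.\<close>
  have t: "t i = (if i = 0 then \<tau> (W 0) else \<tau> (W i) + \<tau> (W (i - 1)))" if i: "i \<le> n" for i
  proof -
    define Xs' where "Xs' = take (Suc i) Xs @ drop (Suc (Suc i)) Xs"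
    define fs' where "fs' = take i fs @ Comp C (fs ! i) (fs ! Suc i) # drop (Suc (Suc i)) fs"
    define X' where "X' k = Xs' ! (k mod Suc n)" for k
    \<comment> \<open>The face drops the object between the composed arrows. At
      \<open>k = Suc n\<close> the index wraps around, and both sides are
      \<open>X 0\<close>.\<close>
    have X': "X' k = (if k \<le> i then X k else X (Suc k))" if "k \<le> Suc n" for k
    proof (cases "k = Suc n")
      case True
      then have "X' k = Xs ! 0"
        using len by (simp add: X'_def Xs'_def nth_append)
      then show ?thesis
        using True i Xn by (simp add: Xs_nth)
    next
      case False
      then have "X' k = Xs' ! k"
        using that by (simp add: X'_def)
      also have "\<dots> = (if k \<le> i then Xs ! k else Xs ! Suc k)"
        using len i that False by (auto simp: Xs'_def nth_append min_def)
      finally show ?thesis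
        using that False by (simp add: Xs_nth)
    qed
    have f': "fs' ! k = (if k < i then f k else if k = i then Comp C (f i) (f (Suc i)) else f (Suc k))"
      if "k \<le> n" for k
      using len i that by (auto simp: fs'_def nth_append f_def min_def nth_Cons')
    have t_eq: "t i = strace M m (X' 0) (comm_word M X' ((!) fs') (H (X' 1) (X' 0) (fs' ! 0)) n)"
      by (simp add: t_def character_def Let_def X'_def[abs_def] Xs'_def fs'_def n_def)
    have X'0: "X' 0 = X 0"
      by (simp add: X')
    show ?thesis
    proof (cases i)
      case 0
      have "H (X' 1) (X' 0) (fs' ! 0) = U 0"
        using X' f' 0 H_Comp[OF XO XO XO, of "f 1" 2 1 "f 0" 0] fH[of 0] fH[of 1]
        by (simp add: U_def P_def numeral_2_eq_2)
      moreover have "comm_word M X' ((!) fs') A n = Q 1 A n" for A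
        unfolding Q_def by (rule comm_word_cong) (use X' f' 0 in auto)
      ultimately show ?thesis
        unfolding t_eq using 0 X'0 by (simp add: W_def \<tau>_def)
    next
      case (Suc l)
      let ?A = "H (X' 1) (X' 0) (fs' ! 0)"
      have A: "?A = H (X 1) (X 0) (f 0)"
        using X' f' Suc i by simp
      have P': "comm_word M X' ((!) fs') ?A l = P l"
        unfolding A P_def by (rule comm_word_cong) (use X' f' Suc i in auto)
      have "comm_word M X' ((!) fs') ?A i = P l o\<^sub>L d (X (Suc (Suc i))) (X i) (Comp C (f i) (f (Suc i)))"
        using Suc i X'[of "Suc i"] X'[of i] f'[of i] by (simp add: P'[unfolded One_nat_def])
      also have "\<dots> = U i + (U l o\<^sub>L d (X (Suc (Suc i))) (X (Suc i)) (f (Suc i)))"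
        using Suc i d_Comp[OF XO XO XO fH fH, of i]
        by (simp add: U_def P_def blinfun_compose_simps)
      finally have inner: "comm_word M X' ((!) fs') ?A i
          = U i + (U l o\<^sub>L d (X (Suc (Suc i))) (X (Suc i)) (f (Suc i)))" .
      have "comm_word M X' ((!) fs') ?A n = comm_word M X' ((!) fs') ?A (i + (n - i))"
        using i by simp
      also have "\<dots> = comm_word M (\<lambda>k. X' (k + i)) (\<lambda>k. fs' ! (k + i)) (comm_word M X' ((!) fs') ?A i) (n - i)"
        by (rule comm_word_split)
      also have "\<dots> = Q (Suc i) (comm_word M X' ((!) fs') ?A i) (n - i)"
        unfolding Q_def by (rule comm_word_cong) (use X' f' i in auto)
      also have "\<dots> = W i + Q (Suc i) (U l o\<^sub>L d (X (Suc (Suc i))) (X (Suc i)) (f (Suc i))) (n - i)"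
        unfolding inner W_def by (simp add: Q_def comm_word_add)
      \<comment> \<open>The trailing commutator of \<open>f (Suc i)\<close> is the first one in the
        tail of \<open>W l\<close>, hence the cut of that tail as
        \<open>1 + (n - i)\<close>.\<close>
      also have "Q (Suc i) (U l o\<^sub>L d (X (Suc (Suc i))) (X (Suc i)) (f (Suc i))) (n - i) = W l"
      proof -
        have "n - l = 1 + (n - i)"
          using Suc i by simp
        then show ?thesis
          unfolding W_def Q_def using Suc
          by (simp only: comm_word_split) (simp add: add.assoc)
      qed
      finally have "comm_word M X' ((!) fs') ?A n = W i + W l" .
      then show ?thesis
        unfolding t_eq X'0 using Suc i \<tau>_add W_mem by (simp add: \<tau>_def[symmetric])
    qed
  qed
  have sum: "(\<Sum>i\<le>k. (- 1) ^ i * t i) = (- 1) ^ k * \<tau> (W k)" if "k \<le> n" for k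
    using that by (induction k) (auto simp: t algebra_simps)
  have last: "character M m (last Xs # butlast (tl Xs)) (Comp C (last fs) (hd fs) # butlast (tl fs)) = \<tau> (W n)"
  proof -
    define Xs' where "Xs' = last Xs # butlast (tl Xs)"
    define fs' where "fs' = Comp C (last fs) (hd fs) # butlast (tl fs)"
    define X' where "X' k = Xs' ! (k mod Suc n)" for k
    have ne: "Xs \<noteq> []" "fs \<noteq> []"
      using len by auto
    have X'0: "X' 0 = X (Suc n)"
      using ne len by (simp add: X'_def Xs'_def last_conv_nth Xs_nth)
    have X': "X' k = X k" if "1 \<le> k" "k \<le> Suc n" for k
    proof (cases "k = Suc n")
      case True
      then show ?thesis
        using X'0 by (simp add: X'_def)
    next
      case False
      then show ?thesis
        using that len by (cases k) (auto simp: X'_def Xs'_def nth_butlast nth_tl Xs_nth)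
    qed
    have f': "fs' ! k = f k" if "1 \<le> k" "k \<le> n" for k
      using that len by (cases k) (auto simp: fs'_def nth_butlast nth_tl f_def)
    have f'0: "fs' ! 0 = Comp C (f (Suc n)) (f 0)"
      using ne len by (simp add: fs'_def f_def last_conv_nth hd_conv_nth)
    let ?H = "H (X (Suc (Suc n))) (X (Suc n)) (f (Suc n))"
    have "H (X' 1) (X' 0) (fs' ! 0) = ?H o\<^sub>L H (X 1) (X 0) (f 0)"
      using H_Comp[OF XO XO XO, of "f 0" 1 0 "f (Suc n)" "Suc n"] fH[of 0] fH[of "Suc n"]
      by (simp add: X' X'0 f'0 Xn)
    then have "comm_word M X' ((!) fs') (H (X' 1) (X' 0) (fs' ! 0)) n = ?H o\<^sub>L P n"
      unfolding P_def comm_word_left[symmetric] by (simp only:) (rule comm_word_cong; simp add: X' f')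
    then have "character M m Xs' fs' = strace M m (X (Suc n)) (?H o\<^sub>L P n)"
      unfolding character_def Let_def n_def[symmetric] X'_def[symmetric] by (simp add: X'0)
    \<comment> \<open>\<open>?H\<close> has degree 0, so it passes around the trace without a sign,
      and the base object changes from \<open>X (Suc n)\<close> to \<open>X 0\<close>.\<close>
    also have "\<dots> = strace M m (X 0) (P n o\<^sub>L ?H)"
      using strace_commute[OF XO XO, of 0 n m ?H 0 "Suc n" "P n"] m P_mem[of n]
        H_unital_hom[OF XO XO fH, of "Suc n"] by (simp add: n_def[symmetric] Xn)
    also have "P n o\<^sub>L ?H = W n"
      by (simp add: W_def Q_def U_def)
    finally show ?thesis
      by (simp add: Xs'_def fs'_def \<tau>_def)
  qed
  show ?thesis
    unfolding hochschild_b_def n_def[symmetric] last t_def[symmetric] sum[OF order_refl] by simp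
qed

text \<open>With \<open>P = f\<^sup>0 [F, f\<^sup>1] \<cdots> [F, f\<^sup>n\<^sup>-\<^sup>1]\<close>, the boundary of \<open>P f\<^sup>n\<close> has vanishing trace; for even \<open>n\<close>
  it is the difference of \<open>[F, f\<^sup>0] \<cdots> [F, f\<^sup>n\<^sup>-\<^sup>1] f\<^sup>n\<close> and \<open>P [F, f\<^sup>n]\<close>.\<close>

lemma character_cyclic:
  assumes m: "p - 1 \<le> real (2 * m)" and pt: "pure_tensor C (2 * m) Xs fs"
  shows "cyclic_op (2 * m) (character M m) Xs fs = character M m Xs fs"
\<comment> \<open>For \<open>m = 0\<close> there is no element of degree \<open>2 * m - 1\<close> to
  differentiate, but rotating a single entry changes nothing.\<close>
proof (cases m)
  case 0
  then obtain Y g where "Xs = [Y]" "fs = [g]"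
    using pt by (auto simp: pure_tensor_def length_Suc_conv)
  then show ?thesis
    using 0 by (simp add: cyclic_op_def)
next
  case (Suc m')
  define l where "l = Suc (2 * m')"
  have l: "2 * m = Suc l"
    using Suc by (simp add: l_def)
  define X where "X k = Xs ! (k mod Suc (Suc l))" for k
  define f where "f k = fs ! k" for k
  have len: "length Xs = Suc (Suc l)" "length fs = Suc (Suc l)"
    and XO: "\<And>k. X k \<in> Obj C" and fH: "\<And>k. k \<le> Suc l \<Longrightarrow> f k \<in> Hom C (X (Suc k)) (X k)"
    and Xn: "X (Suc (Suc l)) = X 0"
    using pure_tensor_simps[OF pt] by (auto simp: X_def f_def l)
  have Xs_nth: "Xs ! k = X k" if "k \<le> Suc l" for k
    using that by (simp add: X_def)
  define P where "P j = comm_word M X f (H (X 1) (X 0) (f 0)) j" for j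
  define D where "D j = comm_word M X f (d (X 1) (X 0) (f 0)) j" for j
  let ?g = "H (X 0) (X (Suc l)) (f (Suc l))"
  have P_mem: "P j \<in> unital_hom j (X (Suc j)) (X 0)" if "j \<le> l" for j
    using comm_word_unital_hom[of "H (X 1) (X 0) (f 0)" 0 X "X 0" j f] that XO fH fH[of 0]
    by (simp add: P_def H_unital_hom)
  have g: "?g \<in> unital_hom 0 (X 0) (X (Suc l))"
    using H_unital_hom[OF XO XO fH, of "Suc l"] by (simp add: Xn)
  \<comment> \<open>The differential passes over the closed commutators and only turns the leading
    \<open>H\<close> into a commutator.\<close>
  have dP: "\<delta> j (X (Suc j)) (X 0) (P j) = D j" if "j \<le> l" for j
    using that
  proof (induction j)
    case 0
    then show ?case
      by (simp add: P_def D_def d_eq_diff)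
  next
    case (Suc j)
    have "\<delta> (j + Suc 0) (X (Suc (Suc j))) (X 0) (P (Suc j))
        = \<delta> j (X (Suc j)) (X 0) (P j) o\<^sub>L d (X (Suc (Suc j))) (X (Suc j)) (f (Suc j))"
      unfolding P_def comm_word.simps
      using diff_d[OF XO XO fH, of "Suc j"] Suc.prems
      by (subst diff_leibniz[where Y = "X (Suc j)"]) simp
    then show ?case
      using Suc by (simp add: D_def)
  qed
  have D_mem: "D l \<in> unital_hom (Suc l) (X (Suc l)) (X 0)"
    using unital_hom_diff[OF XO P_mem[OF order_refl]] dP[of l] by simp
  have "character M m (last Xs # butlast Xs) (last fs # butlast fs) = strace M m (X (Suc l)) (?g o\<^sub>L D l)"
  proof -
    define Xs' where "Xs' = last Xs # butlast Xs"
    define fs' where "fs' = last fs # butlast fs"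
    define X' where "X' k = Xs' ! (k mod Suc (Suc l))" for k
    have ne: "Xs \<noteq> []" "fs \<noteq> []"
      using len by auto
    have X'0: "X' 0 = X (Suc l)"
      using ne len by (simp add: X'_def Xs'_def last_conv_nth Xs_nth)
    have X': "X' (Suc k) = X k" if "k \<le> Suc l" for k
    proof (cases "k = Suc l")
      case True
      then show ?thesis
        using X'0 by (simp add: X'_def)
    next
      case False
      then show ?thesis
        using that len by (simp add: X'_def Xs'_def nth_butlast Xs_nth)
    qed
    have f': "fs' ! Suc k = f k" if "k \<le> l" for k
      using that len by (simp add: fs'_def nth_butlast f_def)
    have f'0: "fs' ! 0 = f (Suc l)"
      using ne len by (simp add: fs'_def f_def last_conv_nth)
    have "comm_word M X' ((!) fs') (H (X' 1) (X' 0) (fs' ! 0)) (1 + l)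
        = comm_word M (\<lambda>k. X' (k + 1)) (\<lambda>k. fs' ! (k + 1))
            (comm_word M X' ((!) fs') (H (X' 1) (X' 0) (fs' ! 0)) 1) l"
      by (rule comm_word_split)
    also have "\<dots> = comm_word M X f (comm_word M X' ((!) fs') (H (X' 1) (X' 0) (fs' ! 0)) 1) l"
      by (rule comm_word_cong) (simp_all add: X' f')
    also have "comm_word M X' ((!) fs') (H (X' 1) (X' 0) (fs' ! 0)) 1 = ?g o\<^sub>L d (X 1) (X 0) (f 0)"
      using X'[of 0] X'[of 1] f'[of 0] by (simp add: X'0 f'0)
    also have "comm_word M X f \<dots> l = ?g o\<^sub>L D l"
      by (simp add: D_def comm_word_left)
    finally show ?thesis
      unfolding Xs'_def[symmetric] fs'_def[symmetric] character_def Let_def l X'_def[symmetric]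
      by (simp add: X'0)
  qed
  also have "\<dots> = strace M m (X 0) (D l o\<^sub>L ?g)"
    using strace_commute[OF XO XO _ g D_mem m] l by simp
  also have "\<dots> = strace M m (X 0) (P (Suc l))"
  proof -
    have Pg: "P l o\<^sub>L ?g \<in> unital_hom l (X 0) (X 0)"
      using unital_hom_compose[OF g P_mem[OF order_refl]] by simp
    have "\<delta> l (X 0) (X 0) (P l o\<^sub>L ?g) = (D l o\<^sub>L ?g) + (- 1) ^ l *\<^sub>R P (Suc l)"
      using diff_leibniz[of l 0 "X 0" "X 0" "P l" ?g "X (Suc l)"] dP[of l]
      by (simp add: P_def d_eq_diff Xn)
    \<comment> \<open>\<open>l\<close> is odd, so the Leibniz sign is negative and
      \<open>P (Suc l)\<close> appears with a plus after rearrangement.\<close>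
    then have eq: "D l o\<^sub>L ?g = \<delta> l (X 0) (X 0) (P l o\<^sub>L ?g) + P (Suc l)"
      by (simp add: l_def)
    have 1: "\<delta> l (X 0) (X 0) (P l o\<^sub>L ?g) \<in> unital_hom (2 * m) (X 0) (X 0)"
      using unital_hom_diff[OF XO Pg] l by simp
    have "D l o\<^sub>L ?g \<in> unital_hom (2 * m) (X 0) (X 0)"
      using unital_hom_compose[OF g D_mem] l by simp
    then have 2: "P (Suc l) \<in> unital_hom (2 * m) (X 0) (X 0)"
      using complex_vector.subspace_diff[OF unital_hom_subspace _ 1] unfolding eq by fastforce
    have "strace M m (X 0) (\<delta> l (X 0) (X 0) (P l o\<^sub>L ?g)) = 0"
      using l by (intro strace_diff XO m unital_hom_operators[OF XO Pg]) simp
    then show ?thesis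
      unfolding eq using clinear_on_add[OF strace_linear[OF XO m] 1 2] by simp
  qed
  also have "\<dots> = character M m Xs fs"
    by (simp add: character_def Let_def l P_def X_def[abs_def] f_def[abs_def])
  finally show ?thesis
    by (simp add: cyclic_op_def)
qed

end

text \<open>The first conjunct certifies that every graded trace in the other two is the trace of a
  trace class operator, so the unspecified case of \<open>op_trace\<close> never arises.\<close>

theorem theorem6p4:
  fixes C :: "('o, 'a::complex_vector) category"
    and M :: "('o, 'a, 'h::complex_hilbert_space) fredholm_data"
    and p :: real and m :: nat
  assumes "linear_category C"
    and "1 \<le> p"
    and "even_fredholm_module p C M"
    and "real (2 * m) \<ge> p - 1"
  shows "(\<forall>X\<in>Obj C. \<forall>T\<in>Omega_hom C M (2 * m) X X.
            strace_arg M m X T \<in> schatten 1 (Hsp M X) (Hsp M X)) \<and>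
         cycle_over C (2 * m) (Omega C M) (Omega_diff M) (strace M m) (\<lambda>X. X) (Hmap M) \<and>
         cyclic_cocycle C (2 * m) (character M m)"
proof -
  interpret fredholm_module C M p
    using assms by unfold_locales
  note m = assms(4)
  show ?thesis
    using trace_ideal_schatten[OF m strace_arg_mem] Omega_hom_unital Omega_cycle[OF m]
      character_cochain[OF m] character_hochschild[OF m] character_cyclic[OF m]
    unfolding cyclic_cocycle_def by blast
qed

end
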